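(* Let $D\subset\check D$ be a Mumford–Tate domain and let $(V,W_\bullet(N),F^\bullet)$ be a limiting mixed Hodge structure for $D$. If $(V,W_\bullet(N),F^\bullet)$ is of Hodge–Tate type, then its reduced limit period $F^\bullet_\infty$ is a point in the closed $G_{\mathbb R}$-orbit of $\check D$.
   Context: A polarized Hodge structure of weight $n$ is $(V,Q,F^\bullet)$ with $V$ a real vector space (with rational structure), $Q$ a nondegenerate $(-1)^n$-symmetric bilinear form, and $F^n\subset\dots\subset F^0=V_{\mathbb C}$ with $F^p\oplus\overline{F^{n-p+1}}=V_{\mathbb C}$, $Q(F^p,F^{n-p+1})=0$, and $Q(Cv,\bar v)>0$ for $v\neq0$, where $C=i^{p-q}$ on $V^{p,q}=F^p\cap\overline{F^q}$. A Mumford–Tate domain $D=G_{\mathbb R}/R$ is the $G_{\mathbb R}$-orbit of a polarized Hodge structure $(V,Q,F^\bullet)$ of weight $n$ whose Mumford–Tate group is $G$ and whose stabilizer in $G_{\mathbb R}$ is the compact group $R$. Here $G_{\mathbb R}$ is a connected real form of the complex semisimple group $G_{\mathbb C}$, and $\mathfrak g\subset\mathrm{End}(V,Q)$. $D$ is open in its compact dual $\check D=G_{\mathbb C}/P$, the $G_{\mathbb C}$-orbit of $F^\bullet$ in the variety of $Q$-isotropic filtrations. $\check D$ contains a unique closed $G_{\mathbb R}$-orbit. A nilpotent orbit is a pair $(F^\bullet,N)$ with $F^\bullet\in\check D$, $N\in\mathfrak g_{\mathbb R}$ nilpotent, $e^{zN}F^\bullet\in D$ for $\mathrm{Im}(z)\gg0$,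 and $N(F^p)\subset F^{p-1}$. The associated limiting mixed Hodge structure is $(V,W_\bullet(N),F^\bullet)$, where $W_\bullet(N)$ is the monodromy weight filtration of $N$ on $V$ centered at $n$. All limiting mixed Hodge structures are of this form. Its reduced limit period is $F^\bullet_\infty=\lim_{\mathrm{Im}(z)\to\infty}e^{zN}F^\bullet\in\check D$. The Deligne splitting $V_{\mathbb C}=\bigoplus I^{p,q}$ is the unique bigrading with $W_k=\bigoplus_{p+q\le k}I^{p,q}$, $F^p=\bigoplus_{r\ge p}I^{r,\bullet}$ and $\overline{I^{p,q}}\equiv I^{q,p}$ modulo $\bigoplus_{r<q,\,s<p}I^{r,s}$. The limiting mixed Hodge structure is of Hodge–Tate type if $I^{p,q}=0$ for all $p\neq q$. *)

theory Defs
  imports "HOL-Analysis.Analysis"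
begin

text \<open>
  After the choice of a rational basis, the rational structure of \<open>V\<close> is that of \<open>V = \<real>\<^sup>m\<close>
  given by the vectors with rational entries, and \<open>V\<^sub>\<complex> = \<complex>\<^sup>m\<close>; here \<open>m = CARD('m)\<close> is arbitrary.
  Complex subspaces are those of the library vector space with scalar multiplication
  \<open>(*s)\<close>; real ones those of the class \<open>real_vector\<close>.
\<close>

section \<open>The complexification\<close>

definition Re_vec :: "complex^'m \<Rightarrow> real^'m" where
  "Re_vec v = (\<chi> i. Re (v $ i))"

definition Im_vec :: "complex^'m \<Rightarrow> real^'m" where
  "Im_vec v = (\<chi> i. Im (v $ i))"

definition cnj_vec :: "complex^'m \<Rightarrow> complex^'m" where
  "cnj_vec v = (\<chi> i. cnj (v $ i))"

definition complexify_subspace :: "(real^'m) set \<Rightarrow> (complex^'m) set" where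
  "complexify_subspace U = {v. Re_vec v \<in> U \<and> Im_vec v \<in> U}"

abbreviation complexify_matrix :: "real^'m^'m \<Rightarrow> complex^'m^'m" where
  "complexify_matrix A \<equiv> map_matrix complex_of_real A"

text \<open>The \<open>\<complex>\<close>-bilinear (not sesquilinear) extension of \<open>Q\<close> to \<open>V\<^sub>\<complex>\<close>.\<close>

definition complexify_form ::
  "(real^'m \<Rightarrow> real^'m \<Rightarrow> real) \<Rightarrow> complex^'m \<Rightarrow> complex^'m \<Rightarrow> complex" where
  "complexify_form Q u v =
     Complex (Q (Re_vec u) (Re_vec v) - Q (Im_vec u) (Im_vec v))
             (Q (Re_vec u) (Im_vec v) + Q (Im_vec u) (Re_vec v))"

section \<open>Matrices\<close>

primrec mat_pow :: "'a::comm_ring_1^'m^'m \<Rightarrow> nat \<Rightarrow> 'a^'m^'m" where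
  "mat_pow A 0 = mat 1"
| "mat_pow A (Suc k) = A ** mat_pow A k"

definition nilpotent_mat :: "'a::comm_ring_1^'m^'m \<Rightarrow> bool" where
  "nilpotent_mat A \<longleftrightarrow> (\<exists>k. mat_pow A k = 0)"

definition mat_exp :: "complex^'m^'m \<Rightarrow> complex^'m^'m" where
  "mat_exp A = (\<Sum>k. inverse (fact k) *\<^sub>R mat_pow A k)"

abbreviation mat_cscale :: "complex \<Rightarrow> complex^'m^'m \<Rightarrow> complex^'m^'m" where
  "mat_cscale z A \<equiv> map_matrix ((*) z) A"

definition lie_bracket :: "complex^'m^'m \<Rightarrow> complex^'m^'m \<Rightarrow> complex^'m^'m" where
  "lie_bracket X Y = X ** Y - Y ** X"

section \<open>Polarized Hodge structures\<close>

text \<open>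
  \<open>Q\<close> is not required to be rational: its compatibility with the Mumford-Tate group is the
  condition \<open>\<gg> \<subseteq> End(V,Q)\<close> below, which holds automatically for rational \<open>Q\<close>.
  Filtrations are indexed by all integers, with \<open>F\<^sup>p = V\<^sub>\<complex>\<close> for \<open>p \<le> 0\<close> and \<open>F\<^sup>p = 0\<close> for \<open>p > n\<close>.
\<close>

type_synonym 'm filtration = "int \<Rightarrow> (complex^'m) set"

definition hodge_component :: "nat \<Rightarrow> 'm::finite filtration \<Rightarrow> int \<Rightarrow> (complex^'m) set" where
  "hodge_component n F p = F p \<inter> cnj_vec ` F (int n - p)"

text \<open>
  \<open>hodge_circle n F z\<close> is the operator acting on \<open>V\<^sup>p\<^sup>,\<^sup>q\<close>, \<open>q = n - p\<close>, as \<open>z\<^sup>p\<^sup>-\<^sup>q\<close>. It is well-defined when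
  \<open>V\<^sub>\<complex>\<close> is the direct sum of the \<open>V\<^sup>p\<^sup>,\<^sup>q\<close>. For \<open>z = \<i>\<close> it is the Weil operator \<open>C\<close>.
\<close>

definition hodge_circle :: "nat \<Rightarrow> 'm::finite filtration \<Rightarrow> complex \<Rightarrow> complex^'m^'m" where
  "hodge_circle n F z =
     (THE A. \<forall>p. \<forall>v \<in> hodge_component n F p. A *v v = (z powi (p - (int n - p))) *s v)"

definition hodge_filtration :: "nat \<Rightarrow> 'm::finite filtration \<Rightarrow> bool" where
  "hodge_filtration n F \<longleftrightarrow>
     (\<forall>p. vec.subspace (F p)) \<and> (\<forall>p. F (p + 1) \<subseteq> F p) \<and>
     (\<forall>p \<le> 0. F p = UNIV) \<and> (\<forall>p > int n. F p = {0}) \<and>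
     (\<forall>p. F p \<inter> cnj_vec ` F (int n - p + 1) = {0} \<and>
          {u + v |u v. u \<in> F p \<and> v \<in> cnj_vec ` F (int n - p + 1)} = UNIV)"

definition polarized_hodge_structure ::
  "nat \<Rightarrow> (real^'m \<Rightarrow> real^'m \<Rightarrow> real) \<Rightarrow> 'm::finite filtration \<Rightarrow> bool" where
  "polarized_hodge_structure n Q F \<longleftrightarrow>
     bilinear Q \<and> (\<forall>u v. Q v u = (- 1) ^ n * Q u v) \<and>
     (\<forall>u. (\<forall>v. Q u v = 0) \<longrightarrow> u = 0) \<and>
     hodge_filtration n F \<and>
     (\<forall>p. \<forall>u \<in> F p. \<forall>v \<in> F (int n - p + 1). complexify_form Q u v = 0) \<and>
     (\<forall>v. v \<noteq> 0 \<longrightarrow>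
        (let h = complexify_form Q (hodge_circle n F \<i> *v v) (cnj_vec v) in h \<in> \<real> \<and> Re h > 0))"

section \<open>Mumford-Tate groups\<close>

text \<open>Polynomial functions with rational coefficients in the matrix entries.\<close>

inductive_set rat_poly_funs :: "(complex^'m^'m \<Rightarrow> complex) set" where
  const: "(\<lambda>A. of_rat c) \<in> rat_poly_funs"
| coord: "(\<lambda>A. A $ i $ j) \<in> rat_poly_funs"
| add: "f \<in> rat_poly_funs \<Longrightarrow> g \<in> rat_poly_funs \<Longrightarrow> (\<lambda>A. f A + g A) \<in> rat_poly_funs"
| mult: "f \<in> rat_poly_funs \<Longrightarrow> g \<in> rat_poly_funs \<Longrightarrow> (\<lambda>A. f A * g A) \<in> rat_poly_funs"

text \<open>
  Algebraic groups are represented by their groups of complex points. A \<open>\<rat>\<close>-algebraic subgroup of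
  \<open>GL(V)\<close> is a subgroup cut out in \<open>GL(V\<^sub>\<complex>)\<close> by polynomials with rational coefficients.
\<close>

definition rat_algebraic_group :: "(complex^'m^'m) set \<Rightarrow> bool" where
  "rat_algebraic_group H \<longleftrightarrow>
     (\<exists>S \<subseteq> rat_poly_funs. H = {A. invertible A \<and> (\<forall>f \<in> S. f A = 0)}) \<and>
     mat 1 \<in> H \<and> (\<forall>A \<in> H. \<forall>B \<in> H. A ** B \<in> H) \<and> (\<forall>A \<in> H. matrix_inv A \<in> H)"

definition mumford_tate_group :: "nat \<Rightarrow> 'm::finite filtration \<Rightarrow> (complex^'m^'m) set" where
  "mumford_tate_group n F =
     \<Inter> {H. rat_algebraic_group H \<and> (\<forall>z. norm z = 1 \<longrightarrow> hodge_circle n F z \<in> H)}"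

text \<open>The connected real form \<open>G\<^sub>\<real>\<close>: the identity component of the group of real points of \<open>G\<close>.\<close>

definition real_form :: "(complex^'m^'m) set \<Rightarrow> (real^'m^'m) set" where
  "real_form G = connected_component_set {A. complexify_matrix A \<in> G} (mat 1)"

definition lie_algebra :: "(complex^'m^'m) set \<Rightarrow> (complex^'m^'m) set" where
  "lie_algebra G = {X. \<forall>t::real. mat_exp (t *\<^sub>R X) \<in> G}"

definition real_lie_algebra :: "(complex^'m^'m) set \<Rightarrow> (real^'m^'m) set" where
  "real_lie_algebra G = {X. complexify_matrix X \<in> lie_algebra G}"

text \<open>\<open>End(V,Q)\<close> is the Lie algebra of \<open>Aut(V,Q)\<close>: the infinitesimal isometries.\<close>

definition End_form :: "(real^'m \<Rightarrow> real^'m \<Rightarrow> real) \<Rightarrow> (complex^'m^'m) set" where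
  "End_form Q =
     {X. \<forall>u v. complexify_form Q (X *v u) v + complexify_form Q u (X *v v) = 0}"

definition lie_ideal :: "(complex^'m^'m) set \<Rightarrow> (complex^'m^'m) set \<Rightarrow> bool" where
  "lie_ideal L J \<longleftrightarrow>
     J \<subseteq> L \<and> subspace J \<and> (\<forall>z. \<forall>X \<in> J. mat_cscale z X \<in> J) \<and>
     (\<forall>X \<in> L. \<forall>Y \<in> J. lie_bracket X Y \<in> J)"

text \<open>
  If \<open>J\<close> is closed under complex scaling, then so is this real span, which is therefore the
  complex span.
\<close>

definition derived_algebra :: "(complex^'m^'m) set \<Rightarrow> (complex^'m^'m) set" where
  "derived_algebra J = span {lie_bracket X Y |X Y. X \<in> J \<and> Y \<in> J}"

definition solvable_algebra :: "(complex^'m^'m) set \<Rightarrow> bool" where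
  "solvable_algebra J \<longleftrightarrow> (\<exists>k. (derived_algebra ^^ k) J = {0})"

definition semisimple_group :: "(complex^'m^'m) set \<Rightarrow> bool" where
  "semisimple_group G \<longleftrightarrow>
     connected G \<and> (\<forall>J. lie_ideal (lie_algebra G) J \<and> solvable_algebra J \<longrightarrow> J = {0})"

section \<open>Mumford-Tate domains and their compact duals\<close>

definition act :: "complex^'m^'m \<Rightarrow> 'm::finite filtration \<Rightarrow> 'm filtration" where
  "act A F = (\<lambda>p. (*v) A ` F p)"

definition real_orbit :: "(complex^'m^'m) set \<Rightarrow> 'm::finite filtration \<Rightarrow> 'm filtration set" where
  "real_orbit G F = {act (complexify_matrix A) F |A. A \<in> real_form G}"

definition complex_orbit :: "(complex^'m^'m) set \<Rightarrow> 'm::finite filtration \<Rightarrow> 'm filtration set" where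
  "complex_orbit G F = {act A F |A. A \<in> G}"

text \<open>
  \<open>D\<close> is the Mumford-Tate domain, and \<open>D'\<close> its compact dual, of the polarized Hodge structure
  \<open>(V,Q,F\<^sub>0)\<close> with Mumford-Tate group \<open>G\<close>.
\<close>

definition mumford_tate_domain ::
  "nat \<Rightarrow> (real^'m \<Rightarrow> real^'m \<Rightarrow> real) \<Rightarrow> 'm::finite filtration \<Rightarrow> (complex^'m^'m) set \<Rightarrow>
   'm filtration set \<Rightarrow> 'm filtration set \<Rightarrow> bool" where
  "mumford_tate_domain n Q F0 G D D' \<longleftrightarrow>
     polarized_hodge_structure n Q F0 \<and>
     G = mumford_tate_group n F0 \<and>
     semisimple_group G \<and>
     lie_algebra G \<subseteq> End_form Q \<and>
     compact {A \<in> real_form G. act (complexify_matrix A) F0 = F0} \<and>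
     D = real_orbit G F0 \<and>
     D' = complex_orbit G F0"

text \<open>
  The topology of the flag variety: a subspace is identified with the orthogonal projection onto
  it (the closest point map), as usual for Grassmannians. Filtrations and linear maps are both
  given the product topology; for linear maps this is the usual topology, the dimension being finite.
\<close>

definition flag_topology :: "'m::finite filtration topology" where
  "flag_topology = pullback_topology UNIV (\<lambda>F p. closest_point (F p)) euclidean"

definition closed_real_orbit ::
  "(complex^'m^'m) set \<Rightarrow> 'm::finite filtration set \<Rightarrow> 'm filtration set \<Rightarrow> bool" where
  "closed_real_orbit G D' Z \<longleftrightarrow>
     (\<exists>F \<in> D'. Z = real_orbit G F) \<and> closedin (subtopology flag_topology D') Z"

section \<open>Limiting mixed Hodge structures\<close>

definition nilpotent_orbit ::
  "(complex^'m^'m) set \<Rightarrow> 'm::finite filtration set \<Rightarrow> 'm filtration set \<Rightarrow>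
   'm filtration \<Rightarrow> real^'m^'m \<Rightarrow> bool" where
  "nilpotent_orbit G D D' F N \<longleftrightarrow>
     F \<in> D' \<and> N \<in> real_lie_algebra G \<and> nilpotent_mat N \<and>
     (\<exists>c. \<forall>z. Im z > c \<longrightarrow> act (mat_exp (mat_cscale z (complexify_matrix N))) F \<in> D) \<and>
     (\<forall>p. (*v) (complexify_matrix N) ` F p \<subseteq> F (p - 1))"

text \<open>
  The last two conditions state that \<open>N\<^sup>k\<close> induces a surjective and injective map from
  \<open>W\<^sub>n\<^sub>+\<^sub>k / W\<^sub>n\<^sub>+\<^sub>k\<^sub>-\<^sub>1\<close> to \<open>W\<^sub>n\<^sub>-\<^sub>k / W\<^sub>n\<^sub>-\<^sub>k\<^sub>-\<^sub>1\<close>.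
\<close>

definition monodromy_weight_filtration ::
  "nat \<Rightarrow> real^'m^'m \<Rightarrow> (int \<Rightarrow> (real^'m) set) \<Rightarrow> bool" where
  "monodromy_weight_filtration n N W \<longleftrightarrow>
     (\<forall>k. subspace (W k)) \<and> (\<forall>k. W k \<subseteq> W (k + 1)) \<and>
     (\<exists>a. W a = {0}) \<and> (\<exists>b. W b = UNIV) \<and>
     (\<forall>k. (*v) N ` W k \<subseteq> W (k - 2)) \<and>
     (\<forall>k::nat. W (int n - int k) =
        {mat_pow N k *v u + v |u v. u \<in> W (int n + int k) \<and> v \<in> W (int n - int k - 1)}) \<and>
     (\<forall>k::nat. \<forall>u \<in> W (int n + int k).
        mat_pow N k *v u \<in> W (int n - int k - 1) \<longrightarrow> u \<in> W (int n + int k - 1))"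

definition limiting_mhs ::
  "nat \<Rightarrow> (complex^'m^'m) set \<Rightarrow> 'm::finite filtration set \<Rightarrow> 'm filtration set \<Rightarrow>
   (int \<Rightarrow> (real^'m) set) \<Rightarrow> 'm filtration \<Rightarrow> real^'m^'m \<Rightarrow> bool" where
  "limiting_mhs n G D D' W F N \<longleftrightarrow>
     nilpotent_orbit G D D' F N \<and> monodromy_weight_filtration n N W"

text \<open>Convergence is in \<open>D'\<close>, so the limit \<open>F\<^sub>\<infinity>\<close> is a point of \<open>D'\<close>.\<close>

definition reduced_limit_period ::
  "'m::finite filtration set \<Rightarrow> 'm filtration \<Rightarrow> real^'m^'m \<Rightarrow> 'm filtration \<Rightarrow> bool" where
  "reduced_limit_period D' F N Finf \<longleftrightarrow>
     limitin (subtopology flag_topology D')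
       (\<lambda>z. act (mat_exp (mat_cscale z (complexify_matrix N))) F) Finf (filtercomap Im at_top)"

section \<open>The Deligne splitting\<close>

definition bigrading :: "(int \<Rightarrow> int \<Rightarrow> (complex^'m) set) \<Rightarrow> bool" where
  "bigrading I \<longleftrightarrow>
     (\<forall>p q. vec.subspace (I p q)) \<and>
     vec.span (\<Union>p q. I p q) = UNIV \<and>
     (\<forall>S x. finite S \<and> (\<forall>(p, q) \<in> S. x (p, q) \<in> I p q) \<and> (\<Sum>s\<in>S. x s) = 0 \<longrightarrow>
        (\<forall>s \<in> S. x s = 0))"

definition bigraded_part ::
  "(int \<Rightarrow> int \<Rightarrow> (complex^'m) set) \<Rightarrow> (int \<Rightarrow> int \<Rightarrow> bool) \<Rightarrow> (complex^'m) set" where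
  "bigraded_part I P = vec.span (\<Union> {I p q |p q. P p q})"

definition deligne_splitting ::
  "(int \<Rightarrow> (real^'m) set) \<Rightarrow> 'm::finite filtration \<Rightarrow>
   (int \<Rightarrow> int \<Rightarrow> (complex^'m) set) \<Rightarrow> bool" where
  "deligne_splitting W F I \<longleftrightarrow>
     bigrading I \<and>
     (\<forall>k. complexify_subspace (W k) = bigraded_part I (\<lambda>p q. p + q \<le> k)) \<and>
     (\<forall>p. F p = bigraded_part I (\<lambda>r s. r \<ge> p)) \<and>
     (\<forall>p q. let M = bigraded_part I (\<lambda>r s. r < q \<and> s < p) in
        {u + m |u m. u \<in> cnj_vec ` I p q \<and> m \<in> M} = {v + m |v m. v \<in> I q p \<and> m \<in> M})"

definition hodge_tate :: "(int \<Rightarrow> (real^'m) set) \<Rightarrow> 'm::finite filtration \<Rightarrow> bool" where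
  "hodge_tate W F \<longleftrightarrow> (\<exists>I. deligne_splitting W F I \<and> (\<forall>p q. p \<noteq> q \<longrightarrow> I p q = {0}))"

end

theory Submission
  imports Defs "HOL-Library.Function_Algebras"
begin

text \<open>
  For a limiting mixed Hodge structure of Hodge-Tate type, \<open>F\<^sub>\<infinity>\<^sup>p = W\<^sub>2\<^sub>(\<^sub>n\<^sub>-\<^sub>p\<^sub>)\<close>, so \<open>F\<^sub>\<infinity>\<close> is defined over
  \<open>\<real>\<close>. The orbit of such a point under the connected real form is closed. Indeed a real point \<open>F\<close> of the
  compact dual is split by a real grading whose cocharacter lies in \<open>G\<close>. A point of the compact dual that
  is transversal to the opposite filtration is \<open>u F\<close> for a unique lower unipotent \<open>u\<close>, and \<open>u\<close> lies in \<open>G\<close>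
  because \<open>G\<close> is cut out by polynomials. If \<open>u F\<close> is real, then so is \<open>u\<close>, and the cocharacter
  contracts \<open>u\<close> to \<open>1\<close>. So every orbit of a real point is open in the closed set of all real points.
\<close>

text \<open>\<open>G\<close> is accessible only through its polynomial equations, its group
  structure and the circle operators in it. Membership in \<open>G\<close> is therefore drawn from
  polynomial identities: a Laurent polynomial vanishing on the unit circle is zero, and a polynomial
  curve satisfying the equations at infinitely many parameters satisfies them at all. This makes the
  square root of a unipotent element and the limits of cocharacters available inside
  \<open>G\<close>. The harder case is a product \<open>u ** q\<close> in \<open>G\<close> of a
  lower unipotent and an upper factor, neither of which is known to lie in \<open>G\<close>; there
  the equations themselves are sorted by weight under the cocharacter.

  The identification of the limit with the weight filtration rests on two facts. \<open>N\<close>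
  lowers the Deligne grading by one, so e^(zN) F^p is a rescaling of e^N F^p; and e^N F^p is
  complementary to F^(n-p+1). Rescaling suppresses the F^(n-p+1) part of a vector and keeps its
  lower components, which therefore fill the limit. Complementarity comes from the injectivity of
  \<open>N^k\<close> on the piece of weight n+k.\<close>

section \<open>Linear algebra and Laurent polynomials\<close>

lemma (in vector_space) independent_Un:
  assumes "independent A" "independent B" "finite B" "span A \<inter> span B = {0}"
  shows "independent (A \<union> B)"
  using assms(3,2,4)
proof (induction B)
  case empty
  then show ?case using assms(1) by simp
next
  case (insert x B)
  have sub: "span B \<subseteq> span (insert x B)" by (rule span_mono) auto
  have IH: "independent (A \<union> B)"
  proof (rule insert.IH)
    show "independent B" using insert.prems independent_mono by blast
    show "span A \<inter> span B = {0}" using insert.prems sub span_zero by blast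
  qed
  have "x \<notin> span (A \<union> B)"
  proof
    assume "x \<in> span (A \<union> B)"
    then obtain a b where ab: "x = a + b" "a \<in> span A" "b \<in> span B" by (auto simp: span_Un)
    have "a = x - b" using ab by simp
    moreover have "x - b \<in> span (insert x B)"
      using ab sub by (intro span_diff) (auto intro: span_base)
    ultimately have "a \<in> span A \<inter> span (insert x B)" using ab(2) by simp
    then have "a = 0" using insert.prems(2) by blast
    then have "x \<in> span B" using ab by simp
    then show False using insert.prems(1) insert.hyps by (simp add: independent_insert)
  qed
  then show ?case using IH by (simp add: independent_insertI)
qed

text \<open>The right-hand sum has the dimension of \<open>V\<close>.\<close>

lemma (in vector_space) subspace_decomp_image:
  assumes fin: "finite T" "V \<subseteq> span T"
    and sub: "subspace L" "subspace H" "L \<subseteq> V" "f ` H \<subseteq> V"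
    and dec: "\<And>v. v \<in> V \<Longrightarrow> \<exists>l\<in>L. \<exists>h\<in>H. v = l + h"
    and lin: "Vector_Spaces.linear scale scale f" and inj: "inj_on f H"
    and disj: "L \<inter> f ` H = {0}" and v: "v \<in> V"
  shows "\<exists>l\<in>L. \<exists>h\<in>H. v = l + f h"
proof -
  interpret f: Vector_Spaces.linear scale scale f by (rule lin)
  obtain BL where BL: "BL \<subseteq> L" "independent BL" "L \<subseteq> span BL"
    using maximal_independent_subset by blast
  obtain BH where BH: "BH \<subseteq> H" "independent BH" "H \<subseteq> span BH"
    using maximal_independent_subset by blast
  have sBL: "span BL = L" by (rule span_subspace[OF BL(1,3) sub(1)])
  have sBH: "span BH = H" by (rule span_subspace[OF BH(1,3) sub(2)])
  have indf: "independent (f ` BH)"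
    using f.independent_injective_image[OF BH(2)] inj sBH by simp
  have finL: "finite BL"
    using independent_span_bound[OF fin(1) BL(2)] BL(1) sub(3) fin(2) by blast
  have "f ` BH \<subseteq> span T" using BH(1) sub(4) fin(2) by blast
  then have finfH: "finite (f ` BH)" using independent_span_bound[OF fin(1) indf] by blast
  have injBH: "inj_on f BH" using inj BH(1) by (rule inj_on_subset)
  then have finH: "finite BH" using finfH finite_image_iff by blast
  have spf: "span (f ` BH) = f ` H" using f.span_image[of BH] sBH by simp
  have ind: "independent (BL \<union> f ` BH)"
    using independent_Un[OF BL(2) indf finfH] sBL spf disj by simp
  have "BL \<inter> f ` BH \<subseteq> {0}" using BL(1) BH(1) disj by blast
  moreover have "0 \<notin> BL" using BL(2) dependent_zero by blast
  ultimately have "BL \<inter> f ` BH = {}" by (metis IntD1 subset_singletonD singletonI)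
  then have card1: "card (BL \<union> f ` BH) = card BL + card BH"
    using finL finfH injBH by (simp add: card_Un_disjoint card_image)
  have Vsp: "V \<subseteq> span (BL \<union> BH)"
  proof
    fix v assume "v \<in> V"
    then obtain l h where "l \<in> L" "h \<in> H" "v = l + h" using dec by meson
    then show "v \<in> span (BL \<union> BH)" unfolding span_Un sBL sBH by blast
  qed
  \<comment> \<open>\<open>V\<close> lies in the span of \<open>BL \<union> BH\<close> and so holds
    at most \<open>card BL + card BH\<close> independent vectors; \<open>v\<close> outside the new
    span would give one more. Bases are counted because the lemma will be applied in an
    infinite-dimensional space of functions.\<close>
  have "v \<in> span (BL \<union> f ` BH)"
  proof (rule ccontr)
    assume nv: "v \<notin> span (BL \<union> f ` BH)"
    then have "independent (insert v (BL \<union> f ` BH))" using ind by (rule independent_insertI)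
    moreover have "insert v (BL \<union> f ` BH) \<subseteq> span (BL \<union> BH)"
      using Vsp v BL(1) BH(1) sub by blast
    moreover have "finite (BL \<union> BH)" using finL finH by simp
    ultimately have le: "card (insert v (BL \<union> f ` BH)) \<le> card (BL \<union> BH)"
      using independent_span_bound by presburger
    have "v \<notin> BL \<union> f ` BH" using nv span_base by auto
    with le have "Suc (card BL + card BH) \<le> card (BL \<union> BH)"
      using card1 finL finfH by simp
    then show False using card_Un_le[of BL BH] by simp
  qed
  then show ?thesis unfolding span_Un sBL spf by blast
qed

text \<open>Multiplication by \<open>z powi (- Min J)\<close> leaves a polynomial with infinitely
  many roots. The unit circle is the parameter set because the Mumford-Tate group is defined by its
  circle operators.\<close>

lemma laurent_coeffs_zero:
  fixes c :: "int \<Rightarrow> complex"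
  assumes fin: "finite J" and z: "\<And>z. norm z = 1 \<Longrightarrow> (\<Sum>j\<in>J. z powi j * c j) = 0"
    and j: "j \<in> J"
  shows "c j = 0"
proof -
  define m where "m = Min J"
  define P where "P = (\<Sum>j\<in>J. monom (c j) (nat (j - m)))"
  have ev: "poly P z = z powi (- m) * (\<Sum>j\<in>J. z powi j * c j)" if "z \<noteq> 0" for z
  proof -
    have "c j * z ^ nat (j - m) = z powi (- m) * (z powi j * c j)" if "j \<in> J" for j
    proof -
      have "m \<le> j" using that fin m_def by simp
      then have "z ^ nat (j - m) = z powi (j - m)" by (simp add: power_int_def)
      also have "\<dots> = z powi (- m) * z powi j" using \<open>z \<noteq> 0\<close> power_int_add[of z "-m" j] by (simp add: algebra_simps)
      finally show ?thesis by simp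
    qed
    then show ?thesis unfolding P_def poly_sum poly_monom sum_distrib_left by (intro sum.cong) auto
  qed
  have "poly P z = 0" if "z \<in> sphere 0 1" for z
  proof -
    have "norm z = 1" "z \<noteq> 0" using that by auto
    then show ?thesis using ev[of z] z[of z] by simp
  qed
  then have "sphere 0 1 \<subseteq> {z. poly P z = 0}" by blast
  moreover have "infinite (sphere (0::complex) 1)"
  proof -
    have "connected (sphere (0::complex) 1)" by (rule connected_sphere) simp
    moreover have "1 \<in> sphere (0::complex) 1" "-1 \<in> sphere (0::complex) 1" "(1::complex) \<noteq> -1" by auto
    ultimately show ?thesis using connected_finite_iff_sing by (metis emptyE singletonD)
  qed
  ultimately have "P = 0" using poly_roots_finite finite_subset by blast
  then have "coeff P (nat (j - m)) = 0" by simp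
  moreover have "coeff P (nat (j - m)) = (\<Sum>i\<in>J. if i = j then c i else 0)"
  proof -
    have "(nat (i - m) = nat (j - m)) = (i = j)" if "i \<in> J" for i
      using that j fin m_def Min_le[of J i] Min_le[of J j] by (simp add: eq_nat_nat_iff)
    then show ?thesis unfolding P_def coeff_sum coeff_monom by (intro sum.cong) auto
  qed
  ultimately show ?thesis using fin j by simp
qed

section \<open>Matrix algebra\<close>

lemma mat_cscale_mult_left: "mat_cscale z A ** B = mat_cscale z (A ** B)"
  by (simp add: vec_eq_iff matrix_matrix_mult_def sum_distrib_left mult.assoc)

lemma mat_cscale_mult_right: "A ** mat_cscale z B = mat_cscale z (A ** B)"
  by (simp add: vec_eq_iff matrix_matrix_mult_def sum_distrib_left mult.left_commute)

lemma mat_cscale_one [simp]: "mat_cscale 1 A = A"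
  by (simp add: vec_eq_iff)

lemma mat_cscale_mat_cscale [simp]: "mat_cscale z (mat_cscale w A) = mat_cscale (z * w) A"
  by (simp add: vec_eq_iff mult.assoc)

lemma mat_cscale_zero [simp]: "mat_cscale z 0 = 0" "mat_cscale 0 A = 0"
  by (simp_all add: vec_eq_iff)

lemma mat_cscale_mul_vec: "mat_cscale z A *v v = z *s (A *v v)"
  by (simp add: vec_eq_iff matrix_vector_mult_def sum_distrib_left mult.assoc)

lemma matrix_mul_sum_left:
  fixes M :: "'b \<Rightarrow> 'a::comm_ring_1^'n^'m" and B :: "'a^'p^'n"
  shows "(\<Sum>a\<in>S. M a) ** B = (\<Sum>a\<in>S. M a ** B)"
proof (induction S rule: infinite_finite_induct)
  case (insert x F)
  then show ?case
    by (simp add: vec_eq_iff matrix_matrix_mult_def sum.distrib distrib_right)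
qed simp_all

lemma matrix_mul_sum_right:
  fixes M :: "'b \<Rightarrow> 'a::comm_ring_1^'p^'n" and B :: "'a^'n^'m"
  shows "B ** (\<Sum>a\<in>S. M a) = (\<Sum>a\<in>S. B ** M a)"
  by (induction S rule: infinite_finite_induct) (simp_all add: matrix_add_ldistrib)

lemma sum_mul_vec: "(\<Sum>a\<in>S. M a) *v v = (\<Sum>a\<in>S. M a *v v)"
  by (induction S rule: infinite_finite_induct) (simp_all add: matrix_vector_mult_add_rdistrib)

section \<open>Gradings\<close>

text \<open>The projections of a direct sum decomposition of the complexified space. For a Hodge
  structure, \<open>\<pi> p\<close> is the projection onto V^(p,n-p).\<close>

definition grading :: "nat \<Rightarrow> (int \<Rightarrow> complex^'m^'m) \<Rightarrow> bool" where
  "grading n \<pi> \<longleftrightarrow>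
     (\<forall>a b. \<pi> a ** \<pi> b = (if a = b then \<pi> a else 0)) \<and>
     (\<Sum>a\<in>{0..int n}. \<pi> a) = mat 1 \<and> (\<forall>a. a \<notin> {0..int n} \<longrightarrow> \<pi> a = 0)"

text \<open>The exponent p - q of \<open>hodge_circle\<close>, with p = a and q = n - a.\<close>

definition weight :: "nat \<Rightarrow> int \<Rightarrow> int" where
  "weight n a = 2 * a - int n"

definition cochar :: "nat \<Rightarrow> (int \<Rightarrow> complex^'m^'m) \<Rightarrow> complex \<Rightarrow> complex^'m^'m" where
  "cochar n \<pi> t = (\<Sum>a\<in>{0..int n}. mat_cscale (t powi weight n a) (\<pi> a))"

text \<open>\<open>upper\<close> matrices are those preserving the filtration split by
  \<open>\<pi>\<close>, invertible or not; \<open>lower_unipotent\<close> ones form the unipotent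
  radical of the stabilizer of the opposite filtration.\<close>

definition upper :: "(int \<Rightarrow> complex^'m^'m) \<Rightarrow> complex^'m^'m \<Rightarrow> bool" where
  "upper \<pi> q \<longleftrightarrow> (\<forall>a b. a < b \<longrightarrow> \<pi> a ** q ** \<pi> b = 0)"

definition lower_unipotent :: "(int \<Rightarrow> complex^'m^'m) \<Rightarrow> complex^'m^'m \<Rightarrow> bool" where
  "lower_unipotent \<pi> u \<longleftrightarrow> (\<forall>a b. a > b \<longrightarrow> \<pi> a ** u ** \<pi> b = 0) \<and> (\<forall>a. \<pi> a ** u ** \<pi> a = \<pi> a)"

lemma weight_less_iff [simp]: "weight n a < weight n b \<longleftrightarrow> a < b"
  and weight_le_iff [simp]: "weight n a \<le> weight n b \<longleftrightarrow> a \<le> b"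
  and weight_eq_iff [simp]: "weight n a = weight n b \<longleftrightarrow> a = b"
  by (auto simp: weight_def)

context
  fixes n :: nat and \<pi> :: "int \<Rightarrow> complex^'m^'m"
  assumes gr: "grading n \<pi>"
begin

lemma grading_mult: "\<pi> a ** \<pi> b = (if a = b then \<pi> a else 0)"
  using gr by (simp add: grading_def)

lemma grading_mult_assoc: "A ** \<pi> a ** \<pi> b = (if a = b then A ** \<pi> a else 0)"
  by (simp add: grading_mult flip: matrix_mul_assoc)

lemma grading_sum: "(\<Sum>a\<in>{0..int n}. \<pi> a) = mat 1"
  using gr by (simp add: grading_def)

lemma grading_outside: "a \<notin> {0..int n} \<Longrightarrow> \<pi> a = 0"
  using gr by (simp add: grading_def)

lemma grading_expand_left: "A = (\<Sum>a\<in>{0..int n}. \<pi> a ** A)"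
  by (simp add: grading_sum flip: matrix_mul_sum_left)

lemma grading_expand_right: "A = (\<Sum>a\<in>{0..int n}. A ** \<pi> a)"
  by (simp add: grading_sum flip: matrix_mul_sum_right)

lemma grading_expand_vec: "v = (\<Sum>a\<in>{0..int n}. \<pi> a *v v)"
  by (simp add: grading_sum flip: sum_mul_vec)

lemma grading_vec: "\<pi> a *v (\<pi> b *v v) = (if a = b then \<pi> a *v v else 0)"
  by (simp add: matrix_vector_mul_assoc grading_mult)

lemma cochar_mult_proj: "cochar n \<pi> t ** \<pi> a = mat_cscale (t powi weight n a) (\<pi> a)"
proof (cases "a \<in> {0..int n}")
  case True
  have "cochar n \<pi> t ** \<pi> a =
      (\<Sum>b\<in>{0..int n}. if b = a then mat_cscale (t powi weight n a) (\<pi> a) else 0)"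
    unfolding cochar_def matrix_mul_sum_left mat_cscale_mult_left grading_mult
    by (intro sum.cong) auto
  then show ?thesis using True by simp
qed (simp add: grading_outside)

lemma cochar_mult: "z \<noteq> 0 \<Longrightarrow> w \<noteq> 0 \<Longrightarrow> cochar n \<pi> z ** cochar n \<pi> w = cochar n \<pi> (z * w)"
  unfolding cochar_def[of n \<pi> w] matrix_mul_sum_right mat_cscale_mult_right cochar_mult_proj
  by (simp add: cochar_def power_int_mult_distrib mult.commute)

lemma cochar_one: "cochar n \<pi> 1 = mat 1"
  by (simp add: cochar_def grading_sum)

lemma invertible_cochar: "z \<noteq> 0 \<Longrightarrow> invertible (cochar n \<pi> z)"
  unfolding invertible_right_inverse
  by (rule exI[of _ "cochar n \<pi> (inverse z)"]) (simp add: cochar_mult cochar_one)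

text \<open>A lower unipotent matrix does not change the component of highest index of a vector. So
  \<open>u *v v\<close> and \<open>v\<close> have the same highest index and the same component
  there, which gives injectivity and the triangular shape of the inverse at once.\<close>

lemma lower_unipotent_inverse:
  assumes u: "lower_unipotent \<pi> u"
  shows "\<exists>u'. u ** u' = mat 1 \<and> u' ** u = mat 1 \<and> lower_unipotent \<pi> u'"
proof -
  have lo: "\<pi> a *v (u *v v) = \<pi> a *v v"
    if "\<And>c. c > a \<Longrightarrow> \<pi> c *v v = 0" for a v
  proof -
    have "\<pi> a *v (u *v v) = (\<Sum>c\<in>{0..int n}. \<pi> a *v (u *v (\<pi> c *v v)))"
      by (subst grading_expand_vec[of v]) (simp add: vec.sum)
    also have "\<dots> = (\<Sum>c\<in>{0..int n}. if c = a then \<pi> a *v v else 0)"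
    proof (intro sum.cong refl)
      fix c assume "c \<in> {0..int n}"
      consider "c > a" | "c = a" | "c < a" by linarith
      then show "\<pi> a *v (u *v (\<pi> c *v v)) = (if c = a then \<pi> a *v v else 0)"
        using u that by cases (simp_all add: lower_unipotent_def matrix_vector_mul_assoc matrix_mul_assoc)
    qed
    also have "\<dots> = \<pi> a *v v" by (simp add: grading_outside)
    finally show ?thesis .
  qed
  \<comment> \<open>Downward induction on \<open>a\<close>: once all components of \<open>v\<close>
    above \<open>a\<close> vanish, \<open>lo\<close> identifies the two components at
    \<open>a\<close>.\<close>
  have key0: "\<pi> a *v v = 0" if uv: "\<And>c. c > b \<Longrightarrow> \<pi> c *v (u *v v) = 0" and "a > b" for a b v
    using \<open>a > b\<close>
  proof (induction "nat (int n - a)" arbitrary: a rule: less_induct)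
    case less
    have "\<pi> c *v v = 0" if "c > a" for c
    proof (cases "c \<le> int n")
      case True
      then show ?thesis using less.hyps[of c] less.prems that by simp
    qed (simp add: grading_outside)
    then show ?case using lo[of a v] uv[OF less.prems] by simp
  qed
  have "inj ((*v) u)"
  proof (rule linear_injective_0[THEN iffD2, rule_format])
    show "linear ((*v) u)" by (rule matrix_vector_mul_linear)
    fix v assume "u *v v = 0"
    then have "\<pi> a *v v = 0" for a
      using key0[of "-1" v a] by (cases "a > -1") (simp_all add: grading_outside)
    then show "v = 0" by (subst grading_expand_vec) simp
  qed
  then obtain u' where u': "u' ** u = mat 1" using matrix_left_invertible_injective by blast
  then have uu': "u ** u' = mat 1" using matrix_left_right_inverse by blast
  have ev: "u *v (u' *v v) = v" for v by (simp add: matrix_vector_mul_assoc uu')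
  have "\<pi> a ** u' ** \<pi> b = 0" if "a > b" for a b
  proof -
    have "\<pi> a *v (u' *v (\<pi> b *v w)) = 0" for w
      by (rule key0[OF _ that]) (simp add: ev grading_vec)
    then show ?thesis by (simp add: matrix_eq flip: matrix_vector_mul_assoc)
  qed
  moreover have "\<pi> a ** u' ** \<pi> a = \<pi> a" for a
  proof -
    have "\<pi> a *v (u' *v (\<pi> a *v w)) = \<pi> a *v w" for w
    proof -
      have "\<pi> c *v (u' *v (\<pi> a *v w)) = 0" if "c > a" for c
        by (rule key0[OF _ that]) (simp add: ev grading_vec)
      then have "\<pi> a *v (u *v (u' *v (\<pi> a *v w))) = \<pi> a *v (u' *v (\<pi> a *v w))" by (rule lo)
      then show ?thesis by (simp add: ev grading_vec)
    qed
    then show ?thesis by (simp add: matrix_eq flip: matrix_vector_mul_assoc)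
  qed
  ultimately show ?thesis using u' uu' unfolding lower_unipotent_def by blast
qed

end

section \<open>Polynomial functions on matrices\<close>

abbreviation fun_scale :: "complex \<Rightarrow> ('a \<Rightarrow> complex) \<Rightarrow> 'a \<Rightarrow> complex" where
  "fun_scale c f \<equiv> \<lambda>x. c * f x"

interpretation fsp: vector_space fun_scale
  by unfold_locales (auto simp: fun_eq_iff algebra_simps)

lemma sum_fun_apply: "(\<Sum>i\<in>S. f i) x = (\<Sum>i\<in>S. f i x)"
  by (induction S rule: infinite_finite_induct) simp_all

lemma fsp_span_mult:
  assumes h: "h \<in> fsp.span X" and h': "h' \<in> fsp.span Y"
    and prod: "\<And>x y. x \<in> X \<Longrightarrow> y \<in> Y \<Longrightarrow> x * y \<in> fsp.span Z"
  shows "h * h' \<in> fsp.span Z"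
  using h
proof (induction rule: fsp.span_induct_alt)
  case base
  then show ?case using fsp.span_zero by (simp add: zero_fun_def times_fun_def)
next
  case (step c x y)
  have "x * h' \<in> fsp.span Z" using h'
  proof (induction rule: fsp.span_induct_alt)
    case base
    then show ?case using fsp.span_zero by (simp add: zero_fun_def times_fun_def)
  next
    case (step c' x' y')
    have "x * (fun_scale c' x' + y') = fun_scale c' (x * x') + x * y'"
      by (simp add: fun_eq_iff algebra_simps)
    then show ?case using step \<open>x \<in> X\<close> prod fsp.span_add fsp.span_scale by metis
  qed
  moreover have "(fun_scale c x + y) * h' = fun_scale c (x * h') + y * h'"
    by (simp add: fun_eq_iff algebra_simps)
  ultimately show ?case using step fsp.span_add fsp.span_scale by metis
qed

definition translate :: "complex^'m^'m \<Rightarrow> (complex^'m^'m \<Rightarrow> complex) \<Rightarrow> complex^'m^'m \<Rightarrow> complex" where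
  "translate g f = (\<lambda>A. f (A ** g))"

lemma translate_linear: "Vector_Spaces.linear fun_scale fun_scale (translate g)"
  by unfold_locales (auto simp: fun_eq_iff translate_def)

lemma translate_translate: "translate g (translate h f) = translate (g ** h) f"
  by (simp add: translate_def matrix_mul_assoc)

lemma translate_times: "translate g (f * h) = translate g f * translate g h"
  by (simp add: translate_def fun_eq_iff)

definition homogeneous :: "nat \<Rightarrow> (int \<Rightarrow> complex^'m^'m) \<Rightarrow> int \<Rightarrow> (complex^'m^'m \<Rightarrow> complex) \<Rightarrow> bool" where
  "homogeneous n \<pi> w h \<longleftrightarrow> (\<forall>A t. t \<noteq> 0 \<longrightarrow> h (A ** cochar n \<pi> t) = t powi w * h A)"

text \<open>The entries of \<open>A\<close> need not be weight vectors, those of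
  \<open>A ** \<pi> p\<close> are: \<open>cochar n \<pi> t ** \<pi> p\<close> is a multiple of
  \<open>\<pi> p\<close>.\<close>

definition grading_coord :: "(int \<Rightarrow> complex^'m^'m) \<Rightarrow> int \<Rightarrow> 'm \<Rightarrow> 'm \<Rightarrow> complex^'m^'m \<Rightarrow> complex" where
  "grading_coord \<pi> p i j = (\<lambda>A. (A ** \<pi> p) $ i $ j)"

text \<open>The weight is carried along because a function need not determine it: a coordinate with
  \<open>\<pi> p ** M = 0\<close> for all \<open>M\<close>, for instance, is the zero function. The
  coordinates satisfy linear relations, so these monomials span but are no basis.\<close>

primrec monomials :: "nat \<Rightarrow> (int \<Rightarrow> complex^'m^'m) \<Rightarrow> nat \<Rightarrow> (int \<times> (complex^'m^'m \<Rightarrow> complex)) set" where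
  "monomials n \<pi> 0 = {(0, 1)}"
| "monomials n \<pi> (Suc d) = monomials n \<pi> d \<union>
     (\<lambda>((w, b), p, i, j). (w + weight n p, grading_coord \<pi> p i j * b)) `
       (monomials n \<pi> d \<times> {0..int n} \<times> UNIV \<times> UNIV)"

text \<open>Finite-dimensional spaces of polynomial functions of degree at most \<open>d\<close>.
  The bound on the degree survives translation, which makes a dimension count possible.\<close>

definition mon_span :: "nat \<Rightarrow> (int \<Rightarrow> complex^'m^'m) \<Rightarrow> nat \<Rightarrow> int set \<Rightarrow> (complex^'m^'m \<Rightarrow> complex) set" where
  "mon_span n \<pi> d J = fsp.span {b. \<exists>w\<in>J. (w, b) \<in> monomials n \<pi> d}"

lemma finite_monomials: "finite (monomials n \<pi> d)"
  by (induction d) auto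

lemma mon_span_mono: "J \<subseteq> J' \<Longrightarrow> mon_span n \<pi> d J \<subseteq> mon_span n \<pi> d J'"
  unfolding mon_span_def by (rule fsp.span_mono) auto

lemma mon_span_base: "(w, b) \<in> monomials n \<pi> d \<Longrightarrow> w \<in> J \<Longrightarrow> b \<in> mon_span n \<pi> d J"
  unfolding mon_span_def by (rule fsp.span_base) auto

lemma subspace_mon_span: "fsp.subspace (mon_span n \<pi> d J)"
  unfolding mon_span_def by (rule fsp.subspace_span)

lemma monomials_mult:
  "(w, b) \<in> monomials n \<pi> d \<Longrightarrow> (w', b') \<in> monomials n \<pi> d' \<Longrightarrow> (w + w', b * b') \<in> monomials n \<pi> (d + d')"
proof (induction d arbitrary: w b)
  case (Suc d)
  consider "(w, b) \<in> monomials n \<pi> d" |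
    w0 b0 p i j where "(w0, b0) \<in> monomials n \<pi> d" "p \<in> {0..int n}"
      "w = w0 + weight n p" "b = grading_coord \<pi> p i j * b0"
    using Suc.prems(1) by auto
  then show ?case
  proof cases
    case 1
    then show ?thesis using Suc by simp
  next
    case 2
    have "(w0 + w', b0 * b') \<in> monomials n \<pi> (d + d')" using Suc.IH Suc.prems(2) 2 by blast
    then have "((w0 + w') + weight n p, grading_coord \<pi> p i j * (b0 * b')) \<in> monomials n \<pi> (Suc (d + d'))"
      using 2 by (auto intro!: rev_image_eqI[where x = "((w0 + w', b0 * b'), p, i, j)"])
    moreover have "(w + w', b * b') = ((w0 + w') + weight n p, grading_coord \<pi> p i j * (b0 * b'))"
      using 2 by (simp add: fun_eq_iff mult.assoc)
    ultimately show ?thesis by (metis add_Suc)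
  qed
qed simp

lemma grading_coord_monomial: "p \<in> {0..int n} \<Longrightarrow> (weight n p, grading_coord \<pi> p i j) \<in> monomials n \<pi> (Suc 0)"
  by (auto intro!: rev_image_eqI[where x = "((0, 1), p, i, j)"])

lemma mon_span_mult:
  assumes "h \<in> mon_span n \<pi> d J" "h' \<in> mon_span n \<pi> d' J'" "\<And>w w'. w \<in> J \<Longrightarrow> w' \<in> J' \<Longrightarrow> w + w' \<in> K"
  shows "h * h' \<in> mon_span n \<pi> (d + d') K"
  using assms unfolding mon_span_def
  by (elim fsp_span_mult) (auto intro!: fsp.span_base bexI monomials_mult)

lemma mon_span_degree_mono: "d \<le> d' \<Longrightarrow> mon_span n \<pi> d J \<subseteq> mon_span n \<pi> d' J"
proof (induction rule: dec_induct)
  case (step d')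
  have "mon_span n \<pi> d' J \<subseteq> mon_span n \<pi> (Suc d') J"
    unfolding mon_span_def by (rule fsp.span_mono) auto
  then show ?case using step by blast
qed simp

lemma sum_in_span_coord:
  assumes "\<And>p. p \<in> S \<Longrightarrow> p \<in> {0..int n} \<and> weight n p \<in> J"
  shows "(\<lambda>A. \<Sum>p\<in>S. (A ** \<pi> p ** M p) $ i $ j) \<in> mon_span n \<pi> (Suc 0) J"
proof -
  have "(\<lambda>A. \<Sum>p\<in>S. (A ** \<pi> p ** M p) $ i $ j) =
      (\<Sum>p\<in>S. \<Sum>k\<in>UNIV. fun_scale (M p $ k $ j) (grading_coord \<pi> p i k))"
    by (rule ext) (simp add: sum_fun_apply grading_coord_def matrix_matrix_mult_def[of _ "M _"] mult.commute)
  also have "\<dots> \<in> mon_span n \<pi> (Suc 0) J"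
    unfolding mon_span_def using assms
    by (intro fsp.span_sum fsp.span_scale fsp.span_base) (use grading_coord_monomial in blast)
  finally show ?thesis .
qed

lemma rat_poly_funs_mon_span:
  assumes gr: "grading n \<pi>" and f: "f \<in> rat_poly_funs"
  shows "\<exists>d. f \<in> mon_span n \<pi> d UNIV"
  using f
proof induction
  case (const c)
  have "fun_scale (of_rat c) 1 \<in> mon_span n \<pi> 0 UNIV"
    unfolding mon_span_def by (intro fsp.span_scale fsp.span_base) auto
  then show ?case by auto
next
  case (coord i j)
  have "(\<lambda>A. A $ i $ j) = (\<lambda>A. \<Sum>p\<in>{0..int n}. (A ** \<pi> p ** mat 1) $ i $ j)"
    by (subst grading_expand_right[OF gr]) simp
  then show ?case using sum_in_span_coord[of "{0..int n}" n UNIV \<pi> "\<lambda>_. mat 1" i j] by auto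
next
  case (add f g)
  then obtain d d' where "f \<in> mon_span n \<pi> d UNIV" "g \<in> mon_span n \<pi> d' UNIV" by blast
  then have "f \<in> mon_span n \<pi> (max d d') UNIV" "g \<in> mon_span n \<pi> (max d d') UNIV"
    using mon_span_degree_mono by (metis max.cobounded1 max.cobounded2 subsetD)+
  then have "f + g \<in> mon_span n \<pi> (max d d') UNIV"
    unfolding mon_span_def by (rule fsp.span_add)
  then show ?case by (auto simp: plus_fun_def)
next
  case (mult f g)
  then obtain d d' where "f \<in> mon_span n \<pi> d UNIV" "g \<in> mon_span n \<pi> d' UNIV" by blast
  then have "f * g \<in> mon_span n \<pi> (d + d') UNIV" by (rule mon_span_mult) simp
  then show ?case by (auto simp: times_fun_def)
qed

lemma homogeneous_monomial:
  assumes gr: "grading n \<pi>" and "(w, b) \<in> monomials n \<pi> d"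
  shows "homogeneous n \<pi> w b"
  using assms(2)
proof (induction d arbitrary: w b)
  case 0
  then show ?case by (simp add: homogeneous_def)
next
  case (Suc d)
  consider "(w, b) \<in> monomials n \<pi> d" |
    w0 b0 p i j where "(w0, b0) \<in> monomials n \<pi> d" "p \<in> {0..int n}"
      "w = w0 + weight n p" "b = grading_coord \<pi> p i j * b0"
    using Suc.prems(1) by auto
  then show ?case
  proof cases
    case 2
    have "A ** cochar n \<pi> t ** \<pi> p = mat_cscale (t powi weight n p) (A ** \<pi> p)" for A t
      by (simp add: cochar_mult_proj[OF gr] mat_cscale_mult_right flip: matrix_mul_assoc)
    then show ?thesis using Suc.IH[OF 2(1)] 2
      by (simp add: homogeneous_def grading_coord_def power_int_add)
  qed (use Suc in simp)
qed

text \<open>\<open>A ** q ** \<pi> p\<close> involves only the columns \<open>A ** \<pi> a\<close>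
  with \<open>a \<ge> p\<close>, so translation cannot lower the weight of a coordinate; translation
  is multiplicative.\<close>

lemma translate_upper_monomial:
  fixes \<pi> :: "int \<Rightarrow> complex^'m^'m"
  assumes gr: "grading n \<pi>" and q: "upper \<pi> q" and "(w, b) \<in> monomials n \<pi> d"
  shows "translate q b \<in> mon_span n \<pi> d {w..}"
  using assms(3)
proof (induction d arbitrary: w b)
  case 0
  then show ?case by (auto simp: translate_def mon_span_def one_fun_def intro!: fsp.span_base)
next
  case (Suc d)
  consider "(w, b) \<in> monomials n \<pi> d" |
    w0 b0 p i j where "(w0, b0) \<in> monomials n \<pi> d" "p \<in> {0..int n}"
      "w = w0 + weight n p" "b = grading_coord \<pi> p i j * b0"
    using Suc.prems(1) by auto
  then show ?case
  proof cases
    case 1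
    then show ?thesis using Suc.IH mon_span_degree_mono[of d "Suc d"] by fastforce
  next
    case 2
    have "A ** q ** \<pi> p = (\<Sum>a\<in>{0..int n}. A ** \<pi> a ** (q ** \<pi> p))" for A :: "complex^'m^'m"
      by (subst grading_expand_right[OF gr, of A]) (simp add: matrix_mul_sum_left matrix_mul_assoc)
    also have "\<dots> A = (\<Sum>a\<in>{p..int n}. A ** \<pi> a ** (q ** \<pi> p))" for A :: "complex^'m^'m"
      using q 2(2) by (intro sum.mono_neutral_right) (auto simp: upper_def simp flip: matrix_mul_assoc)
    finally have "translate q (grading_coord \<pi> p i j) = (\<lambda>A. \<Sum>a\<in>{p..int n}. (A ** \<pi> a ** (q ** \<pi> p)) $ i $ j)"
      unfolding translate_def grading_coord_def by simp
    also have "\<dots> \<in> mon_span n \<pi> (Suc 0) {weight n p..}"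
      using 2(2) by (intro sum_in_span_coord) auto
    finally have "translate q (grading_coord \<pi> p i j) * translate q b0 \<in> mon_span n \<pi> (Suc 0 + d) {w..}"
      using Suc.IH[OF 2(1)] by (rule mon_span_mult) (use 2 in auto)
    then show ?thesis by (simp only: 2(4) translate_times add_Suc add_0)
  qed
qed

text \<open>On a coordinate the diagonal blocks of \<open>u\<close> are identities and the others
  lower the weight. Products follow from the Leibniz-like identity ux ub - x b = (ux - x) ub + x (ub
  - b).\<close>

lemma translate_lower_monomial:
  fixes \<pi> :: "int \<Rightarrow> complex^'m^'m"
  assumes gr: "grading n \<pi>" and u: "lower_unipotent \<pi> u" and "(w, b) \<in> monomials n \<pi> d"
  shows "translate u b - b \<in> mon_span n \<pi> d {..<w}"
  using assms(3)
proof (induction d arbitrary: w b)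
  case 0
  have "translate u b - b = 0" using 0 by (simp add: translate_def fun_eq_iff)
  then show ?case by (simp only: mon_span_def fsp.span_zero)
next
  case (Suc d)
  consider "(w, b) \<in> monomials n \<pi> d" |
    w0 b0 p i j where "(w0, b0) \<in> monomials n \<pi> d" "p \<in> {0..int n}"
      "w = w0 + weight n p" "b = grading_coord \<pi> p i j * b0"
    using Suc.prems(1) by auto
  then show ?case
  proof cases
    case 1
    then show ?thesis using Suc.IH mon_span_degree_mono[of d "Suc d"] by fastforce
  next
    case 2
    let ?x = "grading_coord \<pi> p i j"
    have "A ** u ** \<pi> p = (\<Sum>a\<in>{0..int n}. A ** \<pi> a ** (u ** \<pi> p))" for A :: "complex^'m^'m"
      by (subst grading_expand_right[OF gr, of A]) (simp add: matrix_mul_sum_left matrix_mul_assoc)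
    also have "\<dots> A = (\<Sum>a\<in>insert p {0..<p}. A ** \<pi> a ** (u ** \<pi> p))" for A :: "complex^'m^'m"
    proof (intro sum.mono_neutral_right ballI)
      fix a assume "a \<in> {0..int n} - insert p {0..<p}"
      then have "\<pi> a ** u ** \<pi> p = 0" using u by (auto simp: lower_unipotent_def)
      then show "A ** \<pi> a ** (u ** \<pi> p) = 0" by (simp flip: matrix_mul_assoc)
    qed (use 2(2) in auto)
    also have "\<dots> A = A ** (\<pi> p ** u ** \<pi> p) + (\<Sum>a\<in>{0..<p}. A ** \<pi> a ** (u ** \<pi> p))" for A :: "complex^'m^'m"
      by (simp add: matrix_mul_assoc)
    finally have eq: "A ** u ** \<pi> p = A ** \<pi> p + (\<Sum>a\<in>{0..<p}. A ** \<pi> a ** (u ** \<pi> p))" for A :: "complex^'m^'m"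
      using u by (simp add: lower_unipotent_def)
    have "translate u ?x - ?x = (\<lambda>A. \<Sum>a\<in>{0..<p}. (A ** \<pi> a ** (u ** \<pi> p)) $ i $ j)"
      by (rule ext) (simp add: translate_def grading_coord_def eq)
    also have "\<dots> \<in> mon_span n \<pi> (Suc 0) {..<weight n p}"
      using 2(2) by (intro sum_in_span_coord) auto
    finally have lx: "translate u ?x - ?x \<in> mon_span n \<pi> (Suc 0) {..<weight n p}" .
    have x: "?x \<in> mon_span n \<pi> (Suc 0) {weight n p}"
      by (rule mon_span_base[OF grading_coord_monomial[OF 2(2)]]) simp
    have lb: "translate u b0 - b0 \<in> mon_span n \<pi> d {..<w0}" using Suc.IH[OF 2(1)] .
    have "b0 \<in> mon_span n \<pi> d {..w0}" using 2(1) by (rule mon_span_base) simp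
    moreover have "translate u b0 - b0 \<in> mon_span n \<pi> d {..w0}"
      using lb mon_span_mono[of "{..<w0}" "{..w0}" n \<pi> d] by force
    ultimately have "(translate u b0 - b0) + b0 \<in> mon_span n \<pi> d {..w0}"
      unfolding mon_span_def by (intro fsp.span_add)
    then have b: "translate u b0 \<in> mon_span n \<pi> d {..w0}" by simp
    have "(translate u ?x - ?x) * translate u b0 \<in> mon_span n \<pi> (Suc 0 + d) {..<w}"
      using lx b by (rule mon_span_mult) (use 2 in auto)
    moreover have "?x * (translate u b0 - b0) \<in> mon_span n \<pi> (Suc 0 + d) {..<w}"
      using x lb by (rule mon_span_mult) (use 2 in auto)
    ultimately have "(translate u ?x - ?x) * translate u b0 + ?x * (translate u b0 - b0)
        \<in> mon_span n \<pi> (Suc 0 + d) {..<w}"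
      unfolding mon_span_def by (intro fsp.span_add)
    moreover have "translate u b - b = (translate u ?x - ?x) * translate u b0 + ?x * (translate u b0 - b0)"
      unfolding 2(4) translate_times by (simp add: fun_eq_iff algebra_simps)
    ultimately show ?thesis by (simp only: add_Suc add_0)
  qed
qed

lemma translate_mon_span:
  assumes "\<And>w b. (w, b) \<in> monomials n \<pi> d \<Longrightarrow> w \<in> J \<Longrightarrow> translate g b \<in> mon_span n \<pi> d K"
    and h: "h \<in> mon_span n \<pi> d J"
  shows "translate g h \<in> mon_span n \<pi> d K"
proof -
  interpret t: Vector_Spaces.linear fun_scale fun_scale "translate g" by (rule translate_linear)
  have "translate g h \<in> fsp.span (translate g ` {b. \<exists>w\<in>J. (w, b) \<in> monomials n \<pi> d})"
    using h unfolding mon_span_def t.span_image by (rule imageI)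
  also have "\<dots> \<subseteq> mon_span n \<pi> d K"
    by (rule fsp.span_minimal[OF _ subspace_mon_span]) (use assms(1) in blast)
  finally show ?thesis .
qed

lemma translate_upper:
  assumes gr: "grading n \<pi>" and q: "upper \<pi> q" and h: "h \<in> mon_span n \<pi> d {m..}"
  shows "translate q h \<in> mon_span n \<pi> d {m..}"
proof (rule translate_mon_span[OF _ h])
  fix w b assume "(w, b) \<in> monomials n \<pi> d" "w \<in> {m..}"
  then show "translate q b \<in> mon_span n \<pi> d {m..}"
    using translate_upper_monomial[OF gr q] mon_span_mono[of "{w..}" "{m..}" n \<pi> d] by auto
qed

lemma translate_lower:
  assumes gr: "grading n \<pi>" and u: "lower_unipotent \<pi> u" and h: "h \<in> mon_span n \<pi> d {m}"
  shows "translate u h - h \<in> mon_span n \<pi> d {..<m}"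
proof -
  interpret t: Vector_Spaces.linear fun_scale fun_scale "translate u" by (rule translate_linear)
  show ?thesis using h unfolding mon_span_def[of n \<pi> d "{m}"]
  proof (induction rule: fsp.span_induct_alt)
    case base
    then show ?case by (simp only: t.zero fsp.span_zero mon_span_def diff_self)
  next
    case (step c b y)
    have "translate u b - b \<in> mon_span n \<pi> d {..<m}"
      using translate_lower_monomial[OF gr u] step.hyps by auto
    then have "fun_scale c (translate u b - b) + (translate u y - y) \<in> mon_span n \<pi> d {..<m}"
      using step.IH unfolding mon_span_def by (intro fsp.span_add fsp.span_scale)
    moreover have "translate u (fun_scale c b + y) - (fun_scale c b + y) =
        fun_scale c (translate u b - b) + (translate u y - y)"
      by (simp add: translate_def fun_eq_iff algebra_simps)
    ultimately show ?case by (simp only:)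
  qed
qed

lemma translate_lower_less:
  assumes gr: "grading n \<pi>" and u: "lower_unipotent \<pi> u" and h: "h \<in> mon_span n \<pi> d {..<m}"
  shows "translate u h \<in> mon_span n \<pi> d {..<m}"
proof (rule translate_mon_span[OF _ h])
  fix w b assume b: "(w, b) \<in> monomials n \<pi> d" "w \<in> {..<m}"
  have "translate u b - b \<in> mon_span n \<pi> d {..<m}"
    using translate_lower_monomial[OF gr u b(1)] b(2) mon_span_mono[of "{..<w}" "{..<m}" n \<pi> d] by auto
  moreover have "b \<in> mon_span n \<pi> d {..<m}" using b by (rule mon_span_base)
  ultimately have "(translate u b - b) + b \<in> mon_span n \<pi> d {..<m}"
    unfolding mon_span_def by (rule fsp.span_add)
  then show "translate u b \<in> mon_span n \<pi> d {..<m}" by simp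
qed

text \<open>Collects a linear combination of monomials by weight. As the monomials may be dependent,
  uniqueness of the components is a separate matter, settled by evaluation along the
  cocharacter.\<close>

lemma weight_decomposition:
  assumes gr: "grading n \<pi>" and h: "h \<in> mon_span n \<pi> d J"
  obtains c where "\<And>j. homogeneous n \<pi> j (c j)" "\<And>j. c j \<in> mon_span n \<pi> d {j}"
    "\<And>j. j \<notin> J \<Longrightarrow> c j = 0" "h = (\<Sum>j\<in>fst ` monomials n \<pi> d. c j)"
proof -
  have "\<exists>c. (\<forall>j. homogeneous n \<pi> j (c j) \<and> c j \<in> mon_span n \<pi> d {j} \<and> (j \<notin> J \<longrightarrow> c j = 0)) \<and>
      h = (\<Sum>j\<in>fst ` monomials n \<pi> d. c j)"
    using h unfolding mon_span_def[of n \<pi> d J]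
  proof (induction rule: fsp.span_induct_alt)
    case base
    show ?case unfolding mon_span_def
      by (rule exI[of _ "\<lambda>_. 0"]) (use fsp.span_zero in \<open>auto simp: homogeneous_def zero_fun_def\<close>)
  next
    case (step z b y)
    then obtain c where c: "\<forall>j. homogeneous n \<pi> j (c j) \<and> c j \<in> mon_span n \<pi> d {j} \<and> (j \<notin> J \<longrightarrow> c j = 0)"
      "y = (\<Sum>j\<in>fst ` monomials n \<pi> d. c j)" by blast
    obtain w where w: "w \<in> J" "(w, b) \<in> monomials n \<pi> d" using step.hyps by blast
    define c' where "c' = c(w := fun_scale z b + c w)"
    have "fun_scale z b + c w \<in> mon_span n \<pi> d {w}"
      using c(1) mon_span_base[OF w(2), of "{w}"] unfolding mon_span_def
      by (intro fsp.span_add fsp.span_scale) auto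
    moreover have "homogeneous n \<pi> w (fun_scale z b + c w)"
      using c(1) homogeneous_monomial[OF gr w(2)] by (simp add: homogeneous_def algebra_simps)
    moreover have "(\<Sum>j\<in>fst ` monomials n \<pi> d. c' j) = fun_scale z b + y"
    proof -
      have w': "w \<in> fst ` monomials n \<pi> d" using w(2) by force
      have fin: "finite (fst ` monomials n \<pi> d)" using finite_monomials by blast
      show ?thesis unfolding c(2)
        by (simp only: sum.remove[OF fin w'] c'_def) (simp add: add.assoc)
    qed
    ultimately show ?case using c(1) w(1) by (intro exI[of _ c']) (auto simp: c'_def)
  qed
  then show thesis using that by blast
qed

text \<open>Evaluated at \<open>A ** cochar n \<pi> z\<close>, the two decompositions of
  \<open>h\<close> become Laurent polynomials in \<open>z\<close> that agree on the circle. Their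
  coefficients agree, and at each weight one of the two is zero.\<close>

lemma mon_span_lower_inter_upper:
  assumes gr: "grading n \<pi>" and h: "h \<in> mon_span n \<pi> d {..<m}" "h \<in> mon_span n \<pi> d {m..}"
  shows "h = 0"
proof -
  let ?J = "fst ` monomials n \<pi> d"
  have fin: "finite ?J" using finite_monomials by blast
  obtain c where c: "\<And>j. homogeneous n \<pi> j (c j)" "\<And>j. j \<notin> {..<m} \<Longrightarrow> c j = 0" "h = sum c ?J"
    using weight_decomposition[OF gr h(1)] by metis
  obtain c' where c': "\<And>j. homogeneous n \<pi> j (c' j)" "\<And>j. j \<notin> {m..} \<Longrightarrow> c' j = 0" "h = sum c' ?J"
    using weight_decomposition[OF gr h(2)] by metis
  have "c j A - c' j A = 0" if "j \<in> ?J" for j A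
  proof (rule laurent_coeffs_zero[OF fin _ that])
    fix z :: complex assume "norm z = 1"
    then have "z \<noteq> 0" by auto
    have "(\<Sum>j\<in>?J. z powi j * (c j A - c' j A)) = (\<Sum>j\<in>?J. z powi j * c j A) - (\<Sum>j\<in>?J. z powi j * c' j A)"
      by (simp add: sum_subtractf right_diff_distrib)
    also have "(\<Sum>j\<in>?J. z powi j * c j A) = sum c ?J (A ** cochar n \<pi> z)"
      using c(1) \<open>z \<noteq> 0\<close> by (simp add: sum_fun_apply homogeneous_def)
    also have "(\<Sum>j\<in>?J. z powi j * c' j A) = sum c' ?J (A ** cochar n \<pi> z)"
      using c'(1) \<open>z \<noteq> 0\<close> by (simp add: sum_fun_apply homogeneous_def)
    finally show "(\<Sum>j\<in>?J. z powi j * (c j A - c' j A)) = 0" using c(3) c'(3) by simp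
  qed
  then have "c j = 0" if "j \<in> ?J" for j
    using that c(2)[of j] c'(2)[of j] by (cases "j < m") (auto simp: fun_eq_iff)
  then show ?thesis using c(3) by simp
qed

text \<open>
  The open cell of \<open>G\<close> is the product of its factors in \<open>GL(V)\<close>. Let \<open>I\<close> be the space of functions
  in the span of the monomials that vanish on \<open>G\<close>. It is graded, and stable under translation by
  \<open>u ** q\<close>, so \<open>I = I\<^sub><\<^sub>m + (u ** q) I\<^sub>\<ge>\<^sub>m\<close> by a dimension count. If \<open>e \<in> I\<close> has weight \<open>m\<close> and
  \<open>e = a + (u ** q) h\<close>, then \<open>u\<^sup>-\<^sup>1 (e - a) = q h\<close> is both in \<open>e + (weights < m)\<close> and of weights \<open>\<ge> m\<close>,
  so it is \<open>e\<close>, and \<open>u e = e - a \<in> I\<close>.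
\<close>

lemma lower_factor_in_group:
  fixes \<pi> :: "int \<Rightarrow> complex^'m^'m"
  assumes gr: "grading n \<pi>" and S: "S \<subseteq> rat_poly_funs"
    and G: "G = {A. invertible A \<and> (\<forall>f\<in>S. f A = 0)}"
    and one: "mat 1 \<in> G" and mult: "\<And>A B. A \<in> G \<Longrightarrow> B \<in> G \<Longrightarrow> A ** B \<in> G"
    and cochar: "\<And>z. norm z = 1 \<Longrightarrow> cochar n \<pi> z \<in> G"
    and q: "upper \<pi> q" and u: "lower_unipotent \<pi> u" and uq: "u ** q \<in> G"
  shows "u \<in> G"
proof -
  obtain u' where u': "u ** u' = mat 1" "u' ** u = mat 1" "lower_unipotent \<pi> u'"
    using lower_unipotent_inverse[OF gr u] by blast
  obtain g' where g': "u ** q ** g' = mat 1" using uq G by (auto simp: invertible_def)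
  have "f u = 0" if fS: "f \<in> S" for f
  proof -
    obtain d where f: "f \<in> mon_span n \<pi> d UNIV" using rat_poly_funs_mon_span[OF gr] S fS by blast
    define I where "I J = mon_span n \<pi> d J \<inter> {h. \<forall>A\<in>G. h A = 0}" for J
    have vanish_sub: "fsp.subspace {h. \<forall>A\<in>G. h A = 0}"
      by (auto simp: fsp.subspace_def)
    have subI: "fsp.subspace (I J)" for J
      unfolding I_def by (rule fsp.subspace_inter[OF subspace_mon_span vanish_sub])
    have I_mono: "J \<subseteq> J' \<Longrightarrow> I J \<subseteq> I J'" for J J'
      unfolding I_def using mon_span_mono[of J J' n \<pi> d] by blast
    have transl: "translate g h \<in> I UNIV" if "h \<in> I UNIV" "g = u ** q" for g h
    proof -
      have "translate u (translate q h) \<in> mon_span n \<pi> d UNIV"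
      proof (rule translate_mon_span[where J = UNIV])
        fix w b assume b: "(w, b) \<in> monomials n \<pi> d"
        have "translate u b - b \<in> mon_span n \<pi> d UNIV" "b \<in> mon_span n \<pi> d UNIV"
          using translate_lower_monomial[OF gr u b] mon_span_base[OF b] mon_span_mono[of "{..<w}" UNIV n \<pi> d] by auto
        then have "(translate u b - b) + b \<in> mon_span n \<pi> d UNIV"
          unfolding mon_span_def by (rule fsp.span_add)
        then show "translate u b \<in> mon_span n \<pi> d UNIV" by simp
      next
        show "translate q h \<in> mon_span n \<pi> d UNIV"
        proof (rule translate_mon_span[where J = UNIV])
          fix w b assume "(w, b) \<in> monomials n \<pi> d"
          then show "translate q b \<in> mon_span n \<pi> d UNIV"
            using translate_upper_monomial[OF gr q] mon_span_mono[of "{w..}" UNIV n \<pi> d] by auto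
        qed (use that I_def in auto)
      qed
      moreover have "translate (u ** q) h A = 0" if "A \<in> G" for A
        using \<open>h \<in> I UNIV\<close> mult[OF that uq] by (auto simp: I_def translate_def)
      ultimately show ?thesis using that by (simp add: I_def translate_translate)
    qed
    \<comment> \<open>\<open>I\<close> is graded because \<open>G\<close> is stable under
      multiplication by the circle: for \<open>A\<close> in \<open>G\<close> the values of the
      components at \<open>A\<close> are the coefficients of a Laurent polynomial that vanishes on
      the circle.\<close>
    have comps: "\<exists>c. (\<forall>j. c j \<in> I {j} \<and> (j \<notin> J \<longrightarrow> c j = 0)) \<and> h = (\<Sum>j\<in>fst ` monomials n \<pi> d. c j)"
      if h: "h \<in> I J" for h J
    proof -
      have fin: "finite (fst ` monomials n \<pi> d)" using finite_monomials by blast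
      have "h \<in> mon_span n \<pi> d J" using h by (simp add: I_def)
      from weight_decomposition[OF gr this] obtain c where
        c: "\<And>j. homogeneous n \<pi> j (c j)" "\<And>j. c j \<in> mon_span n \<pi> d {j}"
        "\<And>j. j \<notin> J \<Longrightarrow> c j = 0" "h = (\<Sum>j\<in>fst ` monomials n \<pi> d. c j)" by blast
      \<comment> \<open>The Laurent argument reaches only the weights that occur in the sum; the
        other components are set to 0.\<close>
      define c' where "c' j = (if j \<in> fst ` monomials n \<pi> d then c j else 0)" for j
      have "c j A = 0" if "j \<in> fst ` monomials n \<pi> d" "A \<in> G" for j A
      proof (rule laurent_coeffs_zero[OF fin _ that(1)])
        fix z :: complex assume z: "norm z = 1"
        then have "z \<noteq> 0" by auto
        then have "(\<Sum>j\<in>fst ` monomials n \<pi> d. z powi j * c j A) = h (A ** cochar n \<pi> z)"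
          unfolding c(4) using c(1) by (simp add: sum_fun_apply homogeneous_def)
        also have "\<dots> = 0" using h mult[OF that(2) cochar[OF z]] by (simp add: I_def)
        finally show "(\<Sum>j\<in>fst ` monomials n \<pi> d. z powi j * c j A) = 0" .
      qed
      then have "c' j \<in> I {j}" for j
        using c(2)[of j] fsp.subspace_0[OF subspace_mon_span, of n \<pi> d "{j}"] by (auto simp: I_def c'_def)
      moreover have "h = (\<Sum>j\<in>fst ` monomials n \<pi> d. c' j)" unfolding c(4) c'_def by simp
      ultimately show ?thesis using c(3) by (intro exI[of _ c']) (auto simp: c'_def)
    qed
    have weight_case: "translate u e \<in> I UNIV" if e: "e \<in> I {m}" for m e
    proof -
      have "\<exists>l\<in>I {..<m}. \<exists>h\<in>I {m..}. e = l + translate (u ** q) h"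
      proof (rule fsp.subspace_decomp_image[where V = "I UNIV" and T = "snd ` monomials n \<pi> d"])
        show "finite (snd ` monomials n \<pi> d)" using finite_monomials by blast
        have "{b. \<exists>w\<in>UNIV. (w, b) \<in> monomials n \<pi> d} \<subseteq> snd ` monomials n \<pi> d" by force
        then show "I UNIV \<subseteq> fsp.span (snd ` monomials n \<pi> d)"
          unfolding I_def mon_span_def using fsp.span_mono by blast
        show "I {..<m} \<subseteq> I UNIV" by (rule I_mono) simp
        show "translate (u ** q) ` I {m..} \<subseteq> I UNIV"
          using transl I_mono[of "{m..}" UNIV] by auto
        show "e \<in> I UNIV" using e I_mono[of "{m}" UNIV] by auto
        show "inj_on (translate (u ** q)) (I {m..})"
        proof (rule inj_onI)
          fix x y assume "translate (u ** q) x = translate (u ** q) y"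
          then have "translate g' (translate (u ** q) x) = translate g' (translate (u ** q) y)" by simp
          moreover have "g' ** (u ** q) = mat 1" using g' matrix_left_right_inverse by blast
          ultimately show "x = y" by (simp add: translate_translate) (simp add: translate_def)
        qed
        \<comment> \<open>Translation by the inverse of \<open>u\<close> keeps weights below
          \<open>m\<close> and turns the second space into translates by \<open>q\<close>, of
          weights at least \<open>m\<close>.\<close>
        show "I {..<m} \<inter> translate (u ** q) ` I {m..} = {0}"
        proof (intro equalityI subsetI)
          fix x assume "x \<in> I {..<m} \<inter> translate (u ** q) ` I {m..}"
          then obtain h where x: "x \<in> I {..<m}" "x = translate (u ** q) h" and h: "h \<in> I {m..}" by blast
          have "translate u' x \<in> mon_span n \<pi> d {..<m}"
            using x(1) by (intro translate_lower_less[OF gr u'(3)]) (simp add: I_def)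
          moreover have eq: "translate u' x = translate q h"
            unfolding x(2) translate_translate by (simp add: u' matrix_mul_assoc)
          moreover have "translate q h \<in> mon_span n \<pi> d {m..}"
            using h by (intro translate_upper[OF gr q]) (simp add: I_def)
          ultimately have "translate u' x = 0" using mon_span_lower_inter_upper[OF gr] by metis
          then have "translate u (translate u' x) = 0" by (simp add: translate_def fun_eq_iff)
          then show "x \<in> {0}" unfolding translate_translate u' by (simp add: translate_def)
        next
          fix x assume "x \<in> {0 :: complex^'m^'m \<Rightarrow> complex}"
          moreover have "translate (u ** q) 0 = 0" by (simp add: translate_def fun_eq_iff)
          ultimately show "x \<in> I {..<m} \<inter> translate (u ** q) ` I {m..}"
            using fsp.subspace_0[OF subI] by force
        qed
        fix v assume "v \<in> I UNIV"
        then obtain c where c: "\<And>j. c j \<in> I {j}" "v = (\<Sum>j\<in>fst ` monomials n \<pi> d. c j)"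
          using comps by blast
        let ?J = "fst ` monomials n \<pi> d"
        have "v = sum c (?J \<inter> {..<m}) + sum c (?J \<inter> {m..})"
          unfolding c(2) using finite_monomials[of n \<pi> d]
          by (subst sum.union_disjoint[symmetric]) (auto intro!: sum.cong)
        moreover have "sum c (?J \<inter> {..<m}) \<in> I {..<m}"
          using c(1) I_mono[of "{_}" "{..<m}"] by (intro fsp.subspace_sum[OF subI]) auto
        moreover have "sum c (?J \<inter> {m..}) \<in> I {m..}"
          using c(1) I_mono[of "{_}" "{m..}"] by (intro fsp.subspace_sum[OF subI]) auto
        ultimately show "\<exists>l\<in>I {..<m}. \<exists>h\<in>I {m..}. v = l + h" by blast
      qed (use subI translate_linear in auto)
      then obtain a h where a: "a \<in> I {..<m}" and h: "h \<in> I {m..}" and eq: "e = a + translate (u ** q) h"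
        by blast
      have "translate u' (e - a) = translate q h"
      proof -
        have "e - a = translate (u ** q) h" using eq by simp
        then show ?thesis by (simp only: translate_translate matrix_mul_assoc u' matrix_mul_lid)
      qed
      then have "translate u' (e - a) \<in> mon_span n \<pi> d {m..}"
        using h translate_upper[OF gr q] by (auto simp: I_def)
      moreover have em: "e \<in> mon_span n \<pi> d {m}" using e by (simp add: I_def)
      then have "e \<in> mon_span n \<pi> d {m..}" using mon_span_mono[of "{m}" "{m..}" n \<pi> d] by auto
      ultimately have up: "translate u' (e - a) - e \<in> mon_span n \<pi> d {m..}"
        unfolding mon_span_def by (rule fsp.span_diff)
      have "translate u' e - e \<in> mon_span n \<pi> d {..<m}" by (rule translate_lower[OF gr u'(3) em])
      moreover have "translate u' a \<in> mon_span n \<pi> d {..<m}"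
        using a by (intro translate_lower_less[OF gr u'(3)]) (simp add: I_def)
      ultimately have "(translate u' e - e) - translate u' a \<in> mon_span n \<pi> d {..<m}"
        unfolding mon_span_def by (rule fsp.span_diff)
      moreover have "(translate u' e - e) - translate u' a = translate u' (e - a) - e"
        by (simp add: translate_def fun_eq_iff)
      ultimately have "translate u' (e - a) - e = 0"
        using up by (intro mon_span_lower_inter_upper[OF gr]) simp_all
      then have "translate u (translate u' (e - a)) = translate u e" by simp
      then have "translate u e = e - a" unfolding translate_translate u' by (simp add: translate_def fun_eq_iff)
      moreover have "e - a \<in> I UNIV"
        using e a I_mono[of "{m}" UNIV] I_mono[of "{..<m}" UNIV] by (intro fsp.subspace_diff[OF subI]) auto
      ultimately show ?thesis by simp
    qed
    have "f \<in> I UNIV" using f fS G by (auto simp: I_def)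
    then obtain c where c: "\<And>j. c j \<in> I {j}" "f = (\<Sum>j\<in>fst ` monomials n \<pi> d. c j)"
      using comps by blast
    \<comment> \<open>The translate of \<open>c j\<close> by \<open>u\<close> vanishes on all of
      \<open>G\<close>; its value at the identity is \<open>c j u\<close>.\<close>
    have "c j u = 0" for j
    proof -
      have "translate u (c j) (mat 1) = 0" using weight_case[OF c(1)[of j]] one by (simp add: I_def)
      then show ?thesis by (simp add: translate_def)
    qed
    then show "f u = 0" by (simp add: c(2) sum_fun_apply)
  qed
  moreover have "invertible u" using u' unfolding invertible_def by blast
  ultimately show ?thesis using G by simp
qed

section \<open>Complex conjugation\<close>

abbreviation cnj_mat :: "complex^'m^'m \<Rightarrow> complex^'m^'m" where
  "cnj_mat \<equiv> map_matrix cnj"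

lemma cnj_vec_cnj_vec [simp]: "cnj_vec (cnj_vec v) = v"
  by (simp add: cnj_vec_def vec_eq_iff)

lemma cnj_vec_add: "cnj_vec (u + v) = cnj_vec u + cnj_vec v"
  by (simp add: cnj_vec_def vec_eq_iff)

lemma cnj_vec_diff: "cnj_vec (u - v) = cnj_vec u - cnj_vec v"
  by (simp add: cnj_vec_def vec_eq_iff)

lemma cnj_vec_0 [simp]: "cnj_vec 0 = 0"
  by (simp add: cnj_vec_def vec_eq_iff)

lemma cnj_vec_scale: "cnj_vec (c *s v) = cnj c *s cnj_vec v"
  by (simp add: cnj_vec_def vec_eq_iff)

lemma cnj_vec_image_iff: "v \<in> cnj_vec ` S \<longleftrightarrow> cnj_vec v \<in> S"
  by (metis cnj_vec_cnj_vec image_iff)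

lemma subspace_cnj_vec_image: "vec.subspace S \<Longrightarrow> vec.subspace (cnj_vec ` S)"
  unfolding vec.subspace_def cnj_vec_image_iff cnj_vec_add cnj_vec_scale by simp

lemma cnj_vec_mul: "cnj_vec (A *v v) = cnj_mat A *v cnj_vec v"
  by (simp add: cnj_vec_def vec_eq_iff matrix_vector_mult_def)

lemma cnj_mat_mult: "cnj_mat (A ** B) = cnj_mat A ** cnj_mat B"
  by (simp add: vec_eq_iff matrix_matrix_mult_def)

lemma cnj_mat_sum: "cnj_mat (\<Sum>i\<in>S. f i) = (\<Sum>i\<in>S. cnj_mat (f i))"
  by (simp add: vec_eq_iff)

lemma cnj_mat_one [simp]: "cnj_mat (mat 1) = mat 1"
  by (simp add: vec_eq_iff mat_def)

lemma cnj_mat_zero [simp]: "cnj_mat 0 = 0"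
  by (simp add: vec_eq_iff)

lemma cnj_mat_cnj_mat [simp]: "cnj_mat (cnj_mat A) = A"
  by (simp add: vec_eq_iff)

lemma cnj_mat_cscale: "cnj_mat (mat_cscale z A) = mat_cscale (cnj z) (cnj_mat A)"
  by (simp add: vec_eq_iff)

lemma invertible_cnj_mat: "invertible A \<Longrightarrow> invertible (cnj_mat A)"
  unfolding invertible_def by (metis cnj_mat_mult cnj_mat_one)

lemma cnj_mat_fixed_iff: "cnj_mat A = A \<longleftrightarrow> (\<exists>B. A = complexify_matrix B)"
proof
  assume "cnj_mat A = A"
  then have "A = complexify_matrix (map_matrix Re A)"
    by (simp add: vec_eq_iff complex_eq_iff)
  then show "\<exists>B. A = complexify_matrix B" by blast
qed (auto simp: vec_eq_iff)

lemma complexify_mult: "complexify_matrix (A ** B) = complexify_matrix A ** complexify_matrix B"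
  by (simp add: vec_eq_iff matrix_matrix_mult_def)

lemma complexify_one [simp]: "complexify_matrix (mat 1) = mat 1"
  by (simp add: vec_eq_iff mat_def)

section \<open>Gradings from opposite filtrations\<close>

lemma complement_projection:
  fixes A B :: "(complex^'m) set"
  assumes A: "vec.subspace A" and B: "vec.subspace B" and int: "A \<inter> B = {0}"
    and sum: "{u + v |u v. u \<in> A \<and> v \<in> B} = UNIV"
  shows "\<exists>T::complex^'m^'m. \<forall>v. T *v v \<in> A \<and> v - T *v v \<in> B"
proof -
  have "\<exists>a. a \<in> A \<and> v - a \<in> B" for v
  proof -
    have "v \<in> {u + v |u v. u \<in> A \<and> v \<in> B}" using sum by simp
    then show ?thesis by force
  qed
  then obtain f where f: "\<And>v. f v \<in> A" "\<And>v. v - f v \<in> B" by metis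
  have uniq: "a = b" if "a \<in> A" "b \<in> A" "v - a \<in> B" "v - b \<in> B" for a b v
  proof -
    have "a - b \<in> A" using that A vec.subspace_diff by blast
    moreover have "(v - b) - (v - a) \<in> B" using that B vec.subspace_diff by blast
    ultimately have "a - b \<in> A \<inter> B" by simp
    then show ?thesis using int by simp
  qed
  have "Vector_Spaces.linear (*s) (*s) f"
  proof (unfold_locales, goal_cases)
    case (1 x y)
    show ?case
    proof (rule uniq)
      show "f x + f y \<in> A" using f A vec.subspace_add by blast
      have "(x - f x) + (y - f y) \<in> B" using f B vec.subspace_add by blast
      then show "(x + y) - (f x + f y) \<in> B" by (simp add: algebra_simps)
    qed (use f in auto)
  next
    case (2 c x)
    show ?case
    proof (rule uniq)
      show "c *s f x \<in> A" using f A vec.subspace_scale by blast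
      have "c *s (x - f x) \<in> B" using f B vec.subspace_scale by blast
      then show "c *s x - c *s f x \<in> B" by (simp add: vec.scale_right_diff_distrib)
    qed (use f in auto)
  qed
  then have "matrix f *v v = f v" for v by (rule matrix_works)
  then show ?thesis using f by (intro exI[of _ "matrix f"]) simp
qed

lemma int_chain_mono:
  fixes F :: "int \<Rightarrow> 'a set"
  assumes "\<And>p. F p \<subseteq> F (p + 1)" "a \<le> b"
  shows "F a \<subseteq> F b"
  using assms(2)
proof (induction rule: int_ge_induct)
  case (step i)
  then show ?case using assms(1) by blast
qed simp

definition splits :: "(int \<Rightarrow> complex^'m^'m) \<Rightarrow> 'm::finite filtration \<Rightarrow> bool" where
  "splits \<pi> F \<longleftrightarrow> (\<forall>p. F p = {v. \<forall>a<p. \<pi> a *v v = 0})"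

text \<open>Let \<open>\<tau> p\<close> project onto \<open>F p\<close> along \<open>E p\<close>.
  Monotonicity of both filtrations gives \<open>\<tau> p ** \<tau> q = \<tau> (max p q)\<close>, so
  the successive differences are orthogonal idempotents and their sum telescopes. Since
  \<open>E p\<close> is complementary to \<open>F p\<close>, it is the sum of the pieces of index
  below \<open>p\<close>.\<close>

lemma grading_from_opposite:
  fixes F E :: "'m::finite filtration"
  assumes sF: "\<And>p. vec.subspace (F p)" and sE: "\<And>p. vec.subspace (E p)"
    and decF: "\<And>p. F (p + 1) \<subseteq> F p" and incE: "\<And>p. E p \<subseteq> E (p + 1)"
    and int: "\<And>p. F p \<inter> E p = {0}"
    and sum: "\<And>p. {u + v |u v. u \<in> F p \<and> v \<in> E p} = UNIV"
    and bot: "\<And>p. p \<le> 0 \<Longrightarrow> F p = UNIV" and top: "\<And>p. p > int n \<Longrightarrow> F p = {0}"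
  shows "\<exists>\<pi>. grading n \<pi> \<and> splits \<pi> F \<and> (\<forall>p. E p = {v. \<forall>a\<ge>p. \<pi> a *v v = 0})"
proof -
  have "\<exists>T::complex^'m^'m. \<forall>v. T *v v \<in> F p \<and> v - T *v v \<in> E p" for p
    using complement_projection sF sE int sum by blast
  then obtain \<tau> :: "int \<Rightarrow> complex^'m^'m" where
    \<tau>: "\<And>p v. \<tau> p *v v \<in> F p" "\<And>p v. v - \<tau> p *v v \<in> E p" by metis
  have id: "\<tau> p *v v = v" if "v \<in> F p" for p v
  proof -
    have "v - \<tau> p *v v \<in> F p" using that \<tau>(1) sF vec.subspace_diff by blast
    then have "v - \<tau> p *v v \<in> F p \<inter> E p" using \<tau>(2) by blast
    then show ?thesis using int by simp
  qed
  have ker: "\<tau> p *v v = 0" if "v \<in> E p" for p v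
  proof -
    have "v - (v - \<tau> p *v v) \<in> E p" using that \<tau>(2) sE vec.subspace_diff by blast
    then have "\<tau> p *v v \<in> F p \<inter> E p" using \<tau>(1) by simp
    then show ?thesis using int by simp
  qed
  have Fmono: "F q \<subseteq> F p" if "p \<le> q" for p q
    using int_chain_mono[of "\<lambda>p. F (- p)" "- q" "- p"] that decF[of "- (_ + 1)"] by simp
  have Emono: "E p \<subseteq> E q" if "p \<le> q" for p q
    using int_chain_mono[of E, OF incE that] .
  have comp1: "\<tau> p ** \<tau> q = \<tau> q" if "p \<le> q" for p q
    using id[of "\<tau> q *v _" p] \<tau>(1) Fmono[OF that] by (auto simp: matrix_eq simp flip: matrix_vector_mul_assoc)
  have comp2: "\<tau> q ** \<tau> p = \<tau> q" if "p \<le> q" for p q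
  proof -
    have "\<tau> q *v (v - \<tau> p *v v) = 0" for v
      using ker[of "v - \<tau> p *v v" q] \<tau>(2) Emono[OF that] by blast
    then show ?thesis
      by (simp add: matrix_eq matrix_vector_mult_diff_distrib flip: matrix_vector_mul_assoc)
  qed
  have comp: "\<tau> p ** \<tau> q = \<tau> (max p q)" for p q
    using comp1[of p q] comp2[of q p] by (auto simp: max_def)
  have \<tau>bot: "\<tau> p = mat 1" if "p \<le> 0" for p
    using id[of _ p] bot[OF that] by (simp add: matrix_eq)
  have \<tau>top: "\<tau> p = 0" if "p > int n" for p
    using \<tau>(1)[of p] top[OF that] by (simp add: matrix_eq)
  define \<pi> where "\<pi> p = \<tau> p - \<tau> (p + 1)" for p
  have mul: "\<pi> a ** \<pi> b = \<tau> (max a b) - \<tau> (max a (b + 1)) - \<tau> (max (a + 1) b) + \<tau> (max (a + 1) (b + 1))" for a b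
  proof -
    have "(\<tau> a - \<tau> (a+1)) ** (\<tau> b - \<tau> (b+1)) =
      \<tau> a ** \<tau> b - \<tau> a ** \<tau> (b+1) - \<tau> (a+1) ** \<tau> b + \<tau> (a+1) ** \<tau> (b+1)"
      by (simp add: vec_eq_iff matrix_matrix_mult_def algebra_simps sum.distrib sum_subtractf)
    then show ?thesis unfolding \<pi>_def comp .
  qed
  have "grading n \<pi>"
    unfolding grading_def
  proof (intro conjI allI impI)
    fix a b show "\<pi> a ** \<pi> b = (if a = b then \<pi> a else 0)"
    proof -
      consider "a = b" | "a < b" | "a > b" by linarith
      then show ?thesis unfolding mul
      proof cases
        case 2
        then have "max a b = b" "max a (b+1) = b + 1" "max (a+1) b = b" "max (a+1) (b+1) = b + 1" by auto
        then show "\<tau> (max a b) - \<tau> (max a (b + 1)) - \<tau> (max (a + 1) b) + \<tau> (max (a + 1) (b + 1)) = (if a = b then \<pi> a else 0)"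
          using 2 by simp
      next
        case 3
        then have "max a b = a" "max a (b+1) = a" "max (a+1) b = a + 1" "max (a+1) (b+1) = a + 1" by auto
        then show "\<tau> (max a b) - \<tau> (max a (b + 1)) - \<tau> (max (a + 1) b) + \<tau> (max (a + 1) (b + 1)) = (if a = b then \<pi> a else 0)"
          using 3 by simp
      qed (simp add: \<pi>_def)
    qed
  next
    have "(\<Sum>a\<in>{0..int k}. \<pi> a) = \<tau> 0 - \<tau> (int k + 1)" for k
    proof (induction k)
      case (Suc k)
      have "{0..int (Suc k)} = insert (int k + 1) {0..int k}" by auto
      then show ?case using Suc by (simp add: \<pi>_def algebra_simps)
    qed (simp add: \<pi>_def)
    then show "(\<Sum>a\<in>{0..int n}. \<pi> a) = mat 1" by (simp add: \<tau>bot \<tau>top)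
  next
    fix a assume "a \<notin> {0..int n}"
    then show "\<pi> a = 0" by (cases "a < 0") (simp_all add: \<pi>_def \<tau>bot \<tau>top)
  qed
  moreover have "splits \<pi> F" unfolding splits_def
  proof (intro allI equalityI subsetI CollectI impI)
    fix p v a assume "v \<in> F p" "a < p"
    then have "v \<in> F a" "v \<in> F (a + 1)" using Fmono[of a p] Fmono[of "a + 1" p] by auto
    then show "\<pi> a *v v = 0" by (simp add: \<pi>_def matrix_vector_mult_diff_rdistrib id)
  next
    fix p v assume "v \<in> {v. \<forall>a<p. \<pi> a *v v = 0}"
    then have "\<tau> a *v v - \<tau> (a + 1) *v v = 0" if "a < p" for a
      using that unfolding \<pi>_def matrix_vector_mult_diff_rdistrib by blast
    then have v: "\<tau> a *v v = \<tau> (a + 1) *v v" if "a < p" for a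
      using that by (meson eq_iff_diff_eq_0)
    have "\<tau> a *v v = v" if "a \<le> p" "0 \<le> a" for a
      using that(2,1)
    proof (induction rule: int_ge_induct)
      case (step i)
      then show ?case using v[of i] by simp
    qed (simp add: \<tau>bot)
    then show "v \<in> F p" using \<tau>(1)[of p v] bot[of p] by (cases "p \<ge> 0") auto
  qed
  moreover have "E p = {v. \<forall>a\<ge>p. \<pi> a *v v = 0}" for p
  proof (intro equalityI subsetI CollectI allI impI)
    fix v a assume "v \<in> E p" "p \<le> a"
    then have "v \<in> E a" "v \<in> E (a + 1)" using Emono[of p a] Emono[of p "a + 1"] by auto
    then show "\<pi> a *v v = 0" by (simp add: \<pi>_def matrix_vector_mult_diff_rdistrib ker)
  next
    fix v assume "v \<in> {v. \<forall>a\<ge>p. \<pi> a *v v = 0}"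
    then have "\<tau> a *v v - \<tau> (a + 1) *v v = 0" if "p \<le> a" for a
      using that unfolding \<pi>_def matrix_vector_mult_diff_rdistrib by blast
    then have v: "\<tau> a *v v = \<tau> (a + 1) *v v" if "p \<le> a" for a
      using that by (meson eq_iff_diff_eq_0)
    have "\<tau> p *v v = \<tau> a *v v" if "p \<le> a" for a
      using that
    proof (induction rule: int_ge_induct)
      case (step i)
      then show ?case using v[of i] by simp
    qed simp
    from this[of "max p (int n + 1)"] have "\<tau> p *v v = 0" by (simp add: \<tau>top)
    then show "v \<in> E p" using \<tau>(2)[of v p] by simp
  qed
  ultimately show ?thesis by blast
qed

text \<open>The opposite filtration is the conjugate one, indexed so that
  \<open>F p \<inter> E (p + 1)\<close> is V^(p,n-p). These pieces span, so the definite description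
  in \<open>hodge_circle\<close> has exactly one solution.\<close>

lemma hodge_filtration_grading:
  assumes "hodge_filtration n F"
  shows "\<exists>\<pi>. grading n \<pi> \<and> splits \<pi> F \<and> (\<forall>z. hodge_circle n F z = cochar n \<pi> z)"
proof -
  define E where "E p = cnj_vec ` F (int n - p + 1)" for p
  have F: "\<And>p. vec.subspace (F p)" "\<And>p. F (p + 1) \<subseteq> F p" "\<And>p. p \<le> 0 \<Longrightarrow> F p = UNIV"
    "\<And>p. p > int n \<Longrightarrow> F p = {0}" "\<And>p. F p \<inter> E p = {0}"
    "\<And>p. {u + v |u v. u \<in> F p \<and> v \<in> E p} = UNIV"
    using assms unfolding hodge_filtration_def E_def by simp_all
  have "E p \<subseteq> E (p + 1)" for p
    using F(2)[of "int n - p"] by (simp add: E_def image_mono)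
  moreover have "vec.subspace (E p)" for p
    using F(1) by (simp add: E_def subspace_cnj_vec_image)
  ultimately obtain \<pi> where gr: "grading n \<pi>" and sp: "splits \<pi> F"
    and E: "\<And>p. E p = {v. \<forall>a\<ge>p. \<pi> a *v v = 0}"
    using grading_from_opposite[of F E n] F by blast
  have comp: "hodge_component n F p = range ((*v) (\<pi> p))" for p
  proof -
    have "hodge_component n F p = F p \<inter> E (p + 1)" by (simp add: hodge_component_def E_def)
    also have "\<dots> = {v. \<forall>a. a \<noteq> p \<longrightarrow> \<pi> a *v v = 0}"
      using sp unfolding splits_def E by (auto simp: neq_iff)
    also have "\<dots> = range ((*v) (\<pi> p))"
    proof (intro equalityI subsetI)
      fix v assume v: "v \<in> {v. \<forall>a. a \<noteq> p \<longrightarrow> \<pi> a *v v = 0}"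
      have "v = (\<Sum>a\<in>{0..int n}. \<pi> a *v v)" by (rule grading_expand_vec[OF gr])
      also have "\<dots> = (\<Sum>a\<in>{0..int n}. if a = p then \<pi> p *v v else 0)"
        using v by (intro sum.cong) auto
      also have "\<dots> = \<pi> p *v v" by (simp add: grading_outside[OF gr])
      finally show "v \<in> range ((*v) (\<pi> p))" by blast
    qed (auto simp: grading_vec[OF gr])
    finally show ?thesis .
  qed
  have "hodge_circle n F z = cochar n \<pi> z" for z
    unfolding hodge_circle_def comp
  proof (rule the_equality)
    show "\<forall>p. \<forall>v\<in>range ((*v) (\<pi> p)). cochar n \<pi> z *v v = z powi (p - (int n - p)) *s v"
      by (auto simp: matrix_vector_mul_assoc cochar_mult_proj[OF gr] mat_cscale_mul_vec weight_def algebra_simps)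
    fix A assume A: "\<forall>p. \<forall>v\<in>range ((*v) (\<pi> p)). A *v v = z powi (p - (int n - p)) *s v"
    have "A ** \<pi> p = cochar n \<pi> z ** \<pi> p" for p
      using A by (auto simp: matrix_eq cochar_mult_proj[OF gr] mat_cscale_mul_vec weight_def algebra_simps
          simp flip: matrix_vector_mul_assoc)
    then show "A = cochar n \<pi> z"
      by (subst grading_expand_right[OF gr, of A], subst grading_expand_right[OF gr, of "cochar n \<pi> z"]) simp
  qed
  then show ?thesis using gr sp by blast
qed

section \<open>Polynomial curves\<close>

definition poly_curve :: "(complex \<Rightarrow> complex^'m^'m) \<Rightarrow> bool" where
  "poly_curve M \<longleftrightarrow> (\<forall>i j. \<exists>P. \<forall>s. M s $ i $ j = poly P s)"

lemma poly_curve_sum: "poly_curve (\<lambda>s. \<Sum>x\<in>X. mat_cscale (poly (P x) s) (C x))"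
  unfolding poly_curve_def
  by (intro allI exI[of _ "\<Sum>x\<in>X. smult (C x $ _ $ _) (P x)"]) (simp add: poly_sum mult.commute)

lemma poly_curve_mult_right:
  assumes "poly_curve M" shows "poly_curve (\<lambda>s. M s ** B)"
proof -
  obtain P where "\<And>i j s. M s $ i $ j = poly (P i j) s" using assms unfolding poly_curve_def by metis
  then show ?thesis unfolding poly_curve_def
    by (intro allI exI[of _ "\<Sum>k\<in>UNIV. smult (B $ k $ _) (P _ k)"])
      (simp add: poly_sum mult.commute matrix_matrix_mult_def)
qed

lemma poly_curve_compose:
  assumes "poly_curve M" shows "poly_curve (\<lambda>s. M (poly Q s))"
  using assms unfolding poly_curve_def by (metis poly_pcompose)

lemma rat_poly_fun_curve:
  assumes M: "poly_curve M" and "f \<in> rat_poly_funs"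
  shows "\<exists>P. \<forall>s. f (M s) = poly P s"
  using assms(2)
proof induction
  case (const c)
  then show ?case by (intro exI[of _ "[:of_rat c:]"]) simp
next
  case (coord i j)
  then show ?case using M by (simp add: poly_curve_def)
next
  case (add f g)
  then show ?case by (metis poly_add)
next
  case (mult f g)
  then show ?case by (metis poly_mult)
qed

lemma poly_zero_infinite:
  fixes P :: "complex poly"
  assumes "infinite X" "\<And>s. s \<in> X \<Longrightarrow> poly P s = 0"
  shows "P = 0"
  using assms poly_roots_finite[of P] finite_subset[of X "{x. poly P x = 0}"] by blast

lemma rat_poly_fun_curve_zero:
  assumes "poly_curve M" "f \<in> rat_poly_funs" "infinite X" "\<And>s. s \<in> X \<Longrightarrow> f (M s) = 0"
  shows "f (M s) = 0"
  using rat_poly_fun_curve[OF assms(1,2)] poly_zero_infinite[OF assms(3)] assms(4) by (metis poly_0)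

lemma poly_curve_eq:
  assumes "poly_curve M" "poly_curve M'" "infinite X" "\<And>s. s \<in> X \<Longrightarrow> M s = M' s"
  shows "M s = M' s"
proof -
  have "M s $ i $ j = M' s $ i $ j" for i j
  proof -
    obtain P P' where P: "\<And>s. M s $ i $ j = poly P s" "\<And>s. M' s $ i $ j = poly P' s"
      using assms(1,2) unfolding poly_curve_def by metis
    have "P - P' = 0"
      by (rule poly_zero_infinite[OF assms(3)]) (simp add: assms(4) flip: P)
    then show ?thesis using P by simp
  qed
  then show ?thesis by (simp add: vec_eq_iff)
qed

lemma infinite_of_nat: "infinite (range (of_nat :: nat \<Rightarrow> complex))"
  using finite_imageD inj_of_nat infinite_UNIV_nat by blast

lemma infinite_nonzero: "infinite (- {0 :: complex})"
  by (simp add: Compl_eq_Diff_UNIV infinite_UNIV_char_0)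

text \<open>Rational coefficients are fixed by conjugation; this is what makes \<open>G\<close>
  stable under it.\<close>

lemma rat_poly_fun_cnj: "f \<in> rat_poly_funs \<Longrightarrow> f (cnj_mat A) = cnj (f A)"
  by (induction rule: rat_poly_funs.induct) (auto simp: of_rat_def split: prod.splits)

locale rat_group =
  fixes S :: "(complex^'m^'m \<Rightarrow> complex) set" and G :: "(complex^'m^'m) set"
  assumes S: "S \<subseteq> rat_poly_funs"
    and G: "G = {A. invertible A \<and> (\<forall>f\<in>S. f A = 0)}"
    and one: "mat 1 \<in> G"
    and mult: "A \<in> G \<Longrightarrow> B \<in> G \<Longrightarrow> A ** B \<in> G"
begin

lemma cnj: "A \<in> G \<Longrightarrow> cnj_mat A \<in> G"
  using S invertible_cnj_mat rat_poly_fun_cnj unfolding G by fastforce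

text \<open>The circle is Zariski dense in the nonzero complex numbers: along the cocharacter each
  equation of \<open>G\<close> is a Laurent polynomial in the parameter.\<close>

lemma cochar_in_group:
  assumes gr: "grading n \<pi>" and circ: "\<And>z. norm z = 1 \<Longrightarrow> cochar n \<pi> z \<in> G" and t: "t \<noteq> 0"
  shows "cochar n \<pi> t \<in> G"
proof -
  have "f (cochar n \<pi> t) = 0" if fS: "f \<in> S" for f
  proof -
    obtain d where f: "f \<in> mon_span n \<pi> d UNIV" using rat_poly_funs_mon_span[OF gr] S fS by blast
    let ?J = "fst ` monomials n \<pi> d"
    have fin: "finite ?J" using finite_monomials by blast
    from weight_decomposition[OF gr f] obtain c where
      c: "\<And>j. homogeneous n \<pi> j (c j)" "f = sum c ?J" by metis
    have ev: "f (cochar n \<pi> z) = (\<Sum>j\<in>?J. z powi j * c j (mat 1))" if "z \<noteq> 0" for z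
    proof -
      have "c j (cochar n \<pi> z) = z powi j * c j (mat 1)" for j
        using c(1)[of j] that unfolding homogeneous_def by (metis matrix_mul_lid)
      then show ?thesis unfolding c(2) by (simp add: sum_fun_apply)
    qed
    have "c j (mat 1) = 0" if "j \<in> ?J" for j
    proof (rule laurent_coeffs_zero[OF fin _ that])
      fix z :: complex assume z: "norm z = 1"
      then have "z \<noteq> 0" by auto
      then show "(\<Sum>j\<in>?J. z powi j * c j (mat 1)) = 0" using ev[of z] circ[OF z] fS G by auto
    qed
    then show ?thesis using ev[OF t] by simp
  qed
  then show ?thesis using invertible_cochar[OF gr t] by (simp add: G)
qed

text \<open>The equations extend from infinitely many parameters to all of them, whereas
  invertibility may fail at some; hence it is assumed at the parameter \<open>s\<close> in
  question.\<close>

lemma curve_in_group: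
  assumes "poly_curve M" "infinite X" "\<And>s. s \<in> X \<Longrightarrow> M s \<in> G" "invertible (M s)"
  shows "M s \<in> G"
  using assms rat_poly_fun_curve_zero[OF assms(1) _ assms(2)] S by (auto simp: G)

end

section \<open>Real gradings\<close>

lemma matrix_add_rdistrib: "(A + B) ** C = A ** C + B ** C" for A B C :: "complex^'m^'m"
  by (simp add: vec_eq_iff matrix_matrix_mult_def algebra_simps sum.distrib)

lemma map_matrix_ident [simp]: "map_matrix (\<lambda>x. x) A = A"
  by (simp add: vec_eq_iff)

lemma mat_cscale_add: "mat_cscale z (A + B) = mat_cscale z A + mat_cscale z B"
  by (simp add: vec_eq_iff distrib_left)

text \<open>The binomial series of (1 + X)^\<open>\<tau>\<close>, complete when
  \<open>mat_pow X (Suc n) = 0\<close>. It is polynomial in \<open>\<tau>\<close>, so statements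
  about natural exponents extend to \<open>\<tau> = 1/2\<close>, the square root.\<close>

definition unipotent_power :: "nat \<Rightarrow> complex^'m^'m \<Rightarrow> complex \<Rightarrow> complex^'m^'m" where
  "unipotent_power n X \<tau> = (\<Sum>k\<le>n. mat_cscale (\<tau> gchoose k) (mat_pow X k))"

lemma poly_curve_gchoose: "poly_curve (\<lambda>\<tau>. \<Sum>k\<le>n. mat_cscale (\<tau> gchoose k) (C k))"
proof -
  have eq: "\<tau> gchoose k = poly (smult (inverse (fact k)) (\<Prod>i<k. [:- of_nat i, 1:])) \<tau>" for \<tau> :: complex and k
    by (simp add: gbinomial_prod_rev poly_prod divide_inverse atLeast0LessThan)
  show ?thesis unfolding eq by (rule poly_curve_sum)
qed

lemma unipotent_power_zero: "unipotent_power n X 0 = mat 1"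
proof -
  have "unipotent_power n X 0 = (\<Sum>k\<le>n. if k = 0 then mat 1 else 0)"
    unfolding unipotent_power_def
    by (intro sum.cong) (auto simp: gbinomial_0_left vec_eq_iff)
  then show ?thesis by simp
qed

context
  fixes n :: nat and X :: "complex^'m^'m"
  assumes nil: "mat_pow X (Suc n) = 0"
begin

text \<open>Pascal's rule; the one surplus term contains \<open>mat_pow X (Suc n)\<close>.\<close>

lemma unipotent_power_Suc: "(mat 1 + X) ** unipotent_power n X \<tau> = unipotent_power n X (\<tau> + 1)"
proof -
  let ?c = "\<lambda>\<tau> k. mat_cscale (\<tau> gchoose k) (mat_pow X k)"
  have "(mat 1 + X) ** unipotent_power n X \<tau> =
      (\<Sum>k\<le>n. ?c \<tau> k) + (\<Sum>k\<le>n. mat_cscale (\<tau> gchoose k) (mat_pow X (Suc k)))"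
    by (simp add: unipotent_power_def matrix_add_rdistrib matrix_mul_sum_right mat_cscale_mult_right
        mat_cscale_add sum.distrib)
  also have "(\<Sum>k\<le>n. ?c \<tau> k) = mat 1 + (\<Sum>k<n. ?c \<tau> (Suc k))"
    by (subst sum.atMost_shift) simp
  also have "(\<Sum>k\<le>n. mat_cscale (\<tau> gchoose k) (mat_pow X (Suc k))) =
      (\<Sum>k<n. mat_cscale (\<tau> gchoose k) (mat_pow X (Suc k)))"
    using nil by (subst lessThan_Suc_atMost[symmetric]) simp
  also have "mat 1 + (\<Sum>k<n. ?c \<tau> (Suc k)) + \<dots> = mat 1 + (\<Sum>k<n. ?c (\<tau> + 1) (Suc k))"
  proof -
    have "mat_cscale ((\<tau> + 1) gchoose Suc k) A = mat_cscale (\<tau> gchoose Suc k) A + mat_cscale (\<tau> gchoose k) A"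
      for k and A :: "complex^'m^'m"
      unfolding gbinomial_Suc_Suc by (simp add: vec_eq_iff algebra_simps)
    then show ?thesis by (simp add: sum.distrib add.assoc)
  qed
  also have "\<dots> = unipotent_power n X (\<tau> + 1)"
    unfolding unipotent_power_def by (subst sum.atMost_shift) simp
  finally show ?thesis .
qed

text \<open>For natural \<open>\<sigma>\<close> by induction; both sides are polynomial in
  \<open>\<sigma>\<close>.\<close>

lemma unipotent_power_add: "unipotent_power n X \<sigma> ** unipotent_power n X \<tau> = unipotent_power n X (\<sigma> + \<tau>)"
proof (rule poly_curve_eq[where M = "\<lambda>\<sigma>. unipotent_power n X \<sigma> ** unipotent_power n X \<tau>"
      and M' = "\<lambda>\<sigma>. unipotent_power n X (\<sigma> + \<tau>)" and X = "range of_nat"])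
  have pc: "poly_curve (unipotent_power n X)"
    unfolding unipotent_power_def[abs_def] by (rule poly_curve_gchoose)
  then show "poly_curve (\<lambda>\<sigma>. unipotent_power n X \<sigma> ** unipotent_power n X \<tau>)"
    by (rule poly_curve_mult_right)
  show "poly_curve (\<lambda>\<sigma>. unipotent_power n X (\<sigma> + \<tau>))"
    using poly_curve_compose[OF pc, of "[:\<tau>, 1:]"] by (simp add: add.commute)
  show "infinite (range (of_nat :: nat \<Rightarrow> complex))" by (rule infinite_of_nat)
  have "unipotent_power n X (of_nat j) ** unipotent_power n X \<tau> = unipotent_power n X (of_nat j + \<tau>)" for j
  proof (induction j)
    case (Suc j)
    have "unipotent_power n X (of_nat (Suc j)) = (mat 1 + X) ** unipotent_power n X (of_nat j)"
      unfolding unipotent_power_Suc by (simp add: add.commute)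
    then have "unipotent_power n X (of_nat (Suc j)) ** unipotent_power n X \<tau> =
        (mat 1 + X) ** unipotent_power n X (of_nat j + \<tau>)"
      using Suc by (simp flip: matrix_mul_assoc)
    then show ?case unfolding unipotent_power_Suc by (simp add: ac_simps)
  qed (simp add: unipotent_power_zero)
  then show "\<And>s. s \<in> range of_nat \<Longrightarrow> unipotent_power n X s ** unipotent_power n X \<tau> = unipotent_power n X (s + \<tau>)"
    by blast
qed

end

lemma splits_mult_zero:
  assumes gr: "grading n \<rho>" and sp: "splits \<pi> F" "splits \<rho> F" and "a < b"
  shows "\<pi> a ** \<rho> b = 0"
proof -
  have "\<rho> b *v v \<in> F b" for v
    using sp(2) by (auto simp: splits_def grading_vec[OF gr])
  then have "\<pi> a *v (\<rho> b *v v) = 0" for v using sp(1) \<open>a < b\<close> by (simp add: splits_def)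
  then show ?thesis by (simp add: matrix_eq flip: matrix_vector_mul_assoc)
qed

text \<open>Both gradings project onto the same quotients F^a / F^(a+1). Concretely, the sum of all
  \<open>\<rho> b\<close> is inserted into \<open>\<pi> a ** \<pi> a\<close>: terms with b > a die
  on the left, those with b < a on the right.\<close>

lemma splits_mult_self:
  assumes gr: "grading n \<pi>" "grading n \<rho>" and sp: "splits \<pi> F" "splits \<rho> F"
  shows "\<pi> a ** \<rho> a ** \<pi> a = \<pi> a"
proof (cases "a \<in> {0..int n}")
  case True
  have "\<pi> a = \<pi> a ** mat 1 ** \<pi> a" by (simp add: grading_mult[OF gr(1)])
  also have "\<dots> = (\<Sum>b\<in>{0..int n}. \<pi> a ** \<rho> b ** \<pi> a)"
    by (simp flip: grading_sum[OF gr(2)] add: matrix_mul_sum_left matrix_mul_sum_right)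
  also have "\<dots> = (\<Sum>b\<in>{0..int n}. if b = a then \<pi> a ** \<rho> a ** \<pi> a else 0)"
  proof (intro sum.cong refl)
    fix b
    consider "b = a" | "a < b" | "b < a" by linarith
    then show "\<pi> a ** \<rho> b ** \<pi> a = (if b = a then \<pi> a ** \<rho> a ** \<pi> a else 0)"
    proof cases
      case 3
      then have "\<rho> b ** \<pi> a = 0" using splits_mult_zero[OF gr(1) sp(2,1)] by blast
      then show ?thesis using 3 by (simp flip: matrix_mul_assoc)
    qed (simp_all add: splits_mult_zero[OF gr(2) sp])
  qed
  also have "\<dots> = \<pi> a ** \<rho> a ** \<pi> a" using True by simp
  finally show ?thesis by simp
qed (simp add: grading_outside[OF gr(1)])

lemma grading_cnj: "grading n \<pi> \<Longrightarrow> grading n (\<lambda>a. cnj_mat (\<pi> a))"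
  unfolding grading_def by (simp flip: cnj_mat_mult cnj_mat_sum)

lemma cochar_cnj: "cochar n (\<lambda>a. cnj_mat (\<pi> a)) t = cnj_mat (cochar n \<pi> (cnj t))"
  by (simp add: cochar_def cnj_mat_sum cnj_mat_cscale complex_cnj_power_int)

lemma splits_cnj:
  assumes "splits \<pi> F" "\<And>p. cnj_vec ` F p = F p"
  shows "splits (\<lambda>a. cnj_mat (\<pi> a)) F"
  unfolding splits_def
proof
  fix p
  have "v \<in> F p \<longleftrightarrow> (\<forall>a<p. cnj_mat (\<pi> a) *v v = 0)" for v
  proof -
    have "v \<in> F p \<longleftrightarrow> cnj_vec v \<in> F p" using assms(2) cnj_vec_image_iff by metis
    also have "\<dots> \<longleftrightarrow> (\<forall>a<p. \<pi> a *v cnj_vec v = 0)" using assms(1) by (simp add: splits_def)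
    also have "\<dots> \<longleftrightarrow> (\<forall>a<p. cnj_mat (\<pi> a) *v v = 0)"
      by (metis cnj_vec_0 cnj_vec_cnj_vec cnj_vec_mul)
    finally show ?thesis .
  qed
  then show "F p = {v. \<forall>a<p. cnj_mat (\<pi> a) *v v = 0}" by blast
qed

lemma grading_conjugate:
  fixes b b' :: "complex^'m^'m"
  assumes gr: "grading n \<pi>" and b: "b' ** b = mat 1" "b ** b' = mat 1"
  shows "grading n (\<lambda>a. b ** \<pi> a ** b')" and "cochar n (\<lambda>a. b ** \<pi> a ** b') t = b ** cochar n \<pi> t ** b'"
proof -
  have "b ** \<pi> c ** b' ** (b ** \<pi> d ** b') = b ** (\<pi> c ** (b' ** b) ** \<pi> d) ** b'" for c d
    by (simp only: matrix_mul_assoc)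
  then have "b ** \<pi> c ** b' ** (b ** \<pi> d ** b') = b ** (\<pi> c ** \<pi> d) ** b'" for c d
    by (simp add: b(1))
  moreover have "(\<Sum>a\<in>{0..int n}. b ** \<pi> a ** b') = mat 1"
    using grading_sum[OF gr] b(2) by (simp flip: matrix_mul_sum_left matrix_mul_sum_right)
  ultimately show "grading n (\<lambda>a. b ** \<pi> a ** b')"
    using grading_outside[OF gr] by (simp add: grading_def grading_mult[OF gr])
  show "cochar n (\<lambda>a. b ** \<pi> a ** b') t = b ** cochar n \<pi> t ** b'"
    by (simp add: cochar_def matrix_mul_sum_left matrix_mul_sum_right mat_cscale_mult_left mat_cscale_mult_right)
qed

text \<open>
  Two gradings that split the same filtration are conjugate by a unipotent element \<open>u\<close> of \<open>G\<close>. For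
  the conjugates \<open>\<pi>\<close> and \<open>\<rho>\<close> this gives \<open>cnj u = u\<^sup>-\<^sup>1\<close>, so conjugating \<open>\<pi>\<close> by the square root of \<open>u\<close>
  yields a real grading.
\<close>

lemma (in rat_group) real_grading_exists:
  assumes gr: "grading n \<pi>" and sp: "splits \<pi> F" and circ: "\<And>z. norm z = 1 \<Longrightarrow> cochar n \<pi> z \<in> G"
    and real: "\<And>p. cnj_vec ` F p = F p"
  shows "\<exists>\<rho>. grading n \<rho> \<and> splits \<rho> F \<and> (\<forall>z. norm z = 1 \<longrightarrow> cochar n \<rho> z \<in> G) \<and> (\<forall>a. cnj_mat (\<rho> a) = \<rho> a)"
proof -
  define \<rho> where "\<rho> a = cnj_mat (\<pi> a)" for a
  have gr': "grading n \<rho>" unfolding \<rho>_def by (rule grading_cnj[OF gr])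
  have sp': "splits \<rho> F" unfolding \<rho>_def by (rule splits_cnj[OF sp real])
  have circ': "cochar n \<rho> z \<in> G" if "norm z = 1" for z
    unfolding \<rho>_def cochar_cnj by (rule cnj[OF circ]) (simp add: that)
  let ?I = "{0..int n}"
  \<comment> \<open>\<open>u\<close> carries each piece of \<open>\<pi>\<close> to the piece of
    \<open>\<rho>\<close> of the same index, and \<open>v\<close> carries it back. They are
    conjugate because \<open>\<rho>\<close> is the conjugate of \<open>\<pi>\<close>.\<close>
  define u where "u = (\<Sum>a\<in>?I. \<rho> a ** \<pi> a)"
  define v where "v = (\<Sum>a\<in>?I. \<pi> a ** \<rho> a)"
  have cnj_u: "cnj_mat u = v" by (simp add: u_def v_def cnj_mat_sum cnj_mat_mult \<rho>_def)
  have u\<pi>: "u ** \<pi> a = \<rho> a ** \<pi> a" and \<rho>u: "\<rho> a ** u = \<rho> a ** \<pi> a" if "a \<in> ?I" for a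
  proof -
    have "u ** \<pi> a = (\<Sum>b\<in>?I. if b = a then \<rho> a ** \<pi> a else 0)"
      unfolding u_def matrix_mul_sum_left by (intro sum.cong) (simp_all add: grading_mult_assoc[OF gr])
    then show "u ** \<pi> a = \<rho> a ** \<pi> a" using that by simp
    have "\<rho> a ** u = (\<Sum>b\<in>?I. if b = a then \<rho> a ** \<pi> a else 0)"
      unfolding u_def matrix_mul_sum_right
      by (intro sum.cong) (simp_all add: matrix_mul_assoc grading_mult[OF gr'])
    then show "\<rho> a ** u = \<rho> a ** \<pi> a" using that by simp
  qed
  have vu: "v ** u = mat 1"
  proof -
    have "v ** u = (\<Sum>a\<in>?I. \<pi> a ** (\<rho> a ** u))" by (simp add: v_def matrix_mul_sum_left matrix_mul_assoc)
    also have "\<dots> = (\<Sum>a\<in>?I. \<pi> a)"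
      by (intro sum.cong refl) (simp add: \<rho>u matrix_mul_assoc splits_mult_self[OF gr gr' sp sp'])
    finally show ?thesis by (simp add: grading_sum[OF gr])
  qed
  then have uv: "u ** v = mat 1" using matrix_left_right_inverse by blast
  \<comment> \<open>For \<open>s \<noteq> 0\<close>, \<open>M s\<close> is the product of the
    cocharacter of \<open>\<rho>\<close> at \<open>s\<close> and that of \<open>\<pi>\<close> at
    \<open>inverse s\<close>. As \<open>\<rho> a ** \<pi> b = 0\<close> for a < b, only the
    exponents 2(a - b) \<ge> 0 occur, so the curve extends to \<open>s = 0\<close>, where it takes
    the value \<open>u\<close>.\<close>
  have uG: "u \<in> G"
  proof -
    define T where "T = (SIGMA a:?I. {0..a})"
    define M where "M s = (\<Sum>x\<in>T. mat_cscale (poly (monom 1 (nat (2 * fst x - 2 * snd x))) s) (\<rho> (fst x) ** \<pi> (snd x)))" for s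
    have "M 0 = (\<Sum>(a, b)\<in>T. if a = b then \<rho> a ** \<pi> a else 0)"
      unfolding M_def by (intro sum.cong) (auto simp: T_def poly_monom vec_eq_iff)
    also have "\<dots> = (\<Sum>a\<in>?I. \<Sum>b\<in>{0..a}. if a = b then \<rho> a ** \<pi> a else 0)"
      unfolding T_def by (rule sum.Sigma[symmetric]) auto
    also have "\<dots> = u" unfolding u_def by (intro sum.cong) auto
    finally have M0: "M 0 = u" .
    have MG: "M s \<in> G" if "s \<noteq> 0" for s
    proof -
      have "cochar n \<rho> s ** cochar n \<pi> (inverse s) =
          (\<Sum>a\<in>?I. \<Sum>b\<in>?I. mat_cscale (s powi weight n a * inverse s powi weight n b) (\<rho> a ** \<pi> b))"
        unfolding cochar_def matrix_mul_sum_left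
        unfolding matrix_mul_sum_right mat_cscale_mult_left mat_cscale_mult_right mat_cscale_mat_cscale
        by (simp add: mult.commute)
      also have "\<dots> = (\<Sum>a\<in>?I. \<Sum>b\<in>{0..a}. mat_cscale (s ^ nat (2 * a - 2 * b)) (\<rho> a ** \<pi> b))"
      proof (rule sum.cong[OF refl])
        fix a assume a: "a \<in> ?I"
        have "(\<Sum>b\<in>?I. mat_cscale (s powi weight n a * inverse s powi weight n b) (\<rho> a ** \<pi> b)) =
            (\<Sum>b\<in>{0..a}. mat_cscale (s powi weight n a * inverse s powi weight n b) (\<rho> a ** \<pi> b))"
          using a by (intro sum.mono_neutral_right) (auto simp: splits_mult_zero[OF gr sp' sp])
        also have "\<dots> = (\<Sum>b\<in>{0..a}. mat_cscale (s ^ nat (2 * a - 2 * b)) (\<rho> a ** \<pi> b))"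
        proof (rule sum.cong[OF refl])
          fix b assume b: "b \<in> {0..a}"
          have "s powi weight n a * inverse s powi weight n b = s powi (weight n a - weight n b)"
            using that by (simp add: power_int_diff power_int_inverse divide_inverse)
          also have "weight n a - weight n b = int (nat (2 * a - 2 * b))" using b by (simp add: weight_def)
          finally show "mat_cscale (s powi weight n a * inverse s powi weight n b) (\<rho> a ** \<pi> b) =
              mat_cscale (s ^ nat (2 * a - 2 * b)) (\<rho> a ** \<pi> b)" by (simp only: power_int_of_nat)
        qed
        finally show "(\<Sum>b\<in>?I. mat_cscale (s powi weight n a * inverse s powi weight n b) (\<rho> a ** \<pi> b)) =
            (\<Sum>b\<in>{0..a}. mat_cscale (s ^ nat (2 * a - 2 * b)) (\<rho> a ** \<pi> b))" .
      qed
      also have "\<dots> = M s" unfolding M_def T_def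
        by (subst sum.Sigma) (auto simp: poly_monom case_prod_beta)
      finally show ?thesis
        using mult[OF cochar_in_group[OF gr' circ'] cochar_in_group[OF gr circ]] that by (metis inverse_nonzero_iff_nonzero)
    qed
    have pc: "poly_curve M" unfolding M_def[abs_def] by (rule poly_curve_sum)
    have "M 0 \<in> G"
    proof (rule curve_in_group[OF pc infinite_nonzero])
      show "invertible (M 0)" unfolding M0 invertible_def using uv vu by metis
    qed (use MG in simp)
    then show ?thesis by (simp add: M0)
  qed
  define X where "X = u - mat 1"
  have uX: "u = mat 1 + X" by (simp add: X_def)
  have matrix_sub: "A ** (B - C) = A ** B - A ** C" "(B - C) ** A = B ** A - C ** A" for A B C :: "complex^'m^'m"
    by (simp_all add: vec_eq_iff matrix_matrix_mult_def algebra_simps sum_subtractf)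
  \<comment> \<open>So \<open>X\<close> raises the index by at least one: its power
    \<open>Suc n\<close> is zero, and all powers of \<open>u\<close> preserve
    \<open>F\<close>.\<close>
  have X1: "\<pi> a ** X ** \<pi> b = 0" if "a \<le> b" for a b
  proof (cases "b \<in> ?I")
    case True
    have "\<pi> a ** X ** \<pi> b = \<pi> a ** \<rho> b ** \<pi> b - \<pi> a ** \<pi> b"
      by (simp add: X_def matrix_sub u\<pi>[OF True] flip: matrix_mul_assoc)
    also have "\<dots> = 0"
    proof (cases "a = b")
      case True
      then show ?thesis by (simp add: splits_mult_self[OF gr gr' sp sp'] grading_mult[OF gr])
    next
      case False
      then show ?thesis using that by (simp add: splits_mult_zero[OF gr' sp sp'] splits_mult_zero[OF gr sp sp])
    qed
    finally show ?thesis .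
  qed (simp add: grading_outside[OF gr])
  have Xk: "\<pi> a ** mat_pow X k ** \<pi> b = 0" if "a < b + int k" for a b k
    using that
  proof (induction k arbitrary: a b)
    case 0
    then show ?case by (simp add: grading_mult[OF gr])
  next
    case (Suc k)
    have "\<pi> a ** mat_pow X (Suc k) ** \<pi> b = (\<Sum>c\<in>?I. (\<pi> a ** X ** \<pi> c) ** (\<pi> c ** mat_pow X k ** \<pi> b))"
    proof -
      have "\<pi> a ** mat_pow X (Suc k) ** \<pi> b = \<pi> a ** X ** (mat_pow X k ** \<pi> b)"
        by (simp add: matrix_mul_assoc)
      also have "\<dots> = \<pi> a ** X ** (\<Sum>c\<in>?I. \<pi> c ** (mat_pow X k ** \<pi> b))"
        by (subst grading_expand_left[OF gr, of "mat_pow X k ** \<pi> b"]) simp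
      also have "\<dots> = (\<Sum>c\<in>?I. (\<pi> a ** X ** (\<pi> c ** \<pi> c)) ** (mat_pow X k ** \<pi> b))"
        by (simp add: matrix_mul_sum_right matrix_mul_assoc grading_mult_assoc[OF gr])
      finally show ?thesis by (simp add: matrix_mul_assoc)
    qed
    also have "\<dots> = 0"
    proof (intro sum.neutral ballI)
      fix c
      show "(\<pi> a ** X ** \<pi> c) ** (\<pi> c ** mat_pow X k ** \<pi> b) = 0"
      proof (cases "a \<le> c")
        case False
        then have "c < b + int k" using Suc.prems by simp
        then show ?thesis by (simp add: Suc.IH)
      qed (simp add: X1)
    qed
    finally show ?case .
  qed
  have nil: "mat_pow X (Suc n) = 0"
  proof -
    have "mat_pow X (Suc n) = (\<Sum>a\<in>?I. \<Sum>b\<in>?I. \<pi> a ** mat_pow X (Suc n) ** \<pi> b)"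
      by (simp add: grading_sum[OF gr] flip: matrix_mul_sum_left matrix_mul_sum_right)
    also have "\<dots> = 0" by (intro sum.neutral ballI Xk) auto
    finally show ?thesis .
  qed
  let ?U = "unipotent_power n X"
  have U_add: "?U \<sigma> ** ?U \<tau> = ?U (\<sigma> + \<tau>)" for \<sigma> \<tau> by (rule unipotent_power_add[OF nil])
  have U0: "?U 0 = mat 1" by (rule unipotent_power_zero)
  have U1: "u ** ?U \<tau> = ?U (\<tau> + 1)" for \<tau> unfolding uX by (rule unipotent_power_Suc[OF nil])
  have Uu: "?U 1 = u" using U1[of 0] U0 by simp
  have Uv: "?U (-1) = v"
  proof -
    have "v ** (u ** ?U (-1)) = v" by (simp add: U1 U0)
    then show ?thesis by (simp add: matrix_mul_assoc vu)
  qed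
  have pcU: "poly_curve ?U" unfolding unipotent_power_def[abs_def] by (rule poly_curve_gchoose)
  have UG: "?U \<tau> \<in> G" for \<tau>
  proof (rule curve_in_group[OF pcU infinite_of_nat])
    have "?U (of_nat j) \<in> G" for j
    proof (induction j)
      case (Suc j)
      have "?U (of_nat (Suc j)) = u ** ?U (of_nat j)" unfolding U1 by (simp add: add.commute)
      then show ?case using mult[OF uG Suc] by simp
    qed (simp add: U0 one)
    then show "\<And>s. s \<in> range of_nat \<Longrightarrow> ?U s \<in> G" by blast
    show "invertible (?U \<tau>)"
      unfolding invertible_right_inverse by (rule exI[of _ "?U (- \<tau>)"]) (simp add: U_add U0)
  qed
  \<comment> \<open>Conjugates \<open>X\<close> but not the parameter. It is thus polynomial in
    \<open>\<tau>\<close>, unlike the conjugate of \<open>?U \<tau>\<close>, and agrees with that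
    conjugate at real \<open>\<tau>\<close>.\<close>
  define V where "V \<tau> = (\<Sum>k\<le>n. mat_cscale (\<tau> gchoose k) (cnj_mat (mat_pow X k)))" for \<tau>
  have cnj_choose: "cnj (\<tau> gchoose k) = cnj \<tau> gchoose k" for \<tau> k by (simp add: gbinomial_prod_rev)
  have cnj_U: "cnj_mat (?U \<tau>) = V (cnj \<tau>)" for \<tau>
    by (simp add: unipotent_power_def V_def cnj_mat_sum cnj_mat_cscale cnj_choose)
  have "V (1/2) = ?U (- (1/2))"
  proof (rule poly_curve_eq[OF _ _ infinite_of_nat, where M = V and M' = "\<lambda>\<tau>. ?U (- \<tau>)"])
    show "poly_curve V" unfolding V_def[abs_def] by (rule poly_curve_gchoose)
    show "poly_curve (\<lambda>\<tau>. ?U (- \<tau>))" using poly_curve_compose[OF pcU, of "[:0, -1:]"] by simp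
    have "V (of_nat j) = ?U (- of_nat j)" for j
    proof (induction j)
      case 0
      have "V 0 = mat 1" using cnj_U[of 0] U0 by simp
      then show ?case by (simp add: U0)
    next
      case (Suc j)
      have "V (of_nat (Suc j)) = cnj_mat (u ** ?U (of_nat j))" by (simp add: U1 cnj_U add.commute)
      also have "\<dots> = v ** V (of_nat j)" by (simp add: cnj_mat_mult cnj_u cnj_U)
      also have "\<dots> = ?U (-1 + (- of_nat j))" unfolding Suc by (simp only: U_add flip: Uv)
      finally show ?case by simp
    qed
    then show "\<And>s. s \<in> range of_nat \<Longrightarrow> V s = ?U (- s)" by blast
  qed
  define b where "b = ?U (1/2)"
  define b' where "b' = ?U (- (1/2))"
  have cnj_b: "cnj_mat b = b'" "cnj_mat b' = b"
  proof -
    show "cnj_mat b = b'" using cnj_U[of "1/2"] \<open>V (1/2) = ?U (- (1/2))\<close> by (simp add: b_def b'_def)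
    then show "cnj_mat b' = b" by (metis cnj_mat_cnj_mat)
  qed
  have bb': "b ** b' = mat 1" "b' ** b = mat 1" by (simp_all add: b_def b'_def U_add U0)
  define \<theta> where "\<theta> a = b ** \<pi> a ** b'" for a
  have "grading n \<theta>" unfolding \<theta>_def by (rule grading_conjugate[OF gr bb'(2,1)])
  moreover have "cochar n \<theta> z \<in> G" if "norm z = 1" for z
    unfolding \<theta>_def grading_conjugate(2)[OF gr bb'(2,1)]
    using mult[OF mult[OF UG circ[OF that]] UG] by (simp add: b_def b'_def)
  moreover have "cnj_mat (\<theta> a) = \<theta> a" for a
  proof (cases "a \<in> ?I")
    case True
    have "\<rho> a = u ** \<pi> a ** v"
    proof -
      have "\<rho> a = \<rho> a ** (u ** v)" by (simp add: uv)
      also have "\<dots> = u ** \<pi> a ** v" by (simp add: matrix_mul_assoc \<rho>u[OF True] u\<pi>[OF True])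
      finally show ?thesis .
    qed
    \<comment> \<open>With b = u^(1/2) and conj b = u^(-1/2), conjugating \<open>\<theta> a\<close>
      gives u^(-1/2) u \<open>\<pi> a\<close> u^(-1) u^(1/2), which is \<open>\<theta> a\<close>
      again.\<close>
    then have "cnj_mat (\<theta> a) = (b' ** u) ** \<pi> a ** (v ** b)"
      by (simp add: \<theta>_def cnj_mat_mult cnj_b matrix_mul_assoc flip: \<rho>_def)
    moreover have "b' ** u = b" by (simp add: b_def b'_def U_add flip: Uu)
    moreover have "v ** b = b'" by (simp add: b_def b'_def U_add flip: Uv)
    ultimately show ?thesis by (simp add: \<theta>_def)
  qed (simp add: \<theta>_def grading_outside[OF gr])
  moreover have "splits \<theta> F"
  proof -
    have UF: "?U \<tau> *v w \<in> F p" if w: "w \<in> F p" for \<tau> w p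
    proof -
      have "\<pi> a *v (mat_pow X k *v w) = 0" if "a < p" for a k
      proof -
        have "\<pi> a *v (mat_pow X k *v w) = (\<Sum>c\<in>?I. \<pi> a *v (mat_pow X k *v (\<pi> c *v w)))"
          by (subst grading_expand_vec[OF gr, of w]) (simp add: vec.sum)
        also have "\<dots> = 0"
        proof (intro sum.neutral ballI)
          fix c
          show "\<pi> a *v (mat_pow X k *v (\<pi> c *v w)) = 0"
          proof (cases "c < p")
            case True
            then show ?thesis using w sp by (simp add: splits_def)
          next
            case False
            then show ?thesis using Xk[of a c k] that by (simp add: matrix_vector_mul_assoc matrix_mul_assoc)
          qed
        qed
        finally show ?thesis .
      qed
      then show ?thesis using sp
        by (simp add: splits_def unipotent_power_def sum_mul_vec mat_cscale_mul_vec vec.sum vec.scale)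
    qed
    have "(\<forall>a<p. \<theta> a *v w = 0) \<longleftrightarrow> w \<in> F p" for p w
    proof -
      have "\<theta> a *v w = 0 \<longleftrightarrow> \<pi> a *v (b' *v w) = 0" for a
      proof
        assume "\<theta> a *v w = 0"
        then have "b' *v (\<theta> a *v w) = 0" by simp
        then show "\<pi> a *v (b' *v w) = 0" by (simp add: \<theta>_def matrix_vector_mul_assoc matrix_mul_assoc bb')
      qed (simp add: \<theta>_def flip: matrix_vector_mul_assoc)
      then have "(\<forall>a<p. \<theta> a *v w = 0) \<longleftrightarrow> b' *v w \<in> F p" using sp by (simp add: splits_def)
      also have "\<dots> \<longleftrightarrow> w \<in> F p"
      proof
        assume "b' *v w \<in> F p"
        then have "b *v (b' *v w) \<in> F p" using UF by (simp add: b_def)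
        then show "w \<in> F p" by (simp add: matrix_vector_mul_assoc bb')
      qed (simp add: UF b'_def)
      finally show ?thesis .
    qed
    then show ?thesis by (simp add: splits_def)
  qed
  ultimately show ?thesis by blast
qed

section \<open>The real form\<close>

lemma matrix_inv_mult:
  fixes A :: "complex^'m^'m"
  assumes "invertible A" shows "A ** matrix_inv A = mat 1" "matrix_inv A ** A = mat 1"
  using someI_ex[OF assms[unfolded invertible_def]] unfolding matrix_inv_def by blast+

lemma real_form_in: "A \<in> real_form G \<Longrightarrow> complexify_matrix A \<in> G"
  unfolding real_form_def using connected_component_in by blast

lemma continuous_on_matrix_mult_left: "continuous_on S (\<lambda>B. A ** B)" for A :: "real^'m^'m"
  unfolding matrix_matrix_mult_def by (intro continuous_on_vec_lambda continuous_intros)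

lemma one_in_real_form: "mat 1 \<in> G \<Longrightarrow> mat 1 \<in> real_form G"
  by (simp add: real_form_def connected_component_refl)

context
  fixes G :: "(complex^'m^'m) set"
  assumes mult: "\<And>A B. A \<in> G \<Longrightarrow> B \<in> G \<Longrightarrow> A ** B \<in> G"
begin

lemma connected_component_translate:
  assumes "connected_component {A. complexify_matrix A \<in> G} X Y" and "complexify_matrix A \<in> G"
  shows "connected_component {A. complexify_matrix A \<in> G} (A ** X) (A ** Y)"
proof -
  obtain T where T: "connected T" "T \<subseteq> {A. complexify_matrix A \<in> G}" "X \<in> T" "Y \<in> T"
    using assms(1) unfolding connected_component_def by blast
  have "connected ((\<lambda>B. A ** B) ` T)"
    using T(1) by (rule connected_continuous_image[OF continuous_on_matrix_mult_left])
  moreover have "(\<lambda>B. A ** B) ` T \<subseteq> {A. complexify_matrix A \<in> G}"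
    using T(2) mult assms(2) by (auto simp: complexify_mult)
  ultimately show ?thesis unfolding connected_component_def using T(3,4) by blast
qed

lemma real_form_mult:
  assumes "A \<in> real_form G" "B \<in> real_form G"
  shows "A ** B \<in> real_form G"
proof -
  have "connected_component {A. complexify_matrix A \<in> G} (mat 1) A"
    using assms(1) by (simp add: real_form_def)
  moreover have "connected_component {A. complexify_matrix A \<in> G} (A ** mat 1) (A ** B)"
    using assms real_form_in by (intro connected_component_translate) (auto simp: real_form_def)
  ultimately show ?thesis unfolding real_form_def by (auto intro: connected_component_trans)
qed

text \<open>The inverse of the complexified matrix equals its own conjugate, hence is real. Left
  translation by it moves a connected set joining 1 to \<open>A\<close> onto one joining the inverse
  to 1.\<close>

lemma real_form_inverse:
  assumes "A \<in> real_form G"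
    and inv: "\<And>A. A \<in> G \<Longrightarrow> matrix_inv A \<in> G" and invertible: "\<And>A. A \<in> G \<Longrightarrow> invertible A"
  shows "\<exists>B\<in>real_form G. A ** B = mat 1 \<and> B ** A = mat 1"
proof -
  have AG: "complexify_matrix A \<in> G" using assms(1) by (rule real_form_in)
  let ?M = "matrix_inv (complexify_matrix A)"
  have M: "complexify_matrix A ** ?M = mat 1" "?M ** complexify_matrix A = mat 1"
    by (rule matrix_inv_mult[OF invertible[OF AG]])+
  have "cnj_mat ?M = ?M"
  proof -
    have "cnj_mat ?M ** complexify_matrix A = cnj_mat (?M ** complexify_matrix A)"
      unfolding cnj_mat_mult using cnj_mat_fixed_iff by metis
    then have "cnj_mat ?M ** complexify_matrix A ** ?M = ?M" using M by simp
    then show ?thesis by (simp add: M flip: matrix_mul_assoc)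
  qed
  then obtain B where B: "?M = complexify_matrix B" using cnj_mat_fixed_iff by blast
  have inj: "X = Y" if "complexify_matrix X = complexify_matrix Y" for X Y :: "real^'m^'m"
    using that by (simp add: vec_eq_iff)
  have AB: "A ** B = mat 1" "B ** A = mat 1"
    using M by (auto intro!: inj simp: complexify_mult B)
  have "connected_component {A. complexify_matrix A \<in> G} (B ** mat 1) (B ** A)"
    using assms(1) inv[OF AG] by (intro connected_component_translate) (auto simp: real_form_def B)
  then have "B \<in> real_form G" using AB by (simp add: real_form_def connected_component_sym)
  then show ?thesis using AB by blast
qed

end

text \<open>Conjugation by \<open>cochar\<close> contracts \<open>u\<close> to \<open>1\<close> within \<open>G\<close>.\<close>

lemma (in rat_group) lower_unipotent_in_real_form:
  assumes gr: "grading n \<pi>" and circ: "\<And>z. norm z = 1 \<Longrightarrow> cochar n \<pi> z \<in> G"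
    and real: "\<And>a. cnj_mat (\<pi> a) = \<pi> a"
    and u: "lower_unipotent \<pi> u" "u \<in> G" "u = complexify_matrix v"
  shows "v \<in> real_form G"
proof -
  let ?I = "{0..int n}"
  define T where "T = (SIGMA a:?I. {a..int n})"
  \<comment> \<open>Equals \<open>cochar n \<pi> (inverse s) ** u ** cochar n \<pi> s\<close> for
    \<open>s \<noteq> 0\<close>. The block (a,b) of \<open>u\<close> is scaled by s^(2(b-a)) and
    vanishes for b < a, so the curve runs from the identity at 0 to \<open>u\<close> at 1.\<close>
  define M where "M s = (\<Sum>x\<in>T. mat_cscale (s ^ nat (2 * snd x - 2 * fst x)) (\<pi> (fst x) ** u ** \<pi> (snd x)))" for s
  have lo: "(\<Sum>a\<in>?I. \<Sum>b\<in>?I. f a b) = (\<Sum>x\<in>T. f (fst x) (snd x))"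
    if "\<And>a b. a \<in> ?I \<Longrightarrow> b < a \<Longrightarrow> f a b = 0" for f :: "int \<Rightarrow> int \<Rightarrow> complex^'m^'m"
  proof -
    have "(\<Sum>a\<in>?I. \<Sum>b\<in>?I. f a b) = (\<Sum>a\<in>?I. \<Sum>b\<in>{a..int n}. f a b)"
      using that by (intro sum.cong refl sum.mono_neutral_right) auto
    then show ?thesis unfolding T_def by (subst (asm) sum.Sigma) (auto simp: case_prod_beta)
  qed
  have u0: "\<pi> a ** u ** \<pi> b = 0" if "b < a" for a b using u(1) that by (simp add: lower_unipotent_def)
  have "M 0 = (\<Sum>x\<in>T. if fst x = snd x then \<pi> (fst x) else 0)"
    unfolding M_def using u(1) by (intro sum.cong) (auto simp: T_def lower_unipotent_def vec_eq_iff)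
  also have "\<dots> = (\<Sum>a\<in>?I. \<Sum>b\<in>?I. if a = b then \<pi> a else 0)"
    by (rule lo[symmetric]) auto
  also have "\<dots> = (\<Sum>a\<in>?I. \<pi> a)" by (intro sum.cong) auto
  finally have M0: "M 0 = mat 1" by (simp add: grading_sum[OF gr])
  have M1: "M 1 = u"
  proof -
    have "u = (\<Sum>a\<in>?I. \<Sum>b\<in>?I. \<pi> a ** u ** \<pi> b)"
      by (simp add: grading_sum[OF gr] flip: matrix_mul_sum_left matrix_mul_sum_right)
    also have "\<dots> = M 1" unfolding M_def by (subst lo) (simp_all add: u0)
    finally show ?thesis by simp
  qed
  have MG: "M s \<in> G" for s
  proof (cases "s = 0")
    case True
    then show ?thesis using M0 one by simp
  next
    case False
    have "cochar n \<pi> (inverse s) ** u ** cochar n \<pi> s =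
        (\<Sum>a\<in>?I. \<Sum>b\<in>?I. mat_cscale (inverse s powi weight n a * s powi weight n b) (\<pi> a ** u ** \<pi> b))"
      unfolding cochar_def matrix_mul_sum_left
      unfolding matrix_mul_sum_right mat_cscale_mult_left mat_cscale_mult_right mat_cscale_mat_cscale
      by (simp add: mult.commute)
    also have "\<dots> = (\<Sum>x\<in>T. mat_cscale (inverse s powi weight n (fst x) * s powi weight n (snd x)) (\<pi> (fst x) ** u ** \<pi> (snd x)))"
      by (rule lo) (simp add: u0)
    also have "\<dots> = M s"
      unfolding M_def
    proof (rule sum.cong[OF refl])
      fix x assume x: "x \<in> T"
      have "inverse s powi weight n (fst x) * s powi weight n (snd x) = s powi (weight n (snd x) - weight n (fst x))"
        using False by (simp add: power_int_diff power_int_inverse divide_inverse)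
      also have "weight n (snd x) - weight n (fst x) = int (nat (2 * snd x - 2 * fst x))"
        using x by (auto simp: weight_def T_def)
      finally show "mat_cscale (inverse s powi weight n (fst x) * s powi weight n (snd x)) (\<pi> (fst x) ** u ** \<pi> (snd x)) =
          mat_cscale (s ^ nat (2 * snd x - 2 * fst x)) (\<pi> (fst x) ** u ** \<pi> (snd x))"
        by (simp only: power_int_of_nat)
    qed
    finally show ?thesis
      using mult[OF mult[OF cochar_in_group[OF gr circ] u(2)] cochar_in_group[OF gr circ]] False
      by (metis inverse_nonzero_iff_nonzero)
  qed
  define B where "B s = map_matrix Re (M (complex_of_real s))" for s
  have cu: "cnj_mat u = u" using u(3) cnj_mat_fixed_iff by blast
  have "cnj_mat (M (of_real s)) = M (of_real s)" for s
    by (simp add: M_def cnj_mat_sum cnj_mat_cscale cnj_mat_mult real cu)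
  then have B: "complexify_matrix (B s) = M (of_real s)" for s
    unfolding B_def by (simp add: vec_eq_iff) (metis Reals_cnj_iff complex_is_Real_iff of_real_Re)
  have inj: "X = Y" if "complexify_matrix X = complexify_matrix Y" for X Y :: "real^'m^'m"
    using that by (simp add: vec_eq_iff)
  have "continuous_on {0..1} B"
    unfolding B_def[abs_def] M_def map_matrix_def
    by (intro continuous_on_vec_lambda) (simp, intro continuous_intros)
  then have "connected (B ` {0..1})" by (rule connected_continuous_image) simp
  moreover have "B ` {0..1} \<subseteq> {A. complexify_matrix A \<in> G}" using B MG by auto
  moreover have "B 0 = mat 1" "B 1 = v" using B[of 0] B[of 1] M0 M1 u(3) by (auto intro!: inj)
  moreover have "B 0 \<in> B ` {0..1}" "B 1 \<in> B ` {0..1}" by auto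
  ultimately show ?thesis unfolding real_form_def connected_component_def by auto
qed

section \<open>Real orbits near a real point\<close>

lemma act_act: "act A (act B F) = act (A ** B) F"
  by (simp add: act_def image_image matrix_vector_mul_assoc)

lemma act_one [simp]: "act (mat 1) F = F"
  by (simp add: act_def)

lemma act_mem_iff:
  assumes "invertible A"
  shows "A *v v \<in> act A F p \<longleftrightarrow> v \<in> F p"
  using inj_matrix_vector_mult[OF assms] by (auto simp: act_def inj_def)

lemma subspace_act: "vec.subspace (F p) \<Longrightarrow> vec.subspace (act A F p)"
  unfolding act_def by (rule vec.subspace_image)

lemma dim_act: "invertible A \<Longrightarrow> vec.dim (act A F p) = vec.dim (F p)"
  unfolding act_def using inj_matrix_vector_mult inj_on_subset
  by (intro vec.dim_image_eq matrix_vector_mul_linear_gen) blast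

lemma splits_subspace: "splits \<pi> F \<Longrightarrow> vec.subspace (F p)"
  by (simp add: splits_def vec.subspace_def matrix_vector_right_distrib vec.scale)

lemma subspace_opposite: "vec.subspace {v. \<forall>a\<ge>p. \<pi> a *v v = 0}" for \<pi> :: "int \<Rightarrow> complex^'m^'m"
  by (simp add: vec.subspace_def matrix_vector_right_distrib vec.scale)

lemma splits_act:
  assumes "splits \<pi> F" "b ** b' = mat 1" "b' ** b = mat 1"
  shows "splits (\<lambda>a. b ** \<pi> a ** b') (act b F)"
proof -
  have inv: "invertible b" using assms(2,3) unfolding invertible_def by blast
  have "v \<in> act b F p \<longleftrightarrow> (\<forall>a<p. (b ** \<pi> a ** b') *v v = 0)" for v p
  proof -
    have v: "v = b *v (b' *v v)" by (simp add: matrix_vector_mul_assoc assms(2))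
    have "v \<in> act b F p \<longleftrightarrow> (\<forall>a<p. \<pi> a *v (b' *v v) = 0)"
      using act_mem_iff[OF inv, of "b' *v v" F p] assms(1) v by (simp add: splits_def)
    also have "\<dots> \<longleftrightarrow> (\<forall>a<p. b *v (\<pi> a *v (b' *v v)) = 0)"
      using inj_matrix_vector_mult[OF inv] by (metis injD matrix_vector_mult_0_right)
    finally show ?thesis by (simp add: matrix_vector_mul_assoc matrix_mul_assoc)
  qed
  then show ?thesis by (auto simp: splits_def)
qed

text \<open>Let \<open>\<tau> p\<close> project onto \<open>F' p\<close> along the opposite space.
  It changes a vector of the piece \<open>p\<close> only by pieces of lower index, so the
  \<open>\<tau> p\<close> assemble to a lower unipotent \<open>u\<close>, real because all the
  spaces are, with u F = F'. Then u^(-1) g preserves \<open>F\<close>, hence is upper, and g = u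
  (u^(-1) g) is a factorization in the open cell.\<close>

lemma (in rat_group) transversal_real_orbit:
  assumes gr: "grading n \<pi>" and sp: "splits \<pi> F" and circ: "\<And>z. norm z = 1 \<Longrightarrow> cochar n \<pi> z \<in> G"
    and real: "\<And>a. cnj_mat (\<pi> a) = \<pi> a"
    and g: "g \<in> G" "F' = act g F" and real': "\<And>p. cnj_vec ` F' p = F' p"
    and int: "\<And>p. F' p \<inter> {v. \<forall>a\<ge>p. \<pi> a *v v = 0} = {0}"
    and sum: "\<And>p. {u + v |u v. u \<in> F' p \<and> v \<in> {v. \<forall>a\<ge>p. \<pi> a *v v = 0}} = UNIV"
  shows "\<exists>v\<in>real_form G. F' = act (complexify_matrix v) F"
proof -
  let ?I = "{0..int n}"
  define E where "E p = {v. \<forall>a\<ge>p. \<pi> a *v v = 0}" for p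
  have subE: "vec.subspace (E p)" for p unfolding E_def by (rule subspace_opposite)
  have subF': "vec.subspace (F' p)" for p unfolding g(2) by (rule subspace_act[OF splits_subspace[OF sp]])
  have "\<exists>T::complex^'m^'m. \<forall>v. T *v v \<in> F' p \<and> v - T *v v \<in> E p" for p
    using complement_projection[OF subF' subE] int sum by (simp add: E_def)
  then obtain \<tau> :: "int \<Rightarrow> complex^'m^'m" where
    \<tau>: "\<And>p v. \<tau> p *v v \<in> F' p" "\<And>p v. v - \<tau> p *v v \<in> E p" by metis
  define u where "u = (\<Sum>p\<in>?I. \<tau> p ** \<pi> p)"
  have u\<pi>: "u ** \<pi> b = \<tau> b ** \<pi> b" if "b \<in> ?I" for b
  proof -
    have "u ** \<pi> b = (\<Sum>p\<in>?I. if p = b then \<tau> b ** \<pi> b else 0)"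
      unfolding u_def matrix_mul_sum_left by (intro sum.cong) (simp_all add: grading_mult_assoc[OF gr])
    then show ?thesis using that by simp
  qed
  have \<pi>\<tau>: "\<pi> a ** \<tau> p = \<pi> a" if "a \<ge> p" for a p
  proof -
    have "\<pi> a *v (v - \<tau> p *v v) = 0" for v using \<tau>(2) that by (simp add: E_def)
    then show ?thesis by (simp add: matrix_eq matrix_vector_mult_diff_distrib flip: matrix_vector_mul_assoc)
  qed
  have lu: "lower_unipotent \<pi> u"
  proof -
    have "\<pi> a ** u ** \<pi> b = (if a = b then \<pi> a else 0)" if "a \<ge> b" for a b
    proof (cases "b \<in> ?I")
      case True
      have "\<pi> a ** u ** \<pi> b = \<pi> a ** \<tau> b ** \<pi> b" using u\<pi>[OF True] by (simp flip: matrix_mul_assoc)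
      then show ?thesis using that by (simp add: \<pi>\<tau> grading_mult[OF gr])
    qed (simp add: grading_outside[OF gr])
    then show ?thesis by (simp add: lower_unipotent_def)
  qed
  have real_\<tau>: "cnj_mat (\<tau> p) = \<tau> p" for p
  proof -
    have "cnj_mat (\<tau> p) *v v = \<tau> p *v v" for v
    proof -
      have eq: "cnj_mat (\<tau> p) *v v = cnj_vec (\<tau> p *v cnj_vec v)" by (simp add: cnj_vec_mul)
      have "cnj_mat (\<tau> p) *v v \<in> F' p" using \<tau>(1) real' unfolding eq by blast
      then have "cnj_mat (\<tau> p) *v v - \<tau> p *v v \<in> F' p" using \<tau>(1) subF' vec.subspace_diff by blast
      moreover have "v - cnj_mat (\<tau> p) *v v \<in> E p"
      proof -
        have "cnj_vec v - \<tau> p *v cnj_vec v \<in> E p" by (rule \<tau>(2))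
        then have "\<pi> a *v cnj_vec (cnj_vec v - \<tau> p *v cnj_vec v) = 0" if "a \<ge> p" for a
          using that cnj_vec_mul[of "\<pi> a" "cnj_vec v - \<tau> p *v cnj_vec v"] by (simp add: E_def real)
        then show ?thesis by (simp add: E_def eq cnj_vec_diff)
      qed
      then have "(v - \<tau> p *v v) - (v - cnj_mat (\<tau> p) *v v) \<in> E p" using \<tau>(2) subE vec.subspace_diff by blast
      ultimately have "cnj_mat (\<tau> p) *v v - \<tau> p *v v \<in> F' p \<inter> E p" by simp
      then show ?thesis using int by (simp add: E_def)
    qed
    then show ?thesis by (simp add: matrix_eq)
  qed
  then have "cnj_mat u = u" by (simp add: u_def cnj_mat_sum cnj_mat_mult real)
  then obtain v where v: "u = complexify_matrix v" using cnj_mat_fixed_iff by blast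
  obtain u' where u': "u ** u' = mat 1" "u' ** u = mat 1" using lower_unipotent_inverse[OF gr lu] by blast
  have invu: "invertible u" using u' unfolding invertible_def by blast
  have invg: "invertible g" using g(1) G by blast
  \<comment> \<open>One inclusion suffices: both sides are images of \<open>F p\<close> under
    invertible matrices.\<close>
  have uF: "act u F p = F' p" for p
  proof (rule vec.subspace_dim_equal)
    show "vec.subspace (act u F p)" by (rule subspace_act[OF splits_subspace[OF sp]])
    show "vec.subspace (F' p)" by (rule subF')
    show "vec.dim (F' p) \<le> vec.dim (act u F p)" using invu invg by (simp add: dim_act g(2))
    have mono: "F' a \<subseteq> F' p" if "p \<le> a" for a
      using sp that unfolding g(2) act_def by (intro image_mono) (auto simp: splits_def)
    show "act u F p \<subseteq> F' p"
    proof
      fix x assume "x \<in> act u F p"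
      then obtain w where w: "w \<in> F p" "x = u *v w" by (auto simp: act_def)
      have "x = (\<Sum>a\<in>?I. \<tau> a *v (\<pi> a *v w))" by (simp add: w(2) u_def sum_mul_vec matrix_vector_mul_assoc)
      also have "\<dots> \<in> F' p"
      proof (rule vec.subspace_sum[OF subF'])
        fix a
        show "\<tau> a *v (\<pi> a *v w) \<in> F' p"
        proof (cases "a < p")
          case True
          then have "\<pi> a *v w = 0" using w(1) sp by (simp add: splits_def)
          then show ?thesis using vec.subspace_0[OF subF'] by simp
        next
          case False
          then show ?thesis using mono[of a] \<tau>(1)[of a "\<pi> a *v w"] by auto
        qed
      qed
      finally show "x \<in> F' p" .
    qed
  qed
  have "upper \<pi> (u' ** g)"
    unfolding upper_def
  proof (intro allI impI)
    fix a b :: int assume "a < b"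
    have "\<pi> a *v (u' *v (g *v (\<pi> b *v w))) = 0" for w
    proof -
      have "\<pi> b *v w \<in> F b" using sp by (auto simp: splits_def grading_vec[OF gr])
      then have "g *v (\<pi> b *v w) \<in> act u F b" unfolding uF g(2) by (simp add: act_mem_iff[OF invg])
      then obtain y where "y \<in> F b" "g *v (\<pi> b *v w) = u *v y" by (auto simp: act_def)
      then have "u' *v (g *v (\<pi> b *v w)) \<in> F b" by (simp add: matrix_vector_mul_assoc u')
      then show ?thesis using sp \<open>a < b\<close> by (simp add: splits_def)
    qed
    then show "\<pi> a ** (u' ** g) ** \<pi> b = 0"
      by (simp add: matrix_eq flip: matrix_vector_mul_assoc)
  qed
  moreover have "u ** (u' ** g) \<in> G" using g(1) u' by (simp add: matrix_mul_assoc)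
  ultimately have "u \<in> G" using lower_factor_in_group[OF gr S G one mult circ _ lu] by blast
  then have "v \<in> real_form G" using lower_unipotent_in_real_form[OF gr circ real lu _ v] by blast
  moreover have "F' = act (complexify_matrix v) F" using uF v by (simp add: fun_eq_iff)
  ultimately show ?thesis by blast
qed

section \<open>The topology of the flag variety\<close>

lemma openin_flag_topology: "open U \<Longrightarrow> openin flag_topology {F. (\<lambda>p. closest_point (F p)) \<in> U}"
  unfolding flag_topology_def openin_pullback_topology by auto

lemma topspace_flag_topology [simp]: "topspace flag_topology = UNIV"
  unfolding flag_topology_def topspace_pullback_topology by simp

lemma complex_subspace_imp_subspace:
  assumes "vec.subspace (S :: (complex^'m) set)"
  shows "subspace S"
proof -
  have "r *\<^sub>R v = complex_of_real r *s v" for r and v :: "complex^'m"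
    unfolding vec_eq_iff vector_scaleR_component vector_smult_component by (simp add: scaleR_conv_of_real)
  then show ?thesis using assms by (simp add: vec.subspace_def subspace_def)
qed

lemma closest_point_subspace:
  assumes "vec.subspace (S :: (complex^'m) set)"
  shows "closest_point S v \<in> S" "closest_point S v = v \<longleftrightarrow> v \<in> S" "closed S" "convex S"
proof -
  have S: "closed S" "S \<noteq> {}"
    using complex_subspace_imp_subspace[OF assms] closed_subspace subspace_0 by blast+
  show "closest_point S v \<in> S" by (rule closest_point_in_set[OF S])
  show "closest_point S v = v \<longleftrightarrow> v \<in> S" by (rule closest_point_refl[OF S])
  show "closed S" by (rule S)
  show "convex S" by (rule subspace_imp_convex[OF complex_subspace_imp_subspace[OF assms]])
qed

lemma norm_cnj_vec [simp]: "norm (cnj_vec v) = norm v"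
  by (simp add: norm_vec_def cnj_vec_def)

lemma dist_cnj_vec: "dist (cnj_vec u) (cnj_vec v) = dist u v"
  by (simp add: dist_norm flip: cnj_vec_diff)

text \<open>Conjugation is an isometry and so commutes with the closest point map of a stable
  subspace. This expresses reality by equations in the coordinates that define
  \<open>flag_topology\<close>.\<close>

lemma cnj_stable_iff_closest_point:
  assumes S: "vec.subspace (S :: (complex^'m) set)"
  shows "cnj_vec ` S = S \<longleftrightarrow> (\<forall>v. closest_point S (cnj_vec v) = cnj_vec (closest_point S v))"
proof
  assume st: "cnj_vec ` S = S"
  show "\<forall>v. closest_point S (cnj_vec v) = cnj_vec (closest_point S v)"
  proof
    fix v
    have "cnj_vec (closest_point S v) = closest_point S (cnj_vec v)"
    proof (rule closest_point_unique)
      show "cnj_vec (closest_point S v) \<in> S" using closest_point_subspace(1)[OF S] st by blast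
      show "\<forall>z\<in>S. dist (cnj_vec v) (cnj_vec (closest_point S v)) \<le> dist (cnj_vec v) z"
      proof
        fix z assume "z \<in> S"
        then have "cnj_vec z \<in> S" using st by blast
        then have "dist v (closest_point S v) \<le> dist v (cnj_vec z)"
          by (rule closest_point_le[OF closest_point_subspace(3)[OF S]])
        then show "dist (cnj_vec v) (cnj_vec (closest_point S v)) \<le> dist (cnj_vec v) z"
          using dist_cnj_vec[of v "cnj_vec z"] by (simp add: dist_cnj_vec)
      qed
    qed (use closest_point_subspace[OF S] in auto)
    then show "closest_point S (cnj_vec v) = cnj_vec (closest_point S v)" by simp
  qed
next
  assume "\<forall>v. closest_point S (cnj_vec v) = cnj_vec (closest_point S v)"
  then have "cnj_vec v \<in> S" if "v \<in> S" for v
    using that closest_point_subspace(2)[OF S] by metis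
  then show "cnj_vec ` S = S" by (metis cnj_vec_image_iff cnj_vec_cnj_vec subsetI subset_antisym)
qed

lemma continuous_on_complex_det:
  fixes A :: "'a::topological_space \<Rightarrow> complex^'n^'n"
  assumes "\<And>i j. continuous_on S (\<lambda>x. A x $ i $ j)"
  shows "continuous_on S (\<lambda>x. det (A x))"
  unfolding det_def
  by (intro continuous_on_sum continuous_on_mult continuous_on_const continuous_on_prod assms)

text \<open>With \<open>T\<close> the projection onto \<open>F p\<close> along the opposite space,
  the columns T e_j are replaced by their closest points in \<open>F' p\<close>. At
  \<open>F' = F\<close> the matrix is the identity; in general its columns lie in the sum of
  \<open>F' p\<close> and the opposite space.\<close>

lemma open_transversal:
  fixes T :: "complex^'m^'m"
  shows "openin flag_topology {F'. det (\<chi> i j. (closest_point (F' p) (T *v axis j 1) + (axis j 1 - T *v axis j 1)) $ i) \<noteq> 0}"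
proof -
  let ?\<Phi> = "\<lambda>c::int \<Rightarrow> complex^'m \<Rightarrow> complex^'m. det (\<chi> i j. (c p (T *v axis j 1) + (axis j 1 - T *v axis j 1)) $ i)"
  have co: "continuous_on UNIV (\<lambda>c::int \<Rightarrow> complex^'m \<Rightarrow> complex^'m. c p v)" for v
    by (rule continuous_on_product_then_coordinatewise[OF continuous_on_product_coordinates])
  have "continuous_on UNIV ?\<Phi>"
    by (rule continuous_on_complex_det) (simp, intro continuous_intros continuous_on_component co)
  then have "open {c. ?\<Phi> c \<noteq> 0}" by (intro open_Collect_neq) auto
  then show ?thesis using openin_flag_topology by fastforce
qed

lemma matrix_of_columns_mul_vec: "(\<chi> i j. c j $ i) *v x = (\<Sum>j\<in>UNIV. x $ j *s c j)" for c :: "'m \<Rightarrow> complex^'m"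
  by (simp add: vec_eq_iff matrix_vector_mult_def mult.commute)

text \<open>All columns lie in \<open>F' + E\<close>, so an invertible matrix forces the sum to be
  everything; the intersection is then trivial because \<open>F'\<close> has the dimension of
  \<open>F\<close>.\<close>

lemma transversal_if_det_nonzero:
  fixes T :: "complex^'m^'m"
  assumes det: "det (\<chi> i j. (closest_point F' (T *v axis j 1) + (axis j 1 - T *v axis j 1)) $ i) \<noteq> 0"
    and sub: "vec.subspace F'" "vec.subspace E" "vec.subspace F" and E: "\<And>v. v - T *v v \<in> E"
    and F: "\<And>v. T *v v \<in> F" and FE: "F \<inter> E = {0}" and dim: "vec.dim F' = vec.dim F"
  shows "F' \<inter> E = {0}" "{u + v |u v. u \<in> F' \<and> v \<in> E} = UNIV"
proof -
  define A where "A = (\<chi> i j. (closest_point F' (T *v axis j 1) + (axis j 1 - T *v axis j 1)) $ i)"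
  let ?S = "{u + v |u v. u \<in> F' \<and> v \<in> E}"
  have subS: "vec.subspace ?S" by (rule vec.subspace_sums[OF sub(1,2)])
  have col: "closest_point F' (T *v axis j 1) + (axis j 1 - T *v axis j 1) \<in> ?S" for j
    using closest_point_subspace(1)[OF sub(1)] E by blast
  have AS: "A *v x \<in> ?S" for x
  proof -
    have "A *v x = (\<Sum>j\<in>UNIV. x $ j *s (closest_point F' (T *v axis j 1) + (axis j 1 - T *v axis j 1)))"
      unfolding A_def by (rule matrix_of_columns_mul_vec)
    also have "\<dots> \<in> ?S" using col by (intro vec.subspace_sum[OF subS] vec.subspace_scale[OF subS])
    finally show ?thesis .
  qed
  have "invertible A" using det invertible_det_nz unfolding A_def by blast
  then obtain B where "A ** B = mat 1" unfolding invertible_def by blast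
  then have "A *v (B *v x) = x" for x by (simp add: matrix_vector_mul_assoc)
  then have "x \<in> ?S" for x using AS[of "B *v x"] by (simp only:)
  then show S: "?S = UNIV" by (intro UNIV_eq_I[symmetric])
  have "{u + v |u v. u \<in> F \<and> v \<in> E} = UNIV"
  proof (rule UNIV_eq_I[symmetric])
    fix v
    have "v = T *v v + (v - T *v v)" by simp
    then show "v \<in> {u + v |u v. u \<in> F \<and> v \<in> E}" using E F by blast
  qed
  then have "vec.dim (F' \<inter> E) = vec.dim (F \<inter> E)"
    using vec.dim_sums_Int[OF sub(1,2)] vec.dim_sums_Int[OF sub(3,2)] S dim by simp
  then have "vec.dim (F' \<inter> E) = 0" using FE by simp
  then show "F' \<inter> E = {0}"
    using vec.subspace_0[OF sub(1)] vec.subspace_0[OF sub(2)] by auto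
qed

section \<open>Orbits of real points are closed\<close>

text \<open>An intersection of groups given by equations is given by the union of their equations,
  possibly an infinite set.\<close>

lemma mumford_tate_rat_group:
  assumes "hodge_filtration n F0"
  shows "\<exists>S. rat_group S (mumford_tate_group n F0)"
    and "A \<in> mumford_tate_group n F0 \<Longrightarrow> matrix_inv A \<in> mumford_tate_group n F0"
    and "norm z = 1 \<Longrightarrow> hodge_circle n F0 z \<in> mumford_tate_group n F0"
proof -
  obtain \<pi> where gr: "grading n \<pi>" and hc: "\<And>z. hodge_circle n F0 z = cochar n \<pi> z"
    using hodge_filtration_grading[OF assms] by blast
  define fam where "fam = {H. rat_algebraic_group H \<and> (\<forall>z. norm z = 1 \<longrightarrow> hodge_circle n F0 z \<in> H)}"
  have MT: "mumford_tate_group n F0 = \<Inter> fam" by (simp add: mumford_tate_group_def fam_def)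
  have "\<forall>H\<in>fam. \<exists>S. S \<subseteq> rat_poly_funs \<and> H = {A. invertible A \<and> (\<forall>f\<in>S. f A = 0)}"
    by (simp add: fam_def rat_algebraic_group_def)
  from bchoice[OF this] obtain S where
    S0: "\<forall>H\<in>fam. S H \<subseteq> rat_poly_funs \<and> H = {A. invertible A \<and> (\<forall>f\<in>S H. f A = 0)}" by (rule exE)
  note S = conjunct1[OF bspec[OF S0]] conjunct2[OF bspec[OF S0]]
  \<comment> \<open>The general linear group belongs to the family, the circle operators being
    invertible. So the intersection consists of invertible matrices.\<close>
  have "rat_algebraic_group {A::complex^'m^'m. invertible A}"
    unfolding rat_algebraic_group_def
  proof (intro conjI ballI)
    show "\<exists>S\<subseteq>rat_poly_funs. {A::complex^'m^'m. invertible A} = {A. invertible A \<and> (\<forall>f\<in>S. f A = 0)}"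
      by (rule exI[of _ "{}"]) simp
    fix A :: "complex^'m^'m" assume "A \<in> {A. invertible A}"
    then show "matrix_inv A \<in> {A. invertible A}" using matrix_inv_mult unfolding invertible_def by blast
  qed (auto simp: invertible_mult intro: exI[of _ "mat 1"] simp: invertible_right_inverse[of "mat 1"])
  moreover have "invertible (hodge_circle n F0 z)" if "norm z = 1" for z
    unfolding hc using that by (intro invertible_cochar[OF gr]) auto
  ultimately have GL: "{A. invertible A} \<in> fam" by (simp add: fam_def)
  have group: "mat 1 \<in> H" "A \<in> H \<Longrightarrow> B \<in> H \<Longrightarrow> A ** B \<in> H" "A \<in> H \<Longrightarrow> matrix_inv A \<in> H"
    "norm z = 1 \<Longrightarrow> hodge_circle n F0 z \<in> H" if "H \<in> fam" for H A B z
    using that by (simp_all add: fam_def rat_algebraic_group_def)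
  have "rat_group (\<Union>(S ` fam)) (\<Inter> fam)"
  proof
    show "\<Union>(S ` fam) \<subseteq> rat_poly_funs" using S(1) by blast
    show "\<Inter> fam = {A. invertible A \<and> (\<forall>f\<in>\<Union>(S ` fam). f A = 0)}"
    proof (intro equalityI subsetI)
      fix A assume A: "A \<in> \<Inter> fam"
      then have "f A = 0" if "H \<in> fam" "f \<in> S H" for H f using that S(2)[OF that(1)] by blast
      moreover have "invertible A" using A GL by blast
      ultimately show "A \<in> {A. invertible A \<and> (\<forall>f\<in>\<Union>(S ` fam). f A = 0)}" by blast
    next
      fix A assume A: "A \<in> {A. invertible A \<and> (\<forall>f\<in>\<Union>(S ` fam). f A = 0)}"
      show "A \<in> \<Inter> fam"
      proof
        fix H assume H: "H \<in> fam"
        then have "A \<in> {A. invertible A \<and> (\<forall>f\<in>S H. f A = 0)}" using A by blast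
        then show "A \<in> H" using S(2)[OF H] by simp
      qed
    qed
  qed (use group in auto)
  then show "\<exists>S. rat_group S (mumford_tate_group n F0)" unfolding MT by blast
  show "A \<in> mumford_tate_group n F0 \<Longrightarrow> matrix_inv A \<in> mumford_tate_group n F0"
    "norm z = 1 \<Longrightarrow> hodge_circle n F0 z \<in> mumford_tate_group n F0"
    unfolding MT using group by blast+
qed

lemma grading_complement:
  assumes gr: "grading n \<pi>" and sp: "splits \<pi> F"
  defines "E \<equiv> \<lambda>p. {v. \<forall>a\<ge>p. \<pi> a *v v = 0}" and "T \<equiv> \<lambda>p. \<Sum>a\<in>{p..int n}. \<pi> a"
  shows "T p *v v \<in> F p" "v - T p *v v \<in> E p" "F p \<inter> E p = {0}"
proof -
  have proj: "\<pi> b *v (T p *v v) = (if p \<le> b then \<pi> b *v v else 0)" for b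
  proof -
    have "\<pi> b *v (T p *v v) = (\<Sum>a\<in>{p..int n}. if a = b then \<pi> b *v v else 0)"
      by (auto simp: T_def sum_mul_vec vec.sum grading_vec[OF gr] intro!: sum.cong)
    then show ?thesis by (auto simp: grading_outside[OF gr])
  qed
  show "T p *v v \<in> F p" using sp by (simp add: splits_def proj)
  show "v - T p *v v \<in> E p" by (simp add: E_def matrix_vector_mult_diff_distrib proj)
  have "v = 0" if "v \<in> F p" "v \<in> E p" for v
  proof -
    have "\<pi> a *v v = 0" for a using that sp by (cases "a < p") (auto simp: splits_def E_def)
    then show ?thesis by (subst grading_expand_vec[OF gr]) simp
  qed
  then show "F p \<inter> E p = {0}" using sp by (auto simp: splits_def E_def)
qed

text \<open>
  The orbits of real points are open in the set of all real points of the compact dual, which is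
  closed. So each of them is closed.
\<close>

lemma closed_real_orbit_real_point:
  assumes MT: "mumford_tate_domain n Q F0 G D D'"
    and P: "P \<in> D'" and realP: "\<And>p. cnj_vec ` P p = P p"
  shows "closed_real_orbit G D' (real_orbit G P)"
proof -
  have hf: "hodge_filtration n F0" and GMT: "G = mumford_tate_group n F0" and D': "D' = complex_orbit G F0"
    using MT by (simp_all add: mumford_tate_domain_def polarized_hodge_structure_def)
  obtain S where "rat_group S G" using mumford_tate_rat_group(1)[OF hf] GMT by blast
  then interpret rat_group S G .
  have inv: "matrix_inv A \<in> G" if "A \<in> G" for A using mumford_tate_rat_group(2)[OF hf] that unfolding GMT by blast
  have invertible: "invertible A" if "A \<in> G" for A using that rat_group.G[OF \<open>rat_group S G\<close>] by blast
  have inverse: "A ** matrix_inv A = mat 1" "matrix_inv A ** A = mat 1" if "A \<in> G" for A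
    using matrix_inv_mult[OF invertible[OF that]] by blast+
  obtain \<pi>0 where gr0: "grading n \<pi>0" and sp0: "splits \<pi>0 F0" and circ0: "\<And>z. norm z = 1 \<Longrightarrow> cochar n \<pi>0 z \<in> G"
    using hodge_filtration_grading[OF hf] mumford_tate_rat_group(3)[OF hf] GMT by metis
  have D'_act: "act A F \<in> D'" if "F \<in> D'" "A \<in> G" for A F
    using that mult by (auto simp: D' complex_orbit_def act_act)
  have D'_trans: "\<exists>A\<in>G. F' = act A F" if "F \<in> D'" "F' \<in> D'" for F F'
  proof -
    obtain A B where AB: "A \<in> G" "F = act A F0" "B \<in> G" "F' = act B F0"
      using \<open>F \<in> D'\<close> \<open>F' \<in> D'\<close> by (auto simp: D' complex_orbit_def)
    then have "F' = act (B ** matrix_inv A) F" by (simp add: act_act inverse flip: matrix_mul_assoc)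
    then show ?thesis using AB mult inv by blast
  qed
  have sub: "vec.subspace (F p)" if "F \<in> D'" for F p
    using that subspace_act[OF splits_subspace[OF sp0]] by (auto simp: D' complex_orbit_def)
  define Z where "Z = real_orbit G P"
  have Z: "\<exists>v\<in>real_form G. F = act (complexify_matrix v) P" if "F \<in> Z" for F
    using that by (auto simp: Z_def real_orbit_def)
  have ZD: "Z \<subseteq> D'" using D'_act[OF P] real_form_in by (auto simp: Z_def real_orbit_def)
  have realZ: "cnj_vec ` F p = F p" if FZ: "F \<in> Z" for F p
  proof -
    obtain v where F: "F = act (complexify_matrix v) P" using Z[OF FZ] by blast
    have "cnj_vec ` F p = (*v) (complexify_matrix v) ` cnj_vec ` P p"
      unfolding F act_def image_image cnj_vec_mul using cnj_mat_fixed_iff by metis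
    then show ?thesis by (simp add: realP F act_def)
  qed
  have "\<exists>T. openin (subtopology flag_topology D') T \<and> F \<in> T \<and> T \<subseteq> D' - Z" if F: "F \<in> D' - Z" for F
  proof (cases "\<forall>p. cnj_vec ` F p = F p")
    case False
    \<comment> \<open>At a point that is not real, one projection fails to commute with conjugation
      at one vector, and this persists nearby; points of \<open>Z\<close> are real.\<close>
    then obtain p v where pv: "closest_point (F p) (cnj_vec v) \<noteq> cnj_vec (closest_point (F p) v)"
      using cnj_stable_iff_closest_point sub F by blast
    let ?U = "{c::int \<Rightarrow> complex^'a \<Rightarrow> complex^'a. c p (cnj_vec v) \<noteq> cnj_vec (c p v)}"
    have co: "continuous_on UNIV (\<lambda>c::int \<Rightarrow> complex^'a \<Rightarrow> complex^'a. c p v)" for v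
      by (rule continuous_on_product_then_coordinatewise[OF continuous_on_product_coordinates])
    have "open ?U"
      unfolding cnj_vec_def
      by (intro open_Collect_neq co continuous_on_vec_lambda continuous_on_cnj continuous_on_component)
    then have "openin flag_topology {F. (\<lambda>p. closest_point (F p)) \<in> ?U}" by (rule openin_flag_topology)
    then have "openin (subtopology flag_topology D') (D' \<inter> {F. (\<lambda>p. closest_point (F p)) \<in> ?U})"
      by (rule openin_subtopology_Int2)
    moreover have "F' \<notin> Z" if F': "F' \<in> D' \<inter> {F. (\<lambda>p. closest_point (F p)) \<in> ?U}" for F'
    proof
      assume "F' \<in> Z"
      then have "cnj_vec ` F' p = F' p" by (rule realZ)
      moreover have "vec.subspace (F' p)" using sub F' by simp
      ultimately have "closest_point (F' p) (cnj_vec v) = cnj_vec (closest_point (F' p) v)"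
        using cnj_stable_iff_closest_point by blast
      then show False using F' by simp
    qed
    ultimately show ?thesis using F pv by (intro exI[of _ "D' \<inter> {F. (\<lambda>p. closest_point (F p)) \<in> ?U}"]) auto
  next
    case True
    \<comment> \<open>The Hodge grading of the base point is transported to \<open>F\<close> by
      \<open>A\<close> and then replaced by a real grading.\<close>
    obtain A where A: "A \<in> G" "F = act A F0" using F by (auto simp: D' complex_orbit_def)
    define \<pi>1 where "\<pi>1 a = A ** \<pi>0 a ** matrix_inv A" for a
    have gr1: "grading n \<pi>1" unfolding \<pi>1_def
      by (rule grading_conjugate(1)[OF gr0 inverse(2)[OF A(1)] inverse(1)[OF A(1)]])
    have sp1: "splits \<pi>1 F" unfolding \<pi>1_def A(2)
      by (rule splits_act[OF sp0 inverse(1)[OF A(1)] inverse(2)[OF A(1)]])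
    have circ1: "cochar n \<pi>1 z \<in> G" if "norm z = 1" for z
      unfolding \<pi>1_def grading_conjugate(2)[OF gr0 inverse(2)[OF A(1)] inverse(1)[OF A(1)]]
      using mult[OF mult[OF A(1) circ0[OF that]] inv[OF A(1)]] .
    obtain \<rho> where gr: "grading n \<rho>" and sp: "splits \<rho> F" and circ: "\<And>z. norm z = 1 \<Longrightarrow> cochar n \<rho> z \<in> G"
      and real: "\<And>a. cnj_mat (\<rho> a) = \<rho> a"
      using real_grading_exists[OF gr1 sp1 circ1] True by blast
    define T where "T p = (\<Sum>a\<in>{p..int n}. \<rho> a)" for p
    define E where "E p = {v. \<forall>a\<ge>p. \<rho> a *v v = 0}" for p
    note compl = grading_complement[OF gr sp, folded T_def E_def]
    define \<Phi> where "\<Phi> p F' = det (\<chi> i j. (closest_point (F' p) (T p *v axis j 1) + (axis j 1 - T p *v axis j 1)) $ i)"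
      for p and F' :: "'a filtration"
    \<comment> \<open>A finite intersection, hence open. At the remaining indices the spaces are 0
      or everything and transversality is automatic.\<close>
    define O' where "O' = (\<Inter>p\<in>{0..int n}. {F'. \<Phi> p F' \<noteq> 0})"
    have "openin flag_topology O'" unfolding O'_def \<Phi>_def
      by (intro openin_INT2 open_transversal) auto
    then have op: "openin (subtopology flag_topology D') (D' \<inter> O')" by (rule openin_subtopology_Int2)
    have "\<Phi> p F = 1" for p
    proof -
      have "closest_point (F p) (T p *v axis j 1) = T p *v axis j 1" for j
        by (rule closest_point_self[OF compl(1)])
      then have "\<Phi> p F = det (mat 1 :: complex^'a^'a)"
        unfolding \<Phi>_def by (intro arg_cong[where f = det]) (simp add: vec_eq_iff mat_def axis_def)
      then show ?thesis by simp
    qed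
    then have FO: "F \<in> O'" by (simp add: O'_def)
    have "F' \<notin> Z" if F': "F' \<in> D' \<inter> O'" for F'
    proof
      assume "F' \<in> Z"
      obtain g where g: "g \<in> G" "F' = act g F" using D'_trans F F' by blast
      have dim: "vec.dim (F' p) = vec.dim (F p)" for p using g invertible by (simp add: dim_act)
      have subE: "vec.subspace (E p)" for p unfolding E_def by (rule subspace_opposite)
      have subF: "vec.subspace (F p)" "vec.subspace (F' p)" for p using sub F F' by auto
      have tr: "F' p \<inter> E p = {0} \<and> {u + v |u v. u \<in> F' p \<and> v \<in> E p} = UNIV" for p
      proof (cases "p \<in> {0..int n}")
        case True
        then have "\<Phi> p F' \<noteq> 0" using F' by (auto simp: O'_def)
        then show ?thesis unfolding \<Phi>_def
          using transversal_if_det_nonzero[OF _ subF(2) subE subF(1) compl(2,1,3) dim] by blast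
      next
        case False
        then consider "p < 0" | "p > int n" by force
        then show ?thesis
        proof cases
          case 1
          have "F p = UNIV" using sp 1 by (auto simp: splits_def grading_outside[OF gr])
          then have "F' p = UNIV" using subF dim by (metis vec.dim_eq_span vec.span_eq_iff subset_UNIV vec.subspace_dim_equal vec.subspace_UNIV order_refl)
          moreover have "E p = {0}" using compl(3) \<open>F p = UNIV\<close> by blast
          ultimately show ?thesis by force
        next
          case 2
          have "E p = UNIV" using 2 by (auto simp: E_def grading_outside[OF gr])
          then have "F p = {0}" using compl(3) by blast
          then have "vec.dim (F' p) = 0" using dim[of p] by simp
          then have "F' p = {0}" using vec.subspace_0[OF subF(2)] by auto
          then show ?thesis using \<open>E p = UNIV\<close> by force
        qed
      qed
      \<comment> \<open>\<open>F'\<close> now lies in the real orbits of both \<open>F\<close> and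
        \<open>P\<close>, which puts \<open>F\<close> into \<open>Z\<close>.\<close>
      obtain v where v: "v \<in> real_form G" "F' = act (complexify_matrix v) F"
        using transversal_real_orbit[OF gr sp circ real g realZ[OF \<open>F' \<in> Z\<close>]] tr by (auto simp: E_def)
      obtain w where w: "w \<in> real_form G" "F' = act (complexify_matrix w) P" using Z[OF \<open>F' \<in> Z\<close>] by blast
      obtain v' where v': "v' \<in> real_form G" "v' ** v = mat 1"
        using real_form_inverse[OF mult v(1) inv invertible] by blast
      have "F = act (complexify_matrix (v' ** v)) F" by (simp add: v')
      also have "\<dots> = act (complexify_matrix (v' ** w)) P"
        using v(2) w(2) by (simp add: complexify_mult flip: act_act)
      finally have "F \<in> Z"
        using real_form_mult[OF mult v'(1) w(1)] by (auto simp: Z_def real_orbit_def)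
      then show False using F by blast
    qed
    then show ?thesis using op FO F by (intro exI[of _ "D' \<inter> O'"]) auto
  qed
  then have "openin (subtopology flag_topology D') (D' - Z)"
    using openin_subopen by blast
  then have "closedin (subtopology flag_topology D') Z" using ZD by (simp add: closedin_def)
  then show ?thesis using P by (auto simp: closed_real_orbit_def Z_def)
qed

section \<open>Exponentials of lowering operators\<close>

lemma mat_pow_add: "mat_pow A (j + k) = mat_pow A j ** mat_pow A k"
  by (induction j) (simp_all add: matrix_mul_assoc)

lemma mat_pow_eq_0_mono: "mat_pow A K = 0 \<Longrightarrow> K \<le> k \<Longrightarrow> mat_pow A k = 0"
  using mat_pow_add[of A "k - K" K] by simp

lemma mat_pow_cscale: "mat_pow (mat_cscale z A) k = mat_cscale (z ^ k) (mat_pow A k)"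
  by (induction k) (simp_all add: mat_cscale_mult_left mat_cscale_mult_right power_commutes)

lemma mat_pow_complexify: "mat_pow (complexify_matrix A) k = complexify_matrix (mat_pow A k)"
  by (induction k) (simp_all add: complexify_mult)

lemma scaleR_eq_mat_cscale: "r *\<^sub>R A = mat_cscale (of_real r) A"
  unfolding vec_eq_iff vector_scaleR_component nth_map_matrix by (simp add: scaleR_conv_of_real)

lemma mat_exp_nilpotent:
  assumes "mat_pow A K = 0"
  shows "mat_exp (mat_cscale z A) = (\<Sum>k<K. mat_cscale (z ^ k / fact k) (mat_pow A k))"
proof -
  have "mat_exp (mat_cscale z A) = (\<Sum>k<K. inverse (fact k) *\<^sub>R mat_pow (mat_cscale z A) k)"
    unfolding mat_exp_def
    by (rule suminf_finite) (simp_all add: mat_pow_cscale mat_pow_eq_0_mono[OF assms])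
  also have "\<dots> = (\<Sum>k<K. mat_cscale (z ^ k / fact k) (mat_pow A k))"
    by (intro sum.cong refl)
      (simp add: mat_pow_cscale scaleR_eq_mat_cscale divide_inverse mult.commute)
  finally show ?thesis .
qed

lemma lowering_mat_pow:
  fixes \<rho> :: "int \<Rightarrow> complex^'m^'m"
  assumes "\<And>a. \<rho> a ** N = N ** \<rho> (a + 1)"
  shows "\<rho> a ** mat_pow N k = mat_pow N k ** \<rho> (a + int k)"
proof (induction k arbitrary: a)
  case (Suc k)
  have "\<rho> a ** mat_pow N (Suc k) = N ** (\<rho> (a + 1) ** mat_pow N k)"
    using assms[of a] by (simp add: matrix_mul_assoc)
  then show ?case by (simp add: Suc matrix_mul_assoc algebra_simps)
qed simp

text \<open>
  Vandermonde's identity provides the linear combination of the equations that isolates the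
  component of highest weight.
\<close>

lemma exp_lowering_transversal:
  fixes \<rho> :: "int \<Rightarrow> complex^'m^'m"
  assumes gr: "grading n \<rho>" and low: "\<And>a. \<rho> a ** N = N ** \<rho> (a + 1)" and nil: "mat_pow N K = 0"
    and lefschetz: "\<And>r k v. 2 * r = int n + int k \<Longrightarrow> mat_pow N k *v (\<rho> r *v v) = 0 \<Longrightarrow> \<rho> r *v v = 0"
    and v: "\<And>a. a < p \<Longrightarrow> \<rho> a *v v = 0"
    and ev: "\<And>a. a \<le> int n - p \<Longrightarrow> \<rho> a *v ((\<Sum>k<K. mat_cscale (1 / fact k) (mat_pow N k)) *v v) = 0"
  shows "v = 0"
proof (rule ccontr)
  assume "v \<noteq> 0"
  let ?e = "\<Sum>k<K. mat_cscale (1 / fact k) (mat_pow N k)"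
  define A where "A = {a\<in>{0..int n}. \<rho> a *v v \<noteq> 0}"
  have "A \<noteq> {}"
  proof
    assume "A = {}"
    then have "v = 0" by (subst grading_expand_vec[OF gr]) (auto simp: A_def intro: sum.neutral)
    then show False using \<open>v \<noteq> 0\<close> by simp
  qed
  have finA: "finite A" by (rule finite_subset[of A "{0..int n}"]) (auto simp: A_def)
  define R where "R = Max A"
  have "R \<in> A" using Max_in[OF finA \<open>A \<noteq> {}\<close>] by (simp add: R_def)
  then have R: "\<rho> R *v v \<noteq> 0" by (simp add: A_def)
  have above: "\<rho> a *v v = 0" if "a > R" for a
  proof (rule ccontr)
    assume a: "\<rho> a *v v \<noteq> 0"
    then have "a \<in> {0..int n}" using grading_outside[OF gr, of a] by fastforce
    then have "a \<in> A" using a by (simp add: A_def)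
    then show False using that Max_ge[OF finA, of a] by (simp add: R_def)
  qed
  have "R \<ge> p" using R v by force
  have comp: "\<rho> a *v (?e *v v) = (\<Sum>k<K. (1 / fact k) *s (mat_pow N k *v (\<rho> (a + int k) *v v)))" for a
    by (simp add: sum_mul_vec vec.sum mat_cscale_mul_vec vec.scale matrix_vector_mul_assoc lowering_mat_pow[of \<rho>, OF low])
  have "K > 0"
  proof (rule ccontr)
    assume "\<not> K > 0"
    then have "mat 1 = (0 :: complex^'m^'m)" using nil by simp
    then have "mat 1 *v v = 0 *v v" by (rule arg_cong)
    then show False using \<open>v \<noteq> 0\<close> by simp
  qed
  \<comment> \<open>Otherwise the index \<open>R\<close> is among those at which e^N v has no
    component; but that component is \<open>\<rho> R *v v\<close>, all higher ones of
    \<open>v\<close> being zero.\<close>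
  have Rp: "R + p \<ge> int n"
  proof (rule ccontr)
    assume "\<not> R + p \<ge> int n"
    then have "0 = (\<Sum>k<K. (1 / fact k) *s (mat_pow N k *v (\<rho> (R + int k) *v v)))"
      using ev[of R] comp[of R] by simp
    also have "\<dots> = (\<Sum>k<K. if k = 0 then \<rho> R *v v else 0)"
      by (intro sum.cong) (auto simp: above)
    also have "\<dots> = \<rho> R *v v" using \<open>K > 0\<close> by simp
    finally show False using R by simp
  qed
  \<comment> \<open>Every \<open>w l\<close> lies in the piece n - R. It can be nonzero only for c
    \<le> l \<le> c + d, as \<open>v\<close> has components only between \<open>p\<close> and
    \<open>R\<close>; and \<open>w (c + d)\<close> is N^(2R-n) applied to the component
    \<open>R\<close>, where the Lefschetz hypothesis applies.\<close>
  define c where "c = nat (R + p - int n)"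
  define d where "d = nat (R - p)"
  define w where "w l = mat_pow N l *v (\<rho> (int n - R + int l) *v v)" for l
  define L where "L = c + d + K + 1"
  have cd: "int c = R + p - int n" "int d = R - p" using Rp \<open>R \<ge> p\<close> by (simp_all add: c_def d_def)
  have w_low: "w l = 0" if "l < c" for l using that cd v by (simp add: w_def)
  have w_high: "w l = 0" if "l > c + d" for l using that cd above by (simp add: w_def)
  have w_nil: "w l = 0" if "l \<ge> K" for l by (simp add: w_def mat_pow_eq_0_mono[OF nil that])
  \<comment> \<open>The component n - R + j of e^N v vanishes since n - R + j \<le> n - p. Applying
    N^j brings it into the piece n - R, and division by j! turns 1/(l-j)! into a binomial
    coefficient over l!.\<close>
  have eq: "(\<Sum>l<L. (of_nat (l choose j) / fact l) *s w l) = 0" if "j \<le> d" for j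
  proof -
    have "(0::complex^'m) = mat_pow N j *v (\<rho> (int n - R + int j) *v (?e *v v))"
      using ev[of "int n - R + int j"] that cd by simp
    also have "\<dots> = (\<Sum>k<K. (1 / fact k) *s w (k + j))"
      unfolding comp w_def by (simp add: vec.sum vec.scale matrix_vector_mul_assoc matrix_mul_assoc mat_pow_add add.commute add.left_commute flip: mat_pow_add)
    also have "\<dots> = (\<Sum>l\<in>{j..<K+j}. (1 / fact (l - j)) *s w l)"
      using sum.shift_bounds_nat_ivl[of "\<lambda>l. (1 / fact (l - j)) *s w l" 0 j K] by (simp add: lessThan_atLeast0)
    also have "\<dots> = (\<Sum>l\<in>{j..<K+j}. fact j *s ((of_nat (l choose j) / fact l) *s w l))"
      by (intro sum.cong) (simp_all add: binomial_fact)
    also have "\<dots> = (\<Sum>l<L. fact j *s ((of_nat (l choose j) / fact l) *s w l))"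
    proof (rule sum.mono_neutral_left)
      show "{j..<K + j} \<subseteq> {..<L}" using that by (auto simp: L_def)
      show "\<forall>l\<in>{..<L} - {j..<K + j}. fact j *s ((of_nat (l choose j) / fact l) *s w l) = 0"
      proof
        fix l assume "l \<in> {..<L} - {j..<K + j}"
        then have "l < j \<or> l \<ge> K" by auto
        then show "fact j *s ((of_nat (l choose j) / fact l) *s w l) = 0"
          using w_nil by (auto simp: binomial_eq_0)
      qed
    qed simp
    also have "\<dots> = fact j *s (\<Sum>l<L. (of_nat (l choose j) / fact l) *s w l)"
      by (simp add: vec.scale_sum_right)
    finally show ?thesis using fact_nonzero[of j, where ?'a = complex] by (metis vec.scale_eq_0_iff)
  qed
  \<comment> \<open>The resulting coefficient, l - c choose d, vanishes for c \<le> l < c + d and is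
    1 at l = c + d. The upper argument -c is chosen for this shift.\<close>
  have vander: "(\<Sum>j\<le>d. (- of_nat c gchoose (d - j)) * (of_nat (l choose j) / fact l)) =
      ((of_nat l - of_nat c) gchoose d) / (fact l :: complex)" for l
  proof -
    have "(\<Sum>j\<le>d. (of_nat l gchoose j) * (- of_nat c gchoose (d - j))) = ((of_nat l + - of_nat c) gchoose d :: complex)"
      using gbinomial_Vandermonde[of "of_nat l :: complex" "- of_nat c" d] by (simp only: atLeast0AtMost)
    then have "(\<Sum>j\<le>d. (of_nat l gchoose j) * (- of_nat c gchoose (d - j))) / fact l =
        ((of_nat l - of_nat c) gchoose d) / (fact l :: complex)" by simp
    then show ?thesis by (simp add: sum_divide_distrib binomial_gbinomial mult.commute)
  qed
  have "0 = (\<Sum>j\<le>d. (- of_nat c gchoose (d - j)) *s (\<Sum>l<L. (of_nat (l choose j) / fact l) *s w l))"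
    using eq by simp
  also have "\<dots> = (\<Sum>l<L. \<Sum>j\<le>d. (- of_nat c gchoose (d - j)) *s ((of_nat (l choose j) / fact l) *s w l))"
    unfolding vec.scale_sum_right by (rule sum.swap)
  also have "\<dots> = (\<Sum>l<L. (((of_nat l - of_nat c) gchoose d) / fact l) *s w l)"
    by (simp add: vec.scale_sum_left flip: vander)
  also have "\<dots> = (\<Sum>l<L. if l = c + d then (1 / fact (c + d)) *s w (c + d) else 0)"
  proof (rule sum.cong[OF refl])
    fix l
    consider "l < c" | "c \<le> l" "l < c + d" | "l = c + d" | "l > c + d" by linarith
    then show "(((of_nat l - of_nat c) gchoose d) / fact l) *s w l =
        (if l = c + d then (1 / fact (c + d)) *s w (c + d) else 0)"
    proof cases
      case 2
      then have "((of_nat l - of_nat c) gchoose d :: complex) = of_nat ((l - c) choose d)"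
        by (simp add: binomial_gbinomial of_nat_diff)
      also have "(l - c) choose d = 0" using 2 by (simp add: binomial_eq_0)
      finally show ?thesis using 2 by simp
    next
      case 3
      have "((of_nat d) gchoose d :: complex) = of_nat (d choose d)" by (simp only: binomial_gbinomial)
      then show ?thesis using 3 by simp
    qed (simp_all add: w_low w_high)
  qed
  also have "\<dots> = (1 / fact (c + d)) *s w (c + d)" by (simp add: L_def)
  finally have "w (c + d) = 0" by (metis divide_eq_0_iff fact_nonzero vec.scale_eq_0_iff zero_neq_one)
  moreover have "int n - R + int (c + d) = R" using cd by simp
  ultimately have "mat_pow N (c + d) *v (\<rho> R *v v) = 0" by (simp only: w_def)
  moreover have "2 * R = int n + int (c + d)" using cd by simp
  ultimately show False using lefschetz R by blast
qed

section \<open>The Deligne splitting of Hodge-Tate type\<close>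

lemma bigraded_part_sum:
  assumes sub: "\<And>p q. vec.subspace (I p q)" and v: "v \<in> bigraded_part I P"
  obtains S x where "finite S" "\<And>p q. (p, q) \<in> S \<Longrightarrow> P p q" "\<And>p q. x (p, q) \<in> I p q" "v = (\<Sum>s\<in>S. x s)"
proof -
  have "\<exists>S x. finite S \<and> (\<forall>p q. (p, q) \<in> S \<longrightarrow> P p q) \<and> (\<forall>p q. x (p, q) \<in> I p q) \<and> v = (\<Sum>s\<in>S. x s)"
    using v unfolding bigraded_part_def
  proof (induction rule: vec.span_induct_alt)
    case base
    show ?case by (rule exI[of _ "{}"], rule exI[of _ "\<lambda>_. 0"]) (simp add: vec.subspace_0[OF sub])
  next
    case (step c b y)
    then obtain S x where S: "finite S" "\<forall>p q. (p, q) \<in> S \<longrightarrow> P p q" "\<forall>p q. x (p, q) \<in> I p q" "y = (\<Sum>s\<in>S. x s)"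
      by blast
    obtain p q where pq: "P p q" "b \<in> I p q" using step.hyps by blast
    define x0 where "x0 = (\<lambda>s. if s \<in> S then x s else 0)"
    define x' where "x' = x0((p, q) := c *s b + x0 (p, q))"
    have "x0 (a, b) \<in> I a b" for a b using S(3) vec.subspace_0[OF sub] by (simp add: x0_def)
    then have "\<forall>a b. x' (a, b) \<in> I a b"
      using pq(2) vec.subspace_add[OF sub] vec.subspace_scale[OF sub] by (simp add: x'_def)
    moreover have "sum x' (insert (p, q) S) = c *s b + y"
    proof -
      have "sum x' (insert (p, q) S) = x' (p, q) + sum x' (S - {(p, q)})"
        using S(1) sum.remove[of "insert (p, q) S" "(p, q)" x'] by simp
      also have "sum x' (S - {(p, q)}) = sum x0 (S - {(p, q)})" by (intro sum.cong) (auto simp: x'_def)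
      also have "x' (p, q) = c *s b + x0 (p, q)" by (simp add: x'_def)
      also have "c *s b + x0 (p, q) + sum x0 (S - {(p, q)}) = c *s b + sum x0 S"
        using S(1) by (cases "(p, q) \<in> S") (simp_all add: sum.remove x0_def add.assoc)
      also have "sum x0 S = y" unfolding S(4) by (intro sum.cong) (auto simp: x0_def)
      finally show ?thesis .
    qed
    ultimately show ?case using S(1,2) pq(1) by (intro exI[of _ "insert (p, q) S"] exI[of _ x']) auto
  qed
  then show thesis using that by blast
qed

text \<open>Two expansions of one vector differ by a family with sum zero, whose members vanish by
  directness. The conditions need to exclude each other only on the diagonal, the other pieces being
  zero.\<close>

lemma bigraded_part_diagonal_disjoint:
  assumes big: "bigrading I" and diag: "\<And>p q. p \<noteq> q \<Longrightarrow> I p q = {0}"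
    and disj: "\<And>p. \<not> (P p p \<and> P' p p)"
  shows "bigraded_part I P \<inter> bigraded_part I P' = {0}"
proof -
  have sub: "\<And>p q. vec.subspace (I p q)" using big by (simp add: bigrading_def)
  have ind: "\<And>S x. finite S \<Longrightarrow> (\<forall>(p, q)\<in>S. x (p, q) \<in> I p q) \<Longrightarrow> (\<Sum>s\<in>S. x s) = 0 \<Longrightarrow> (\<forall>s\<in>S. x s = 0)"
    using big by (simp add: bigrading_def)
  have "v = 0" if v: "v \<in> bigraded_part I P" "v \<in> bigraded_part I P'" for v
  proof -
    obtain S x where S: "finite S" "\<And>p q. (p, q) \<in> S \<Longrightarrow> P p q" "\<And>p q. x (p, q) \<in> I p q" "v = (\<Sum>s\<in>S. x s)"
      using bigraded_part_sum[OF sub v(1)] by metis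
    obtain S' y where S': "finite S'" "\<And>p q. (p, q) \<in> S' \<Longrightarrow> P' p q" "\<And>p q. y (p, q) \<in> I p q" "v = (\<Sum>s\<in>S'. y s)"
      using bigraded_part_sum[OF sub v(2)] by metis
    define z where "z s = (if s \<in> S then x s else 0) - (if s \<in> S' then y s else 0)" for s
    have zI: "z (p, q) \<in> I p q" for p q
    proof -
      have "(if (p, q) \<in> S then x (p, q) else 0) \<in> I p q" "(if (p, q) \<in> S' then y (p, q) else 0) \<in> I p q"
        using S(3) S'(3) vec.subspace_0[OF sub] by simp_all
      then show ?thesis unfolding z_def by (rule vec.subspace_diff[OF sub])
    qed
    have zs: "(\<Sum>s\<in>S \<union> S'. z s) = 0"
    proof -
      have "(\<Sum>s\<in>S \<union> S'. z s) = (\<Sum>s\<in>S \<union> S'. if s \<in> S then x s else 0) - (\<Sum>s\<in>S \<union> S'. if s \<in> S' then y s else 0)"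
        by (simp add: z_def sum_subtractf)
      also have "(\<Sum>s\<in>S \<union> S'. if s \<in> S then x s else 0) = v"
        unfolding S(4) using S(1) S'(1) by (intro sum.mono_neutral_cong_right) auto
      also have "(\<Sum>s\<in>S \<union> S'. if s \<in> S' then y s else 0) = v"
        unfolding S'(4) using S(1) S'(1) by (intro sum.mono_neutral_cong_right) auto
      finally show ?thesis by simp
    qed
    have "finite (S \<union> S')" using S(1) S'(1) by simp
    moreover have "\<forall>(p, q)\<in>S \<union> S'. z (p, q) \<in> I p q" using zI by blast
    ultimately have "\<forall>s\<in>S \<union> S'. z s = 0" using zs by (rule ind)
    then have z0: "z s = 0" if "s \<in> S \<union> S'" for s using that by (rule bspec)
    have "x s = 0" if "s \<in> S" for s
    proof -
      obtain p q where s: "s = (p, q)" by fastforce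
      show ?thesis
      proof (cases "p = q")
        case True
        then have "s \<notin> S'" using S(2) S'(2) that disj s by blast
        then show ?thesis using z0[of s] that by (simp add: z_def)
      next
        case False
        then show ?thesis using diag[OF False] S(3)[of p q] s by simp
      qed
    qed
    then show ?thesis using S(4) by simp
  qed
  moreover have "0 \<in> bigraded_part I P" "0 \<in> bigraded_part I P'" unfolding bigraded_part_def by (rule vec.span_zero)+
  ultimately show ?thesis by blast
qed

text \<open>Only the pieces I^(a,a), of even weight 2a, remain: F^p collects those with a \<ge> p
  and W_(2p-1) those with a < p, and no odd weight occurs.\<close>

lemma hodge_tate_opposite:
  assumes "hodge_tate W F"
  shows "vec.subspace (complexify_subspace (W k))" "vec.subspace (F p)"
    "F p \<inter> complexify_subspace (W (2 * p - 1)) = {0}"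
    "{u + v |u v. u \<in> F p \<and> v \<in> complexify_subspace (W (2 * p - 1))} = UNIV"
    "complexify_subspace (W (2 * p + 1)) = complexify_subspace (W (2 * p))"
proof -
  obtain I where I: "deligne_splitting W F I" and diag: "\<And>p q. p \<noteq> q \<Longrightarrow> I p q = {0}"
    using assms by (auto simp: hodge_tate_def)
  have big: "bigrading I" and W: "complexify_subspace (W k) = bigraded_part I (\<lambda>p q. p + q \<le> k)"
    and F: "F p = bigraded_part I (\<lambda>r s. r \<ge> p)" for k p
    using I by (simp_all add: deligne_splitting_def)
  have sub: "vec.subspace (bigraded_part I P)" for P unfolding bigraded_part_def by (rule vec.subspace_span)
  show "vec.subspace (complexify_subspace (W k))" "vec.subspace (F p)" unfolding W F by (rule sub)+
  show "F p \<inter> complexify_subspace (W (2 * p - 1)) = {0}"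
    unfolding W F by (rule bigraded_part_diagonal_disjoint[OF big diag]) auto
  have part: "I a b \<subseteq> bigraded_part I P" if "P a b" for a b P
    unfolding bigraded_part_def using that by (auto intro!: vec.span_base)
  let ?S = "{u + v |u v. u \<in> F p \<and> v \<in> complexify_subspace (W (2 * p - 1))}"
  have subS: "vec.subspace ?S" unfolding W F by (rule vec.subspace_sums[OF sub sub])
  have sum_l: "u \<in> ?S" if "u \<in> F p" for u
    using that vec.subspace_0[OF sub] unfolding W by (intro CollectI exI[of _ u] exI[of _ 0]) simp
  have sum_r: "u \<in> ?S" if "u \<in> complexify_subspace (W (2 * p - 1))" for u
    using that vec.subspace_0[OF sub] unfolding F by (intro CollectI exI[of _ 0] exI[of _ u]) simp
  have "vec.span (\<Union>p q. I p q) \<subseteq> ?S"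
  proof (rule vec.span_minimal[OF _ subS], rule)
    fix x assume "x \<in> (\<Union>p q. I p q)"
    then obtain a b where x: "x \<in> I a b" by blast
    consider "a \<noteq> b" | "a = b" "p \<le> a" | "a = b" "a < p" by linarith
    then show "x \<in> ?S"
    proof cases
      case 1
      then show ?thesis using x diag vec.subspace_0[OF subS] by simp
    next
      case 2
      then have "x \<in> F p" using x part[of "\<lambda>r s. p \<le> r" a b] unfolding F by auto
      then show ?thesis by (rule sum_l)
    next
      case 3
      then have "x \<in> complexify_subspace (W (2 * p - 1))"
        using x part[of "\<lambda>r s. r + s \<le> 2 * p - 1" a b] unfolding W by auto
      then show ?thesis by (rule sum_r)
    qed
  qed
  moreover have "vec.span (\<Union>p q. I p q) = UNIV" using big by (simp add: bigrading_def)
  ultimately have "UNIV \<subseteq> ?S" by (simp only:)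
  then show "?S = UNIV" by (rule top.extremum_uniqueI)
  show "complexify_subspace (W (2 * p + 1)) = complexify_subspace (W (2 * p))"
    unfolding W
  proof
    show "bigraded_part I (\<lambda>a b. a + b \<le> 2 * p) \<subseteq> bigraded_part I (\<lambda>a b. a + b \<le> 2 * p + 1)"
      unfolding bigraded_part_def
    proof (intro vec.span_mono Union_mono Collect_mono impI)
      fix x assume "\<exists>a b. x = I a b \<and> a + b \<le> 2 * p"
      then obtain a b where "x = I a b" "a + b \<le> 2 * p" by (elim exE conjE)
      moreover from this have "a + b \<le> 2 * p + 1" by linarith
      ultimately show "\<exists>a b. x = I a b \<and> a + b \<le> 2 * p + 1" by (intro exI conjI)
    qed
    show "bigraded_part I (\<lambda>a b. a + b \<le> 2 * p + 1) \<subseteq> bigraded_part I (\<lambda>a b. a + b \<le> 2 * p)"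
      unfolding bigraded_part_def[of I "\<lambda>a b. a + b \<le> 2 * p + 1"]
    proof (rule vec.span_minimal[OF _ sub], rule)
      fix x assume "x \<in> \<Union> {I a b |a b. a + b \<le> 2 * p + 1}"
      then obtain a b where x: "x \<in> I a b" "a + b \<le> 2 * p + 1" by blast
      show "x \<in> bigraded_part I (\<lambda>a b. a + b \<le> 2 * p)"
      proof (cases "a = b")
        case True
        then have "a + b \<le> 2 * p" using x(2) by presburger
        then show ?thesis using x(1) part[of "\<lambda>a b. a + b \<le> 2 * p" a b] by blast
      next
        case False
        then show ?thesis using x(1) diag vec.subspace_0[OF sub] by simp
      qed
    qed
  qed
qed

section \<open>The reduced limit period of Hodge-Tate type\<close>

text \<open>Conjugation is only semilinear. It maps spanning sets to spanning sets, which bounds the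
  dimension; as an involution it gives the reverse bound too.\<close>

lemma vec_dim_cnj_image: "vec.dim (cnj_vec ` S) = vec.dim S" for S :: "(complex^'m) set"
proof -
  have le: "vec.dim (cnj_vec ` S) \<le> vec.dim S" for S :: "(complex^'m) set"
  proof -
    obtain B where B: "B \<subseteq> S" "vec.independent B" "S \<subseteq> vec.span B" "card B = vec.dim S"
      by (rule vec.basis_exists)
    have fin: "finite B" using B(2) by (rule vec.finiteI_independent)
    have "cnj_vec v \<in> vec.span (cnj_vec ` B)" if "v \<in> vec.span B" for v
      using that
    proof (induction rule: vec.span_induct_alt)
      case base
      then show ?case using vec.span_zero by simp
    next
      case (step c x y)
      have "cnj_vec x \<in> vec.span (cnj_vec ` B)" by (rule vec.span_base) (use step.hyps in blast)
      then show ?case unfolding cnj_vec_add cnj_vec_scale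
        by (intro vec.span_add vec.span_scale step.IH)
    qed
    then have "cnj_vec ` S \<subseteq> vec.span (cnj_vec ` B)" using B(3) by blast
    then have "vec.dim (cnj_vec ` S) \<le> card (cnj_vec ` B)" using fin by (intro vec.dim_le_card) simp_all
    also have "\<dots> \<le> card B" using fin by (rule card_image_le)
    finally show ?thesis using B(4) by simp
  qed
  have "vec.dim S = vec.dim (cnj_vec ` cnj_vec ` S)" by (simp add: image_image)
  also have "\<dots> \<le> vec.dim (cnj_vec ` S)" by (rule le)
  finally show ?thesis using le[of S] by simp
qed

lemma complexify_mul_vec:
  "Re_vec (complexify_matrix A *v v) = A *v Re_vec v"
  "Im_vec (complexify_matrix A *v v) = A *v Im_vec v"
  by (simp_all add: Re_vec_def Im_vec_def vec_eq_iff matrix_vector_mult_def)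

lemma complexify_zero [simp]: "complexify_matrix 0 = 0"
  by (simp add: vec_eq_iff)

lemma cnj_complexify_subspace:
  assumes "subspace U"
  shows "cnj_vec ` complexify_subspace U = complexify_subspace U"
proof -
  have "cnj_vec v \<in> complexify_subspace U" if "v \<in> complexify_subspace U" for v
  proof -
    have "Re_vec (cnj_vec v) = Re_vec v" "Im_vec (cnj_vec v) = - Im_vec v"
      by (simp_all add: Re_vec_def Im_vec_def cnj_vec_def vec_eq_iff)
    then show ?thesis using that subspace_neg[OF assms] by (simp add: complexify_subspace_def)
  qed
  then show ?thesis by (metis cnj_vec_image_iff cnj_vec_cnj_vec subsetI subset_antisym)
qed

lemma limitin_flag_tendsto:
  assumes "limitin (subtopology flag_topology D') f l \<F>"
  shows "((\<lambda>z. closest_point (f z p) x) \<longlongrightarrow> closest_point (l p) x) \<F>"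
proof (rule topological_tendstoI)
  fix B assume B: "open B" "closest_point (l p) x \<in> B"
  have "open {c :: int \<Rightarrow> complex^'a \<Rightarrow> complex^'a. c p x \<in> B}"
    using open_vimage[OF B(1) continuous_on_product_then_coordinatewise[OF continuous_on_product_coordinates]]
    by (simp add: vimage_def)
  then have "openin flag_topology {F. (\<lambda>p. closest_point (F p)) \<in> {c. c p x \<in> B}}"
    by (rule openin_flag_topology)
  then have "openin (subtopology flag_topology D') (D' \<inter> {F. (\<lambda>p. closest_point (F p)) \<in> {c. c p x \<in> B}})"
    by (rule openin_subtopology_Int2)
  moreover have "l \<in> D'" using assms limitin_topspace by fastforce
  then have "l \<in> D' \<inter> {F. (\<lambda>p. closest_point (F p)) \<in> {c. c p x \<in> B}}" using B(2) by simp
  ultimately have "\<forall>\<^sub>F z in \<F>. f z \<in> D' \<inter> {F. (\<lambda>p. closest_point (F p)) \<in> {c. c p x \<in> B}}"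
    using assms unfolding limitin_def by blast
  then show "\<forall>\<^sub>F z in \<F>. closest_point (f z p) x \<in> B" by (rule eventually_mono) simp
qed

text \<open>\<open>N\<close> shifts the Deligne splitting, which rescales \<open>exp (zN)\<close> to \<open>exp N\<close>.\<close>

lemma exp_rescale:
  fixes \<rho> :: "int \<Rightarrow> complex^'m^'m"
  assumes gr: "grading n \<rho>" and low: "\<And>a. \<rho> a ** N = N ** \<rho> (a + 1)" and z: "z \<noteq> 0"
  defines "D \<equiv> \<Sum>r\<in>{0..int n}. mat_cscale (z powi - r) (\<rho> r)"
  shows "(\<Sum>k<K. mat_cscale (z ^ k / fact k) (mat_pow N k)) ** D = D ** (\<Sum>k<K. mat_cscale (1 / fact k) (mat_pow N k))"
proof -
  have D: "D ** \<rho> a = mat_cscale (z powi - a) (\<rho> a)" "\<rho> a ** D = mat_cscale (z powi - a) (\<rho> a)" for a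
  proof -
    have "D ** \<rho> a = (\<Sum>r\<in>{0..int n}. if r = a then mat_cscale (z powi - a) (\<rho> a) else 0)"
      unfolding D_def matrix_mul_sum_left by (intro sum.cong) (auto simp: mat_cscale_mult_left grading_mult[OF gr])
    then show "D ** \<rho> a = mat_cscale (z powi - a) (\<rho> a)" by (auto simp: grading_outside[OF gr])
    have "\<rho> a ** D = (\<Sum>r\<in>{0..int n}. if r = a then mat_cscale (z powi - a) (\<rho> a) else 0)"
      unfolding D_def matrix_mul_sum_right by (intro sum.cong) (auto simp: mat_cscale_mult_right grading_mult[OF gr])
    then show "\<rho> a ** D = mat_cscale (z powi - a) (\<rho> a)" by (auto simp: grading_outside[OF gr])
  qed
  \<comment> \<open>N^k maps the piece a + k to the piece a, where \<open>D\<close> acts by z^(-a)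
    in place of z^(-a-k).\<close>
  have comm: "D ** mat_pow N k = mat_cscale (z ^ k) (mat_pow N k ** D)" for k
  proof -
    have "\<rho> a ** (D ** mat_pow N k) = \<rho> a ** mat_cscale (z ^ k) (mat_pow N k ** D)" for a
    proof -
      have "\<rho> a ** (D ** mat_pow N k) = mat_cscale (z powi - a) (mat_pow N k ** \<rho> (a + int k))"
        by (simp add: matrix_mul_assoc D mat_cscale_mult_left lowering_mat_pow[of \<rho>, OF low])
      also have "z powi - a = z ^ k * z powi - (a + int k)"
        using z power_int_add[of z "int k" "- (a + int k)"] by simp
      also have "mat_cscale \<dots> (mat_pow N k ** \<rho> (a + int k)) = mat_cscale (z ^ k) (mat_pow N k ** (\<rho> (a + int k) ** D))"
        by (simp add: D mat_cscale_mult_right)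
      also have "\<dots> = \<rho> a ** mat_cscale (z ^ k) (mat_pow N k ** D)"
        by (simp add: matrix_mul_assoc mat_cscale_mult_right lowering_mat_pow[of \<rho>, OF low])
      finally show ?thesis .
    qed
    then show ?thesis
      by (subst grading_expand_left[OF gr, of "D ** mat_pow N k"], subst grading_expand_left[OF gr, of "mat_cscale (z ^ k) (mat_pow N k ** D)"]) simp
  qed
  show ?thesis
    by (simp add: matrix_mul_sum_left matrix_mul_sum_right mat_cscale_mult_left mat_cscale_mult_right comm)
qed

text \<open>With q = n - p + 1, the limit \<open>Finf p\<close> is W_(2q-1), a complexified real
  subspace. For \<open>w\<close> in a piece b < q write w = e^N f + f' with f in F^p and f' in F^q.
  Rescaling by z^b D_z, where D_z acts on the piece r by z^(-r), fixes \<open>w\<close>, sends e^N f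
  into e^(zN) F^p and multiplies the component r of f' by z^(b-r). The latter tends to 0 because r
  \<ge> q > b, so \<open>w\<close> is a limit of vectors of e^(zN) F^p.\<close>

lemma reduced_limit_period_real:
  assumes MT: "mumford_tate_domain n Q F0 G D D'" and lim: "limiting_mhs n G D D' W F N"
    and HT: "hodge_tate W F" and per: "reduced_limit_period D' F N Finf"
  shows "cnj_vec ` Finf p = Finf p"
proof -
  have hf: "hodge_filtration n F0" and GMT: "G = mumford_tate_group n F0" and D': "D' = complex_orbit G F0"
    using MT by (simp_all add: mumford_tate_domain_def polarized_hodge_structure_def)
  obtain S where "rat_group S G" using mumford_tate_rat_group(1)[OF hf] GMT by blast
  then have invG: "invertible A" if "A \<in> G" for A using that rat_group.G by blast
  have hodge: "vec.subspace (F0 p)" "F0 (p + 1) \<subseteq> F0 p" "p \<le> 0 \<Longrightarrow> F0 p = UNIV" "p > int n \<Longrightarrow> F0 p = {0}"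
    "F0 p \<inter> cnj_vec ` F0 (int n - p + 1) = {0}"
    "{u + v |u v. u \<in> F0 p \<and> v \<in> cnj_vec ` F0 (int n - p + 1)} = UNIV" for p
    using hf by (simp_all add: hodge_filtration_def)
  have nil': "nilpotent_mat N" and FD: "F \<in> D'" and NF: "(*v) (complexify_matrix N) ` F p \<subseteq> F (p - 1)" for p
    using lim by (simp_all add: limiting_mhs_def nilpotent_orbit_def)
  have W: "subspace (W k)" "W k \<subseteq> W (k + 1)" "(*v) N ` W k \<subseteq> W (k - 2)" for k
    using lim by (simp_all add: limiting_mhs_def monodromy_weight_filtration_def)
  have Winj: "u \<in> W (int n + int k - 1)" if "u \<in> W (int n + int k)" "mat_pow N k *v u \<in> W (int n - int k - 1)" for k u
    using lim that by (simp add: limiting_mhs_def monodromy_weight_filtration_def)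
  have FinfD: "Finf \<in> D'" using per unfolding reduced_limit_period_def
    using limitin_topspace by fastforce
  let ?N = "complexify_matrix N"
  obtain K where K: "mat_pow ?N K = 0"
    using nil' unfolding nilpotent_mat_def mat_pow_complexify by (metis complexify_zero)
  define E where "E p = complexify_subspace (W (2 * p - 1))" for p
  note opp = hodge_tate_opposite[OF HT, folded E_def]
  have subE: "vec.subspace (E p)" for p unfolding E_def by (rule opp(1))
  have mem: "v \<in> complexify_subspace U \<longleftrightarrow> Re_vec v \<in> U \<and> Im_vec v \<in> U" for v :: "complex^'a" and U
    by (simp add: complexify_subspace_def)
  have incE: "E p \<subseteq> E (p + 1)" for p
  proof -
    have "W (2 * p - 1) \<subseteq> W (2 * p + 1)"
      using W(2)[of "2 * p - 1"] W(2)[of "2 * p"] by auto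
    then show ?thesis unfolding E_def mem complexify_subspace_def by (auto simp: algebra_simps)
  qed
  obtain A where A: "A \<in> G" "F = act A F0" using FD by (auto simp: D' complex_orbit_def)
  obtain A' where A': "A' \<in> G" "Finf = act A' F0" using FinfD by (auto simp: D' complex_orbit_def)
  have dec: "F (p + 1) \<subseteq> F p" for p unfolding A(2) act_def using hodge(2) by (rule image_mono)
  have bot: "F p = UNIV" if "p \<le> 0" for p
  proof -
    have "v \<in> F p" for v
    proof -
      obtain B where "A ** B = mat 1" using invG[OF A(1)] unfolding invertible_def by blast
      then have "v = A *v (B *v v)" by (simp add: matrix_vector_mul_assoc)
      then show ?thesis unfolding A(2) act_def hodge(3)[OF that] by (rule range_eqI)
    qed
    then show ?thesis by blast
  qed
  have top: "F p = {0}" if "p > int n" for p unfolding A(2) act_def hodge(4)[OF that] by simp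
  obtain \<rho> where gr: "grading n \<rho>" and sp: "splits \<rho> F" and E: "\<And>p. E p = {v. \<forall>a\<ge>p. \<rho> a *v v = 0}"
    using grading_from_opposite[of F E n, OF opp(2) subE dec incE opp(3,4) bot top] by blast
  have Fiff: "v \<in> F p \<longleftrightarrow> (\<forall>a<p. \<rho> a *v v = 0)" for v p using sp by (simp add: splits_def)
  have Eiff: "v \<in> E p \<longleftrightarrow> (\<forall>a\<ge>p. \<rho> a *v v = 0)" for v p by (simp add: E)
  \<comment> \<open>N F^b \<subseteq> F^(b-1) excludes a < b - 1, and N W_(2b+1) \<subseteq>
    W_(2b-1) excludes a \<ge> b.\<close>
  have low0: "\<rho> a ** ?N ** \<rho> b = 0" if "b \<noteq> a + 1" for a b
  proof -
    have "\<rho> a *v (?N *v (\<rho> b *v w)) = 0" for w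
    proof (cases "b < a + 1")
      case False
      have "\<rho> b *v w \<in> F b" by (auto simp: Fiff grading_vec[OF gr])
      then have "?N *v (\<rho> b *v w) \<in> F (b - 1)" using NF by blast
      then show ?thesis using False that by (simp add: Fiff)
    next
      case True
      have "\<rho> b *v w \<in> E (b + 1)" by (auto simp: Eiff grading_vec[OF gr])
      then have "?N *v (\<rho> b *v w) \<in> complexify_subspace (W (2 * (b + 1) - 1 - 2))"
        using W(3)[of "2 * (b + 1) - 1"] unfolding E_def mem complexify_mul_vec by blast
      also have "complexify_subspace (W (2 * (b + 1) - 1 - 2)) = E b" by (simp add: E_def)
      finally show ?thesis using True by (simp add: Eiff)
    qed
    then show ?thesis by (simp add: matrix_eq flip: matrix_vector_mul_assoc)
  qed
  have low: "\<rho> a ** ?N = ?N ** \<rho> (a + 1)" for a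
  proof -
    have "\<rho> a ** ?N = (\<Sum>b\<in>{0..int n}. \<rho> a ** ?N ** \<rho> b)" by (rule grading_expand_right[OF gr])
    also have "\<dots> = (\<Sum>b\<in>{0..int n}. if b = a + 1 then \<rho> a ** ?N ** \<rho> (a + 1) else 0)"
      by (intro sum.cong) (auto simp: low0)
    also have "\<dots> = \<rho> a ** ?N ** \<rho> (a + 1)" by (auto simp: grading_outside[OF gr])
    also have "\<dots> = (\<Sum>b\<in>{0..int n}. if b = a then \<rho> a ** ?N ** \<rho> (a + 1) else 0)"
      by (auto simp: grading_outside[OF gr])
    also have "\<dots> = (\<Sum>b\<in>{0..int n}. \<rho> b ** (?N ** \<rho> (a + 1)))"
      by (intro sum.cong) (auto simp: low0 matrix_mul_assoc)
    also have "\<dots> = ?N ** \<rho> (a + 1)" by (rule grading_expand_left[OF gr, symmetric])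
    finally show ?thesis .
  qed
  \<comment> \<open>The piece \<open>r\<close> lies in W_(2r+1) = W_(2r). Injectivity of N^k on the
    quotient by W_(2r-1) puts the vector into \<open>E r\<close>, which has no component
    \<open>r\<close>.\<close>
  have lefschetz: "\<rho> r *v v = 0" if r: "2 * r = int n + int k" and v: "mat_pow ?N k *v (\<rho> r *v v) = 0" for r k v
  proof -
    let ?v = "\<rho> r *v v"
    have "?v \<in> E (r + 1)" by (auto simp: Eiff grading_vec[OF gr])
    then have "?v \<in> complexify_subspace (W (2 * r + 1))" by (simp add: E_def algebra_simps)
    then have "?v \<in> complexify_subspace (W (2 * r))" unfolding opp(5) .
    then have "?v \<in> complexify_subspace (W (int n + int k))" unfolding r .
    then have v1: "Re_vec ?v \<in> W (int n + int k)" "Im_vec ?v \<in> W (int n + int k)" by (simp_all add: mem)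
    have "Re_vec (0 :: complex^'a) = 0" "Im_vec (0 :: complex^'a) = 0"
      by (simp_all add: Re_vec_def Im_vec_def vec_eq_iff)
    then have "mat_pow N k *v Re_vec ?v = 0" "mat_pow N k *v Im_vec ?v = 0"
      using v unfolding mat_pow_complexify by (metis complexify_mul_vec)+
    then have "?v \<in> complexify_subspace (W (int n + int k - 1))"
      using v1 Winj subspace_0[OF W(1)] by (simp add: mem)
    then have "?v \<in> E r" by (simp add: E_def r)
    then have "\<rho> r *v ?v = 0" by (simp add: Eiff)
    then show ?thesis by (simp add: grading_vec[OF gr])
  qed
  let ?e = "\<Sum>k<K. mat_cscale (1 / fact k) (mat_pow ?N k)"
  define q where "q = int n - p + 1"
  have trans: "v = 0" if "v \<in> F p" "?e *v v \<in> F q" for v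
    by (rule exp_lowering_transversal[where p = p, OF gr low K lefschetz]) (use that in \<open>auto simp: Fiff q_def\<close>)
  \<comment> \<open>\<open>F\<close> is not assumed to be a Hodge filtration; its dimensions are
    those of \<open>F0\<close>, which is opposite to its conjugate. They turn the trivial
    intersection supplied by \<open>trans\<close> into a direct sum.\<close>
  have dimsum: "vec.dim (F0 p) + vec.dim (F0 q) = vec.dim (UNIV :: (complex^'a) set)"
    using vec.dim_sums_Int[OF hodge(1)[of p] subspace_cnj_vec_image[OF hodge(1)[of q]]]
      hodge(5)[of p] hodge(6)[of p] by (simp add: q_def vec_dim_cnj_image)
  have dimF: "vec.dim (F r) = vec.dim (F0 r)" "vec.dim (Finf r) = vec.dim (F0 r)" for r
    unfolding A(2) A'(2) by (simp_all add: dim_act invG A(1) A'(1))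
  have eF: "{u + v |u v. u \<in> (*v) ?e ` F p \<and> v \<in> F q} = UNIV"
  proof -
    have inj: "inj_on ((*v) ?e) (F p)"
    proof (rule inj_onI)
      fix x y assume xy: "x \<in> F p" "y \<in> F p" "?e *v x = ?e *v y"
      then have "?e *v (x - y) = 0" by (simp add: matrix_vector_mult_diff_distrib)
      then have "?e *v (x - y) \<in> F q" using vec.subspace_0[OF opp(2)] by simp
      then show "x = y" using trans[of "x - y"] vec.subspace_diff[OF opp(2) xy(1,2)] by simp
    qed
    have sub: "vec.subspace ((*v) ?e ` F p)" by (rule vec.subspace_image[OF opp(2)])
    have dim: "vec.dim ((*v) ?e ` F p) = vec.dim (F p)"
    proof (rule vec.dim_image_eq[OF matrix_vector_mul_linear_gen])
      have "vec.span (F p) = F p" using opp(2) by (rule vec.span_eq_iff[THEN iffD2])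
      then show "inj_on ((*v) ?e) (vec.span (F p))" using inj by (simp only:)
    qed
    have int: "(*v) ?e ` F p \<inter> F q = {0}"
    proof (intro equalityI subsetI)
      fix x assume "x \<in> (*v) ?e ` F p \<inter> F q"
      then obtain v where v: "v \<in> F p" "x = ?e *v v" "?e *v v \<in> F q" by blast
      then have "v = 0" by (intro trans)
      then show "x \<in> {0}" using v(2) by simp
    qed (use vec.subspace_0[OF sub] vec.subspace_0[OF opp(2)] in simp)
    let ?T = "{u + v |u v. u \<in> (*v) ?e ` F p \<and> v \<in> F q}"
    have "vec.dim ?T = vec.dim (UNIV :: (complex^'a) set)"
      using vec.dim_sums_Int[OF sub opp(2), of q] int dim dimsum dimF by simp
    then show ?thesis
      by (intro vec.subspace_dim_equal vec.subspace_sums[OF sub opp(2)] vec.subspace_UNIV) simp_all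
  qed
  have subinf: "vec.subspace (Finf p)" unfolding A'(2) by (rule subspace_act[OF hodge(1)])
  have graded: "w \<in> Finf p" if w: "\<rho> b *v w = w" "b < q" for b w
  proof -
    have "w \<in> {u + v |u v. u \<in> (*v) ?e ` F p \<and> v \<in> F q}" unfolding eF by simp
    then obtain f f' where f: "f \<in> F p" and f': "f' \<in> F q" and wf: "w = ?e *v f + f'" by blast
    \<comment> \<open>A sequence on which Im tends to infinity; \<open>Suc\<close> keeps it away
      from 0, where rescaling breaks down.\<close>
    define z where "z k = \<i> * of_nat (Suc k)" for k
    have z0: "z k \<noteq> 0" for k unfolding z_def by (simp del: of_nat_Suc)
    define Dm where "Dm k = (\<Sum>r\<in>{0..int n}. mat_cscale (z k powi - r) (\<rho> r))" for k
    define y where "y k = z k powi b *s (Dm k *v (?e *v f))" for k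
    define Fk where "Fk k = act (mat_exp (mat_cscale (z k) ?N)) F" for k
    have yF: "y k \<in> Fk k p" for k
    proof -
      have "Dm k *v (?e *v f) = mat_exp (mat_cscale (z k) ?N) *v (Dm k *v f)"
        unfolding mat_exp_nilpotent[OF K] matrix_vector_mul_assoc Dm_def
        by (simp only: exp_rescale[of n \<rho> ?N, OF gr low z0])
      then have "y k = mat_exp (mat_cscale (z k) ?N) *v (z k powi b *s (Dm k *v f))"
        by (simp add: y_def vec.scale)
      moreover have "Dm k *v f \<in> F p"
      proof -
        have "\<rho> a *v (Dm k *v f) = z k powi - a *s (\<rho> a *v f)" for a
        proof -
          have "\<rho> a *v (Dm k *v f) = (\<Sum>r\<in>{0..int n}. if r = a then z k powi - a *s (\<rho> a *v f) else 0)"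
            unfolding Dm_def sum_mul_vec vec.sum
            by (intro sum.cong) (auto simp: mat_cscale_mul_vec vec.scale grading_vec[OF gr])
          then show ?thesis by (auto simp: grading_outside[OF gr])
        qed
        then show ?thesis using f by (simp add: Fiff)
      qed
      then have "z k powi b *s (Dm k *v f) \<in> F p" by (rule vec.subspace_scale[OF opp(2)])
      ultimately show ?thesis unfolding Fk_def act_def by (rule image_eqI)
    qed
    have yeq: "y k = w - (\<Sum>r\<in>{q..int n}. z k powi (b - r) *s (\<rho> r *v f'))" for k
    proof -
      have Dv: "z k powi b *s (Dm k *v v) = (\<Sum>r\<in>{0..int n}. z k powi (b - r) *s (\<rho> r *v v))" for v
        unfolding Dm_def sum_mul_vec vec.scale_sum_right
        using power_int_add[of "z k" b "- _"] z0[of k] by (intro sum.cong) (simp_all add: mat_cscale_mul_vec)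
      have "?e *v f = w - f'" using wf by simp
      then have "y k = z k powi b *s (Dm k *v w) - z k powi b *s (Dm k *v f')"
        by (simp add: y_def matrix_vector_mult_diff_distrib vec.scale_right_diff_distrib)
      also have "z k powi b *s (Dm k *v w) = (\<Sum>r\<in>{0..int n}. if r = b then w else 0)"
      proof -
        have "\<rho> r *v w = (if r = b then w else 0)" for r
          using grading_vec[OF gr, of r b w] w(1) by (simp split: if_splits)
        then show ?thesis unfolding Dv by (intro sum.cong) simp_all
      qed
      also have "\<dots> = w"
        using w(1) grading_outside[OF gr, of b] by auto
      also have "z k powi b *s (Dm k *v f') = (\<Sum>r\<in>{q..int n}. z k powi (b - r) *s (\<rho> r *v f'))"
        unfolding Dv
      proof (rule sum.mono_neutral_cong)
        fix r assume "r \<in> {0..int n} - {q..int n}"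
        then have "r < q" by auto
        then show "z k powi (b - r) *s (\<rho> r *v f') = 0" using f' by (simp add: Fiff)
      next
        fix r assume "r \<in> {q..int n} - {0..int n}"
        then have "\<rho> r = 0" by (intro grading_outside[OF gr]) auto
        then show "z k powi (b - r) *s (\<rho> r *v f') = 0" by simp
      qed auto
      finally show ?thesis .
    qed
    have lim_Suc: "filterlim (\<lambda>k. real (Suc k)) at_top sequentially"
      by (rule filterlim_compose[OF filterlim_real_sequentially filterlim_Suc])
    have pow0: "(\<lambda>k. z k powi (b - r)) \<longlonglongrightarrow> 0" if "r \<in> {q..int n}" for r
    proof -
      have "filterlim (\<lambda>k. norm (z k)) at_top sequentially"
        using lim_Suc by (simp add: z_def norm_mult del: of_nat_Suc)
      then have inf: "filterlim z at_infinity sequentially" by (rule filterlim_norm_at_top_imp_at_infinity)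
      have "(\<lambda>k. inverse (z k) ^ nat (r - b)) \<longlonglongrightarrow> 0 ^ nat (r - b)"
        by (intro tendsto_power filterlim_compose[OF tendsto_inverse_0 inf])
      moreover have "0 ^ nat (r - b) = (0::complex)" using that w(2) by simp
      moreover have "z k powi (b - r) = inverse (z k) ^ nat (r - b)" for k
        using that w(2) by (simp add: power_int_def)
      ultimately show ?thesis by simp
    qed
    have "y \<longlonglongrightarrow> w"
    proof (rule vec_tendstoI)
      fix i
      have "(\<lambda>k. w $ i - (\<Sum>r\<in>{q..int n}. z k powi (b - r) * (\<rho> r *v f') $ i))
          \<longlonglongrightarrow> w $ i - (\<Sum>r\<in>{q..int n}. 0 * (\<rho> r *v f') $ i)"
        by (intro tendsto_intros pow0)
      then show "(\<lambda>k. y k $ i) \<longlonglongrightarrow> w $ i" by (simp add: yeq)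
    qed
    then have dist0: "(\<lambda>k. dist w (y k)) \<longlonglongrightarrow> 0"
      using tendsto_dist[OF tendsto_const[of w]] by fastforce
    \<comment> \<open>Convergence of flags is convergence of closest points, so it suffices that
      \<open>Fk k p\<close> contains vectors \<open>y k\<close> tending to \<open>w\<close>.\<close>
    have close: "dist (closest_point (Fk k p) w) w \<le> dist w (y k)" for k
    proof -
      have "vec.subspace (Fk k p)" unfolding Fk_def by (rule subspace_act[OF opp(2)])
      then show ?thesis
        using closest_point_le[OF closest_point_subspace(3) yF] by (simp add: dist_commute)
    qed
    have "(\<lambda>k. dist (closest_point (Fk k p) w) w) \<longlonglongrightarrow> 0"
      by (rule tendsto_sandwich[OF _ _ tendsto_const dist0]) (use close in auto)
    then have lim1: "(\<lambda>k. closest_point (Fk k p) w) \<longlonglongrightarrow> w" by (subst tendsto_dist_iff)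
    have zlim: "filterlim z (filtercomap Im at_top) sequentially"
      unfolding filterlim_filtercomap_iff using lim_Suc by (simp add: z_def o_def del: of_nat_Suc)
    have "((\<lambda>z. closest_point (act (mat_exp (mat_cscale z ?N)) F p) w) \<longlongrightarrow> closest_point (Finf p) w) (filtercomap Im at_top)"
      using per unfolding reduced_limit_period_def by (rule limitin_flag_tendsto)
    then have "(\<lambda>k. closest_point (Fk k p) w) \<longlonglongrightarrow> closest_point (Finf p) w"
      unfolding Fk_def using zlim by (rule filterlim_compose)
    then have "closest_point (Finf p) w = w" using lim1 by (rule LIMSEQ_unique)
    then show ?thesis using closest_point_subspace(2)[OF subinf] by blast
  qed
  \<comment> \<open>The graded pieces give one inclusion. Both dimensions complement that of F^q,
    one by the opposition of \<open>F\<close> and \<open>E\<close>, the other by that of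
    \<open>F0\<close> and its conjugate.\<close>
  have "E q = Finf p"
  proof (rule vec.subspace_dim_equal[OF subE subinf])
    show "E q \<subseteq> Finf p"
    proof
      fix w assume w: "w \<in> E q"
      have "\<rho> b *v w \<in> Finf p" for b
      proof (cases "b < q")
        case True
        then show ?thesis by (intro graded[of b]) (simp_all add: grading_vec[OF gr])
      next
        case False
        then have "\<rho> b *v w = 0" using w by (simp add: Eiff)
        then show ?thesis using vec.subspace_0[OF subinf] by simp
      qed
      then have "(\<Sum>b\<in>{0..int n}. \<rho> b *v w) \<in> Finf p" by (intro vec.subspace_sum[OF subinf])
      then show "w \<in> Finf p" using grading_expand_vec[OF gr, of w] by simp
    qed
    have "vec.dim (F q) + vec.dim (E q) = vec.dim (UNIV :: (complex^'a) set)"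
      using vec.dim_sums_Int[OF opp(2)[of q] subE[of q]] opp(3)[of q] opp(4)[of q] by simp
    then show "vec.dim (Finf p) \<le> vec.dim (E q)" using dimsum dimF by simp
  qed
  moreover have "cnj_vec ` E q = E q" unfolding E_def by (rule cnj_complexify_subspace[OF W(1)])
  ultimately show ?thesis by simp
qed

theorem proposition1p15:
  fixes n :: nat
    and Q :: "real^'m \<Rightarrow> real^'m \<Rightarrow> real"
    and G :: "(complex^'m^'m) set"
    and F0 F Finf :: "'m::finite filtration"
    and D D' :: "'m filtration set"
    and W :: "int \<Rightarrow> (real^'m) set"
    and N :: "real^'m^'m"
  assumes "mumford_tate_domain n Q F0 G D D'"
    and "limiting_mhs n G D D' W F N"
    and "hodge_tate W F"
    and "reduced_limit_period D' F N Finf"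
  shows "\<exists>Z. closed_real_orbit G D' Z \<and> Finf \<in> Z"
proof (intro exI conjI)
  have D': "D' = complex_orbit G F0" and GMT: "G = mumford_tate_group n F0" and hf: "hodge_filtration n F0"
    using assms(1) by (simp_all add: mumford_tate_domain_def polarized_hodge_structure_def)
  have "Finf \<in> D'" using assms(4) unfolding reduced_limit_period_def
    using limitin_topspace by fastforce
  \<comment> \<open>The closed orbit is exhibited as the real orbit of \<open>Finf\<close> itself, a
    real point.\<close>
  then show "closed_real_orbit G D' (real_orbit G Finf)"
    using closed_real_orbit_real_point[OF assms(1)] reduced_limit_period_real[OF assms] by blast
  obtain S where "rat_group S G" using mumford_tate_rat_group(1)[OF hf] GMT by blast
  then have "mat 1 \<in> real_form G" by (intro one_in_real_form rat_group.one)
  then show "Finf \<in> real_orbit G Finf"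
    unfolding real_orbit_def by (intro CollectI exI[of _ "mat 1"]) simp
qed

end
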